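(* Let $G$ be a finite abelian group of order $v$ and suppose there exists a $(v,m,k,\lambda)$-SEDF in $G$ with $m\geq 3$. Let $d>2$ be an integer with $d\mid\exp(G)$, and let $t$ be the number of distinct prime divisors of $d$. Then $$\lambda\leq\frac{(2^{t-1}v)^2\cdot F(d,\lambda)^2}{4d^2\cdot\varphi(F(d,\lambda))}.$$
   Context: Let $G$ be a finite abelian group of order $v$ with identity $e$. A $(v,m,k,\lambda)$-SEDF in $G$ is a collection $\{D_1,\dots,D_m\}$ of pairwise disjoint $k$-subsets of $G$ such that for each $j$ the multiset $\{xy^{-1}: x\in D_\ell,\ y\in D_j,\ \ell\neq j\}$ contains every non-identity element of $G$ exactly $\lambda$ times and does not contain $e$. $\exp(G)$ is the lcm of element orders; $\varphi$ is Euler's function; $\mathrm{ord}_a(q)$ is the multiplicative order of $q$ modulo $a$. Schmidt's function $F(M,N)$: let $M=\prod_{i=1}^t p_i^{c_i}$ be the prime factorization of $M$. For each prime divisor $q$ of $N$, let $m_q=\prod_{p_i\neq q}p_i$ if $M$ is odd or $q=2$, and $m_q=4\prod_{p_i\neq 2,q}p_i$ otherwise. Then $F(M,N)=\prod_{i=1}^t p_i^{b_i}$ is the smallest multiple of $\prod_{i=1}^t p_i$ (with $1\le b_i\le c_i$) such that for every pair $(i,q)$ with $i\in\{1,\dots,t\}$ and $q$ a prime divisor of $N$, at least one of: (1) $q=p_i$ and $(p_i,b_i)\neq(2,1)$; (2) $b_i=c_i$; (3) $q\neq p_i$ and $q^{\mathrm{ord}_{m_q}(q)}\not\equiv1\pmod{p_i^{b_i+1}}$.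 By convention $F(M,1)=1$.
   Formalization: The formal theorem also assumes k ≠ 1, excluding the trivial SEDF of all singletons of G (λ = 1); there the claim can fail, e.g. G = Z_3, d = 3, F(3,1) = 1 gives 1 ≤ 1/4. *)

theory Defs
  imports "HOL-Number_Theory.Number_Theory"
begin

definition external_differences ::
    "('a, 'b) monoid_scheme \<Rightarrow> nat \<Rightarrow> (nat \<Rightarrow> 'a set) \<Rightarrow> nat \<Rightarrow> 'a multiset" where
  "external_differences G m D j =
     image_mset (\<lambda>(l, x, y). x \<otimes>\<^bsub>G\<^esub> inv\<^bsub>G\<^esub> y)
       (mset_set (SIGMA l:{1..m} - {j}. D l \<times> D j))"

text \<open>
  A family \<open>D 1, \<dots>, D m\<close>; the values of \<open>D\<close> outside \<open>{1..m}\<close> are irrelevant.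
\<close>

definition SEDF ::
    "('a, 'b) monoid_scheme \<Rightarrow> nat \<Rightarrow> nat \<Rightarrow> nat \<Rightarrow> nat \<Rightarrow> (nat \<Rightarrow> 'a set) \<Rightarrow> bool" where
  "SEDF G v m k lam D \<longleftrightarrow>
     order G = v \<and>
     (\<forall>j\<in>{1..m}. D j \<subseteq> carrier G \<and> finite (D j) \<and> card (D j) = k) \<and>
     (\<forall>i\<in>{1..m}. \<forall>j\<in>{1..m}. i \<noteq> j \<longrightarrow> D i \<inter> D j = {}) \<and>
     (\<forall>j\<in>{1..m}.
        (\<forall>g\<in>carrier G - {\<one>\<^bsub>G\<^esub>}. count (external_differences G m D j) g = lam) \<and>
        \<one>\<^bsub>G\<^esub> \<notin># external_differences G m D j)"

definition group_exp :: "('a, 'b) monoid_scheme \<Rightarrow> nat" where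
  "group_exp G = Lcm (group.ord G ` carrier G)"

definition schmidt_m :: "nat \<Rightarrow> nat \<Rightarrow> nat" where
  "schmidt_m M q =
     (if odd M \<or> q = 2 then \<Prod>(prime_factors M - {q})
      else 4 * \<Prod>(prime_factors M - {2, q}))"

text \<open>
  \<open>b\<close> assigns to each prime divisor \<open>p\<close> of \<open>M\<close> its exponent in the candidate for \<open>F(M,N)\<close>;
  the exponent of \<open>p\<close> in \<open>M\<close> itself is \<open>multiplicity p M\<close>. The term \<open>ord n q\<close> is the
  multiplicative order of \<open>q\<close> modulo \<open>n\<close>.
\<close>

definition schmidt_admissible :: "nat \<Rightarrow> nat \<Rightarrow> (nat \<Rightarrow> nat) \<Rightarrow> bool" where
  "schmidt_admissible M N b \<longleftrightarrow>
     (\<forall>p\<in>prime_factors M. 1 \<le> b p \<and> b p \<le> multiplicity p M) \<and>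
     (\<forall>p\<in>prime_factors M. \<forall>q. prime q \<and> q dvd N \<longrightarrow>
        (q = p \<and> (p, b p) \<noteq> (2, 1)) \<or>
        b p = multiplicity p M \<or>
        (q \<noteq> p \<and> \<not> [q ^ ord (schmidt_m M q) q = 1] (mod p ^ (b p + 1))))"

definition schmidt_F :: "nat \<Rightarrow> nat \<Rightarrow> nat" where
  "schmidt_F M N =
     (if N = 1 then 1
      else LEAST f. \<exists>b. schmidt_admissible M N b \<and> f = (\<Prod>p\<in>prime_factors M. p ^ b p))"

end

theory Submission
  imports Defs "Jordan_Normal_Form.Char_Poly"
begin

text \<open>
  Choose a character of order \<open>d\<close> and let \<open>z j\<close> be its sum over \<open>D j\<close>. The defining equation
  gives \<open>((\<Sum>l. z l) - z j) * cnj (z j) = - lam\<close> for all \<open>j\<close>; for \<open>m > 2\<close> this forces some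
  \<open>(norm (z j))\<^sup>2\<close> to be an integer \<open>n \<ge> lam\<close> dividing \<open>lam\<^sup>2\<close>. Schmidt's field descent then shows
  that \<open>z j\<close> is, up to a root of unity, an integer combination of \<open>F\<close>-th roots of unity with
  coefficients between 0 and \<open>v / d\<close>, where \<open>F = schmidt_F d lam\<close>. All its conjugates over these
  roots have absolute value \<open>sqrt n\<close>, so Parseval's identity bounds \<open>n\<close>.

  The descent is carried out without ideal theory. If \<open>\<sigma>\<close> acts like a power of Frobenius modulo
  each prime \<open>q\<close> dividing \<open>n = X * cnj X\<close>, a direct congruence argument shows that \<open>n\<close> divides
  \<open>\<sigma> X * cnj X\<close>. The quotient has absolute value 1 at all conjugates, hence is a root of unity
  by Kronecker's theorem.
\<close>

section \<open>Geometric sums and powers modulo N\<close>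

text \<open>The integer \<open>n\<close> depends on the family, while the bound may depend only on
  \<open>lam\<close>. Dividing \<open>lam\<^sup>2\<close> keeps the primes of \<open>n\<close> among
  those of \<open>lam\<close>, and \<open>schmidt_F d lam\<close> is built so that, for each of
  these primes \<open>q\<close>, the one automorphism z -> z^(1 + F) acts as a power of Frobenius
  modulo the \<open>q\<close>-free part of \<open>d\<close>. One automorphism suffices, since the
  powers of 1 + F give every residue modulo \<open>d\<close> that is 1 modulo F. In the final bound,
  v / d is the size of the fibres of the character, the totient counts the values in Parseval's
  identity known to have absolute value sqrt n, and 4 comes from centring the coefficients at half
  their maximum. The value \<open>lam = 1\<close>, where \<open>schmidt_F\<close> is 1 by
  convention, falls outside the descent and is ruled out combinatorially: for m >= 3 it forces k <=
  1. The case k = 1 is a genuine exception: the singletons of a cyclic group of prime power order v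
  > 2 form a family with m = v and lam = 1, and for d = v the right-hand side is 1/4.\<close>

lemma geometric_sum_add:
  fixes x :: "'a::comm_semiring_1"
  shows "(\<Sum>i<a + b. x ^ i) = (\<Sum>i<a. x ^ i) + x ^ a * (\<Sum>i<b. x ^ i)"
  by (induction b) (auto simp: algebra_simps power_add)

lemma geometric_sum_mult:
  fixes x :: "'a::comm_semiring_1"
  shows "(\<Sum>i<a * b. x ^ i) = (\<Sum>i<a. x ^ i) * (\<Sum>i<b. (x ^ a) ^ i)"
proof (induction b)
  case (Suc b)
  have "(\<Sum>i<a * Suc b. x ^ i) = (\<Sum>i<a * b + a. x ^ i)" by (simp add: add.commute)
  then show ?case
    unfolding geometric_sum_add Suc by (simp add: algebra_simps power_mult)
qed simp

lemma geometric_sum_mult_nat: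
  fixes x :: nat
  assumes "x \<ge> 1"
  shows "(x - 1) * (\<Sum>i<n. x ^ i) = x ^ n - 1"
proof (induction n)
  case (Suc n)
  have "1 \<le> x ^ n" using assms by simp
  moreover have "x ^ n \<le> x * x ^ n" using assms by simp
  ultimately show ?case using Suc by (simp add: distrib_left diff_mult_distrib)
qed simp

text \<open>Modulo p^2 the powers of x = 1 + p y are 1 + i p y, so the sum is p + p y (0 + ... + (p
  - 1)). For odd p the inner sum is divisible by p. For p = 2 the sum is 1 + x, and
  \<open>two\<close> is needed to make it 2 modulo 4.\<close>

lemma multiplicity_geometric_sum_prime:
  fixes p x :: nat
  assumes p: "prime p" and x: "[x = 1] (mod p)" and two: "p = 2 \<Longrightarrow> [x = 1] (mod 4)"
    and "x \<ge> 1"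
  shows "multiplicity p (\<Sum>i<p. x ^ i) = 1"
proof -
  obtain y where y: "x = 1 + p * y"
    using x \<open>x \<ge> 1\<close> by (metis cong_to_1_nat dvdE le_add_diff_inverse mult.commute)
  have bin: "\<exists>c. x ^ i = 1 + i * p * y + p\<^sup>2 * c" for i
  proof (induction i)
    case 0
    have "x ^ 0 = 1 + 0 * p * y + p\<^sup>2 * 0" by simp
    then show ?case by blast
  next
    case (Suc i)
    then obtain c where c: "x ^ i = 1 + i * p * y + p\<^sup>2 * c" by blast
    have "x ^ Suc i = 1 + Suc i * p * y + p\<^sup>2 * (c + i * y * y + p * y * c)"
      unfolding power_Suc c by (simp add: y algebra_simps power2_eq_square)
    then show ?case by blast
  qed
  then obtain c where c: "\<And>i. x ^ i = 1 + i * p * y + p\<^sup>2 * c i" by metis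
  have S: "(\<Sum>i<p. x ^ i) = p + p * y * (\<Sum>i<p. i) + p\<^sup>2 * (\<Sum>i<p. c i)"
    unfolding c sum.distrib by (simp add: sum_distrib_left sum_distrib_right mult_ac)
  have "p dvd y * (\<Sum>i<p. i)"
  proof (cases "p = 2")
    case True
    have "4 dvd x - 1" using two[OF True] \<open>x \<ge> 1\<close> by (metis cong_to_1_nat)
    then have "2 dvd y" using y True by simp
    then show ?thesis using True by simp
  next
    case False
    have "2 * (\<Sum>i<Suc n. i) = Suc n * n" for n :: nat by (induction n) auto
    from this[of "p - 1"] have "p dvd 2 * (\<Sum>i<p. i)" using prime_gt_0_nat[OF p] by simp
    then have "p dvd (\<Sum>i<p. i)"
      using p False by (metis prime_dvd_mult_iff primes_dvd_imp_eq two_is_prime_nat)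
    then show ?thesis by simp
  qed
  then obtain e where e: "y * (\<Sum>i<p. i) = p * e" by blast
  have S': "(\<Sum>i<p. x ^ i) = p * (1 + p * (e + (\<Sum>i<p. c i)))"
    using S e by (simp add: algebra_simps power2_eq_square)
  have "\<not> p dvd 1 + p * (e + (\<Sum>i<p. c i))"
    using p by (subst dvd_add_left_iff) auto
  then have "multiplicity p (1 + p * (e + (\<Sum>i<p. c i))) = 0"
    by (rule not_dvd_imp_multiplicity_0)
  moreover have "p \<noteq> 0" "\<not> is_unit p" using p by auto
  ultimately show ?thesis unfolding S' by (subst multiplicity_times_same) auto
qed

text \<open>Lifting the exponent. A factor p of n splits the sum into one of length p, which
  contributes exactly one p, and a shorter one in x^p; once p no longer divides n, the sum is n
  modulo p.\<close>

lemma multiplicity_geometric_sum: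
  fixes p x n :: nat
  assumes p: "prime p" and "n > 0"
    and "[x = 1] (mod p)" "p = 2 \<Longrightarrow> odd n \<or> [x = 1] (mod 4)" "x \<ge> 1"
  shows "multiplicity p (\<Sum>i<n. x ^ i) = multiplicity p n"
  using assms(2-)
proof (induction n arbitrary: x rule: less_induct)
  case (less n)
  have Spos: "(\<Sum>i<n'. x' ^ i) > 0" if "x' \<ge> 1" "n' > 0" for x' n' :: nat
    using that by (intro sum_pos) auto
  show ?case
  proof (cases "p dvd n")
    case False
    have "[(\<Sum>i<n. x ^ i) = (\<Sum>i<n. 1 ^ i)] (mod p)"
      by (intro cong_sum cong_pow less.prems)
    then have "\<not> p dvd (\<Sum>i<n. x ^ i)" using False by (simp add: cong_dvd_iff)
    then show ?thesis using False by (simp add: not_dvd_imp_multiplicity_0)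
  next
    case True
    then obtain n' where n': "n = p * n'" by blast
    have "n' > 0" "n' < n" using less.prems n' prime_gt_1_nat[OF p] by (auto intro: Nat.gr0I)
    have four: "p = 2 \<Longrightarrow> [x = 1] (mod 4)" using less.prems(3) n' by auto
    have "multiplicity p (\<Sum>i<n'. (x ^ p) ^ i) = multiplicity p n'"
    proof (rule less.IH)
      show "[x ^ p = 1] (mod p)" using less.prems(2) by (metis cong_pow power_one)
      show "odd n' \<or> [x ^ p = 1] (mod 4)" if "p = 2"
        using four[OF that] by (metis cong_pow power_one)
    qed (use \<open>n' > 0\<close> \<open>n' < n\<close> less.prems in auto)
    moreover have "multiplicity p (\<Sum>i<p. x ^ i) = 1"
      using multiplicity_geometric_sum_prime[OF p less.prems(2) four less.prems(4)] .
    moreover have "multiplicity p p = 1"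
      using p by (simp add: multiplicity_prime)
    moreover have "multiplicity p n = multiplicity p p + multiplicity p n'"
      unfolding n' using \<open>n' > 0\<close> p by (intro prime_elem_multiplicity_mult_distrib) auto
    moreover have "(\<Sum>i<p. x ^ i) \<noteq> 0" "(\<Sum>i<n'. (x ^ p) ^ i) \<noteq> 0"
      using Spos[of x p] Spos[of "x ^ p" n'] \<open>n' > 0\<close> \<open>x \<ge> 1\<close> prime_gt_0_nat[OF p] by auto
    then have "multiplicity p (\<Sum>i<n. x ^ i)
        = multiplicity p (\<Sum>i<p. x ^ i) + multiplicity p (\<Sum>i<n'. (x ^ p) ^ i)"
      unfolding n' geometric_sum_mult using p by (intro prime_elem_multiplicity_mult_distrib) auto
    ultimately show ?thesis by simp
  qed
qed

text \<open>
  The powers of \<open>x\<close> are counted: \<open>x\<close> has order \<open>N div gcd (x - 1) N\<close> modulo \<open>N\<close>,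
  which is also the number of residues congruent to 1 modulo \<open>gcd (x - 1) N\<close>.
\<close>

lemma power_cong_exists:
  fixes x y N :: nat
  assumes "N > 0" "x \<ge> 1"
    and px: "\<And>p. prime p \<Longrightarrow> p dvd N \<Longrightarrow> [x = 1] (mod p)"
    and four: "4 dvd N \<Longrightarrow> [x = 1] (mod 4)"
    and y: "[y = 1] (mod gcd (x - 1) N)"
  shows "\<exists>k. [x ^ k = y] (mod N)"
proof -
  define g where "g = gcd (x - 1) N"
  define n where "n = N div g"
  have "g > 0" using \<open>N > 0\<close> by (simp add: g_def)
  have Ng: "N = g * n" by (simp add: n_def g_def)
  then have "n > 0" using \<open>N > 0\<close> by (auto intro: Nat.gr0I)
  obtain x' where x': "x - 1 = g * x'" unfolding g_def by (metis dvdE gcd_dvd1)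
  have "g * gcd x' n = gcd (g * x') (g * n)" by (rule gcd_mult_distrib_nat)
  also have "\<dots> = g" using Ng x' g_def by simp
  finally have "g * gcd x' n = g" .
  then have "gcd x' n = 1" using \<open>g > 0\<close> by simp
  then have cop: "coprime x' n" by (simp only: coprime_iff_gcd_eq_1)
  have copx: "coprime x N"
  proof (rule ccontr)
    assume "\<not> coprime x N"
    then have "gcd x N \<noteq> 1" by (simp only: coprime_iff_gcd_eq_1 not_False_eq_True)
    then obtain p where "prime p" "p dvd gcd x N" using prime_factor_nat by blast
    then have p: "prime p" "p dvd x" "p dvd N" by auto
    then have "[x = 1] (mod p)" using px by blast
    then have "p dvd 1" using p(2) cong_dvd_iff by blast
    then show False using p by simp
  qed
  \<comment> \<open>From \<open>N dvd x ^ k - 1\<close>, cancelling \<open>g\<close> and the factor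
    \<open>x'\<close> prime to \<open>n\<close> leaves \<open>n\<close> dividing the geometric sum
    of length \<open>k\<close>. By lifting the exponent this sum has the same p-part as
    \<open>k\<close> for every prime p dividing \<open>n\<close>.\<close>
  have key: "n dvd k" if "[x ^ k = 1] (mod N)" for k
  proof (cases "k = 0")
    case False
    have "N dvd x ^ k - 1" using that by (metis cong_to_1_nat)
    then have "g * n dvd g * (x' * (\<Sum>i<k. x ^ i))"
      using geometric_sum_mult_nat[OF \<open>x \<ge> 1\<close>, of k] Ng x' by (simp add: mult.assoc)
    then have "n dvd x' * (\<Sum>i<k. x ^ i)" using \<open>g > 0\<close> by simp
    then have nS: "n dvd (\<Sum>i<k. x ^ i)"
      using cop by (simp add: coprime_dvd_mult_right_iff coprime_commute)
    have Spos: "(\<Sum>i<k. x ^ i) > 0" using False \<open>x \<ge> 1\<close> by (intro sum_pos) auto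
    show ?thesis
    proof (rule multiplicity_le_imp_dvd)
      fix p :: nat assume p: "prime p"
      show "multiplicity p n \<le> multiplicity p k"
      proof (cases "p dvd n")
        case True
        have "multiplicity p (\<Sum>i<k. x ^ i) = multiplicity p k"
        proof (rule multiplicity_geometric_sum[OF p])
          show "[x = 1] (mod p)" using px[OF p] True Ng by simp
          then have "p dvd x - 1" by (metis cong_to_1_nat)
          then have pg: "p dvd g" unfolding g_def using True dvd_mult[of p n g] Ng by (intro gcd_greatest) simp_all
          show "odd k \<or> [x = 1] (mod 4)" if "p = 2"
          proof -
            have "2 * 2 dvd g * n" using pg True that by (intro mult_dvd_mono) auto
            then show ?thesis using four Ng by simp
          qed
        qed (use False \<open>x \<ge> 1\<close> in auto)
        then show ?thesis
          using dvd_imp_multiplicity_le[OF nS] Spos by (metis less_numeral_extra(3))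
      qed (simp add: not_dvd_imp_multiplicity_0)
    qed (use \<open>n > 0\<close> in auto)
  qed simp
  let ?A = "{z. z < N \<and> [z = 1] (mod g)}"
  have inj: "inj_on (\<lambda>k. x ^ k mod N) {..<n}"
  proof (rule linorder_inj_onI)
    fix i j assume ij: "i < j" "i \<in> {..<n}" "j \<in> {..<n}"
    show "x ^ i mod N \<noteq> x ^ j mod N"
    proof
      assume "x ^ i mod N = x ^ j mod N"
      then have "[x ^ i * x ^ (j - i) = x ^ i * 1] (mod N)"
        using ij by (simp add: power_add[symmetric] cong_def)
      moreover have "coprime (x ^ i) N" using copx by simp
      ultimately have "[x ^ (j - i) = 1] (mod N)" by (simp only: cong_mult_lcancel_nat)
      then have "n dvd j - i" by (rule key)
      then have "n \<le> j - i" using ij by (intro dvd_imp_le) auto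
      then show False using ij by simp
    qed
  qed auto
  have sub: "(\<lambda>k. x ^ k mod N) ` {..<n} \<subseteq> ?A"
  proof clarsimp
    fix k
    have "[x = 1] (mod g)" using x' \<open>x \<ge> 1\<close>
      by (metis cong_altdef_nat dvd_triv_left)
    then have "[x ^ k = 1 ^ k] (mod g)" by (rule cong_pow)
    moreover have "[x ^ k mod N = x ^ k] (mod g)"
      using Ng by (simp add: cong_def mod_mult2_eq)
    ultimately show "x ^ k mod N < N \<and> [x ^ k mod N = Suc 0] (mod g)"
      using \<open>N > 0\<close> by (simp add: cong_def)
  qed
  have "?A \<subseteq> (\<lambda>t. 1 mod g + g * t) ` {..<n}"
  proof
    fix z assume z: "z \<in> ?A"
    then have "1 mod g = z mod g" by (simp add: cong_def)
    then have "z = 1 mod g + g * (z div g)" by (simp only: mod_mult_div_eq)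
    moreover have "z div g < n" using z Ng \<open>g > 0\<close> by (simp add: less_mult_imp_div_less mult.commute)
    ultimately show "z \<in> (\<lambda>t. 1 mod g + g * t) ` {..<n}" by blast
  qed
  then have "card ?A \<le> card {..<n}" by (meson card_image_le card_mono finite_imageI finite_lessThan le_trans)
  moreover have "card ((\<lambda>k. x ^ k mod N) ` {..<n}) = card {..<n}" using inj by (rule card_image)
  moreover have "finite ?A" by simp
  ultimately have "(\<lambda>k. x ^ k mod N) ` {..<n} = ?A"
    using sub by (metis card_seteq)
  moreover have "y mod N \<in> ?A"
  proof -
    have "[y mod N = y] (mod g)" using Ng by (simp add: cong_def mod_mult2_eq)
    then have "[y mod N = 1] (mod g)" using y cong_trans unfolding g_def by blast
    then show ?thesis using \<open>N > 0\<close> by simp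
  qed
  ultimately obtain k where "y mod N = x ^ k mod N" by auto
  then show ?thesis by (metis cong_def)
qed

section \<open>Conjugates of integer polynomials at roots of unity\<close>

text \<open>Elements of Z[z] are carried as integer polynomials, so that the automorphism z -> z^s
  is evaluation of the same polynomial at \<open>z ^ s\<close> and no field extensions have to be
  constructed.\<close>

definition ev :: "int poly \<Rightarrow> complex \<Rightarrow> complex" where
  "ev g z = poly (of_int_poly g) z"

lemma ev_0 [simp]: "ev 0 z = 0"
  and ev_1 [simp]: "ev 1 z = 1"
  and ev_add [simp]: "ev (g + h) z = ev g z + ev h z"
  and ev_diff [simp]: "ev (g - h) z = ev g z - ev h z"
  and ev_minus [simp]: "ev (- g) z = - ev g z"
  and ev_mult [simp]: "ev (g * h) z = ev g z * ev h z"
  and ev_pCons [simp]: "ev (pCons a g) z = of_int a + z * ev g z"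
  by (simp_all add: ev_def hom_distribs)

lemma ev_power [simp]: "ev (g ^ n) z = ev g z ^ n"
  by (induction n) auto

lemma ev_sum [simp]: "ev (sum f A) z = (\<Sum>x\<in>A. ev (f x) z)"
  by (induction A rule: infinite_finite_induct) auto

lemma ev_prod [simp]: "ev (prod f A) z = (\<Prod>x\<in>A. ev (f x) z)"
  by (induction A rule: infinite_finite_induct) auto

lemma ev_monom [simp]: "ev (monom a n) z = of_int a * z ^ n"
  by (simp add: ev_def poly_monom hom_distribs)

lemma ev_of_int [simp]: "ev (of_int a) z = of_int a"
  by (simp add: of_int_poly)

lemma ev_of_nat [simp]: "ev (of_nat a) z = of_nat a"
  by (simp add: of_nat_poly)

lemma ev_pcompose [simp]: "ev (g \<circ>\<^sub>p h) z = ev g (ev h z)"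
  by (induction g) (auto simp: pcompose_pCons)

lemma ev_cnj: "cnj (ev g z) = ev g (cnj z)"
  by (induction g) auto

lemma ev_altdef: "ev g z = (\<Sum>i\<le>degree g. of_int (coeff g i) * z ^ i)"
  by (simp add: ev_def poly_altdef)

lemma power_mod_root_unity:
  fixes z :: complex
  assumes "z ^ M = 1"
  shows "z ^ (a mod M) = z ^ a"
proof -
  have "z ^ a = z ^ (M * (a div M) + a mod M)" by simp
  also have "\<dots> = z ^ (a mod M)" using assms by (simp only: power_add power_mult) simp
  finally show ?thesis by simp
qed

lemma cong_power_root_unity:
  fixes z :: complex
  assumes "z ^ M = 1" "[a = b] (mod M)"
  shows "z ^ a = z ^ b"
  using assms power_mod_root_unity[of z M a] power_mod_root_unity[of z M b] by (simp add: cong_def)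

lemma monic_root_imp_algebraic_int:
  assumes "lead_coeff q = 1" "ev q x = 0"
  shows "algebraic_int x"
  using assms unfolding algebraic_int_altdef_ipoly ev_def by blast

text \<open>
  The powers of \<open>z\<close> form an eigenvector with eigenvalue \<open>ev g z\<close> of an integer circulant matrix.
\<close>

lemma algebraic_int_ev:
  assumes z: "z ^ M = 1" and "M > 0"
  shows "algebraic_int (ev g z)"
proof -
  define B :: "int mat" where
    "B = mat M M (\<lambda>(i, j). \<Sum>k\<le>degree g. if (i + k) mod M = j then coeff g k else 0)"
  define A :: "complex mat" where "A = map_mat of_int B"
  define v :: "complex vec" where "v = vec M (\<lambda>i. z ^ i)"
  have B: "B \<in> carrier_mat M M" by (simp add: B_def)
  then have A: "A \<in> carrier_mat M M" by (simp add: A_def)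
  have "A *\<^sub>v v = ev g z \<cdot>\<^sub>v v"
  proof (intro eq_vecI)
    fix i assume "i < dim_vec (ev g z \<cdot>\<^sub>v v)"
    then have i: "i < M" by (simp add: v_def)
    have "(A *\<^sub>v v) $ i = (\<Sum>j<M. (\<Sum>k\<le>degree g. if (i + k) mod M = j then of_int (coeff g k) else 0) * z ^ j)"
      using i by (simp add: A_def B_def v_def scalar_prod_def atLeast0LessThan of_int_sum
          if_distrib[of of_int] cong: if_cong)
    also have "\<dots> = (\<Sum>j<M. \<Sum>k\<le>degree g. if (i + k) mod M = j then of_int (coeff g k) * z ^ j else 0)"
      by (simp add: sum_distrib_right if_distrib[of "\<lambda>x. x * _"] cong: if_cong)
    also have "\<dots> = (\<Sum>k\<le>degree g. \<Sum>j<M. if (i + k) mod M = j then of_int (coeff g k) * z ^ j else 0)"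
      by (rule sum.swap)
    also have "\<dots> = (\<Sum>k\<le>degree g. of_int (coeff g k) * z ^ (i + k))"
      using \<open>M > 0\<close> by (intro sum.cong) (auto simp: power_mod_root_unity[OF z])
    also have "\<dots> = ev g z * z ^ i"
      by (simp add: ev_altdef sum_distrib_left power_add mult_ac)
    finally show "(A *\<^sub>v v) $ i = (ev g z \<cdot>\<^sub>v v) $ i" using i by (simp add: v_def)
  qed (simp add: A_def B_def v_def)
  moreover have "v \<noteq> 0\<^sub>v M"
  proof
    assume "v = 0\<^sub>v M"
    then have "v $ 0 = 0\<^sub>v M $ 0" by simp
    then show False using \<open>M > 0\<close> by (simp add: v_def)
  qed
  moreover have "v \<in> carrier_vec M" by (simp add: v_def)
  ultimately have "eigenvalue A (ev g z)"
    using A unfolding eigenvalue_def eigenvector_def by auto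
  then have "poly (char_poly A) (ev g z) = 0" by (simp add: eigenvalue_root_char_poly[OF A])
  then have "ev (char_poly B) (ev g z) = 0"
    unfolding A_def of_int_hom.char_poly_hom[OF B] ev_def .
  then show ?thesis using degree_monic_char_poly[OF B] by (intro monic_root_imp_algebraic_int) auto
qed

lemma rational_ev_imp_int:
  assumes "z ^ M = 1" "M > 0" "ev g z \<in> \<rat>"
  shows "ev g z \<in> \<int>"
  using rational_algebraic_int_is_int[OF algebraic_int_ev[OF assms(1,2)] assms(3)] .

text \<open>Factors X are stripped from \<open>q\<close> until the constant term is nonzero. Thus a
  nonzero algebraic integer divides a nonzero integer, which serves in place of its norm.\<close>

lemma nonzero_root_nonzero_const:
  assumes "lead_coeff q = 1" "ev q y = 0" "y \<noteq> 0"
  shows "\<exists>c q'. c \<noteq> 0 \<and> of_int c + y * ev q' y = 0"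
  using assms
proof (induction "degree q" arbitrary: q rule: less_induct)
  case less
  obtain c q' where q: "q = pCons c q'" by (cases q) auto
  have c: "of_int c + y * ev q' y = 0" using less.prems q by simp
  show ?case
  proof (cases "c = 0")
    case True
    then have "ev q' y = 0" using c less.prems by simp
    moreover have "q' \<noteq> 0" using True less.prems(1) q by auto
    ultimately show ?thesis using less.hyps[of q'] less.prems q by simp
  qed (use c in blast)
qed

text \<open>A prime dividing \<open>ev h z\<close> in Z[z] also divides, in Z[z], the nonzero
  integer \<open>c\<close> supplied by the monic equation of \<open>ev h z\<close>. The quotient is
  rational and an algebraic integer, so the prime divides \<open>c\<close> in the integers.\<close>

lemma finitely_many_prime_divisors:
  assumes z: "z ^ M = 1" "M > 0" and y: "ev h z \<noteq> 0"
  shows "\<exists>c::nat. \<forall>p. prime p \<longrightarrow> (\<exists>w. ev h z = of_nat p * ev w z) \<longrightarrow> p \<le> c"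
proof -
  obtain q where q: "lead_coeff q = 1" "ev q (ev h z) = 0"
    using algebraic_int_ev[OF z, of h] unfolding algebraic_int_altdef_ipoly ev_def by blast
  obtain c q' where c: "c \<noteq> 0" "of_int c + ev h z * ev q' (ev h z) = 0"
    using nonzero_root_nonzero_const[OF q y] by blast
  have "p \<le> nat \<bar>c\<bar>" if p: "prime p" and w: "ev h z = of_nat p * ev w z" for p w
  proof -
    define r where "r = - (w * (q' \<circ>\<^sub>p h))"
    have r: "of_int c = of_nat p * ev r z"
      using c(2) w unfolding r_def by (simp add: eq_neg_iff_add_eq_0 algebra_simps)
    then have "ev r z = of_int c / of_nat p" using prime_gt_0_nat[OF p] by (simp add: field_simps)
    then have "ev r z \<in> \<rat>" by simp
    then obtain b where "ev r z = of_int b" using rational_ev_imp_int[OF z] by (auto elim: Ints_cases)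
    then have "complex_of_int c = of_int (int p * b)" using r by simp
    then have "c = int p * b" by (simp only: of_int_eq_iff)
    then have "int p dvd c" by simp
    then have "int p \<le> \<bar>c\<bar>" using c(1) by (simp add: zdvd_imp_le)
    then show ?thesis by simp
  qed
  then show ?thesis by blast
qed

section \<open>Frobenius congruences for integer polynomials\<close>

lemma freshman_dream_dvd:
  fixes a b :: "'a::comm_ring_1"
  assumes p: "prime p"
  shows "of_nat p dvd (a + b) ^ p - (a ^ p + b ^ p)"
proof -
  have "p > 0" using p by (rule prime_gt_0_nat)
  have "{..p} = insert 0 (insert p {0<..<p})" using \<open>p > 0\<close> by auto
  then have "(a + b) ^ p - (a ^ p + b ^ p) = (\<Sum>k\<in>{0<..<p}. of_nat (p choose k) * a ^ k * b ^ (p - k))"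
    using \<open>p > 0\<close> by (simp add: binomial_ring)
  moreover have "of_nat p dvd (of_nat (p choose k) * a ^ k * b ^ (p - k) :: 'a)" if "k \<in> {0<..<p}" for k
  proof -
    have "p dvd (p choose k)" using that p by (intro dvd_choose_prime) auto
    then obtain c where "p choose k = p * c" by blast
    then have "(of_nat p :: 'a) dvd of_nat (p choose k)" by simp
    then show ?thesis by (simp add: mult.assoc)
  qed
  then have "of_nat p dvd (\<Sum>k\<in>{0<..<p}. of_nat (p choose k) * a ^ k * b ^ (p - k) :: 'a)"
    by (intro dvd_sum)
  ultimately show ?thesis by simp
qed

lemma fermat_int_dvd:
  fixes a :: int
  assumes p: "prime p"
  shows "int p dvd a ^ p - a"
proof (induction a rule: int_induct[of _ 0])
  case base
  then show ?case using prime_gt_0_nat[OF p] by (simp add: zero_power)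
next
  case (step1 i)
  have "int p dvd ((i + 1) ^ p - (i ^ p + 1)) + (i ^ p - i)"
    using freshman_dream_dvd[OF p, of i 1] step1(2) by (intro dvd_add) auto
  then show ?case by (simp add: algebra_simps)
next
  case (step2 i)
  have "int p dvd i ^ p - ((i - 1) ^ p + 1)"
    using freshman_dream_dvd[OF p, of "i - 1" 1] by simp
  then have "int p dvd (i ^ p - i) - (i ^ p - ((i - 1) ^ p + 1))"
    using step2(2) dvd_diff by blast
  then show ?case by (simp add: algebra_simps)
qed

text \<open>Evaluated at a root of unity, this says that z -> z^p is the p-th power map modulo p,
  the only source of information on how automorphisms act modulo primes.\<close>

lemma frobenius_poly:
  fixes g :: "int poly"
  assumes p: "prime p"
  shows "of_nat p dvd g ^ p - g \<circ>\<^sub>p monom 1 p"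
proof (induction g)
  case (pCons a g)
  have 1: "of_nat p dvd ([:a:] + monom 1 1 * g) ^ p - ([:a:] ^ p + (monom 1 1 * g) ^ p)"
    by (rule freshman_dream_dvd[OF p])
  have "int p dvd a ^ p - a" by (rule fermat_int_dvd[OF p])
  then obtain b where "a ^ p - a = int p * b" by blast
  then have "[:a:] ^ p - [:a:] = of_nat p * [:b:]"
    by (simp add: poly_const_pow of_nat_poly)
  then have 2: "of_nat p dvd [:a:] ^ p - [:a:]" by (rule dvdI)
  have 3: "of_nat p dvd monom 1 p * (g ^ p - g \<circ>\<^sub>p monom 1 p)" using pCons by simp
  have "pCons a g = [:a:] + monom 1 1 * g" by (simp add: monom_altdef)
  moreover have "pCons a g \<circ>\<^sub>p monom 1 p = [:a:] + monom 1 p * (g \<circ>\<^sub>p monom 1 p)"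
    by (simp add: pcompose_pCons)
  moreover have "(monom 1 1 * g) ^ p = monom 1 p * g ^ p" by (simp add: power_mult_distrib monom_power)
  ultimately have "pCons a g ^ p - pCons a g \<circ>\<^sub>p monom 1 p =
      (([:a:] + monom 1 1 * g) ^ p - ([:a:] ^ p + (monom 1 1 * g) ^ p)) + ([:a:] ^ p - [:a:])
      + monom 1 p * (g ^ p - g \<circ>\<^sub>p monom 1 p)"
    by (simp add: algebra_simps)
  then show ?case using 1 2 3 by (metis dvd_add)
qed (use prime_gt_0_nat[OF p] in \<open>simp add: zero_power\<close>)

lemma frobenius_poly_power:
  fixes g :: "int poly"
  assumes p: "prime p"
  shows "of_nat p dvd g ^ (p ^ j) - g \<circ>\<^sub>p monom 1 (p ^ j)"
proof (induction j)
  case 0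
  then show ?case by (simp add: monom_altdef pcompose_idR)
next
  case (Suc j)
  let ?X = "monom (1::int) (p ^ j)"
  have "g ^ (p ^ j) - g \<circ>\<^sub>p ?X dvd (g ^ (p ^ j)) ^ p - (g \<circ>\<^sub>p ?X) ^ p"
    by (simp add: power_diff_sumr2)
  then have 1: "of_nat p dvd (g ^ (p ^ j)) ^ p - (g \<circ>\<^sub>p ?X) ^ p"
    using Suc dvd_trans by blast
  obtain c where "g ^ p - g \<circ>\<^sub>p monom 1 p = of_nat p * c" using frobenius_poly[OF p, of g] by blast
  then have "(g ^ p - g \<circ>\<^sub>p monom 1 p) \<circ>\<^sub>p ?X = of_nat p * (c \<circ>\<^sub>p ?X)"
    by (simp add: pcompose_smult of_nat_poly)
  moreover have "(g ^ n) \<circ>\<^sub>p ?X = (g \<circ>\<^sub>p ?X) ^ n" for n by (induction n) (auto simp: pcompose_mult pcompose_1)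
  moreover have "(g \<circ>\<^sub>p monom 1 p) \<circ>\<^sub>p ?X = g \<circ>\<^sub>p monom 1 (p ^ Suc j)"
  proof -
    have "monom 1 p \<circ>\<^sub>p ?X = monom 1 (p ^ Suc j)"
      by (simp add: monom_altdef[of 1 p] pcompose_hom.hom_power) (simp add: monom_power mult.commute)
    then show ?thesis by (simp add: pcompose_assoc[symmetric])
  qed
  ultimately have 2: "of_nat p dvd (g \<circ>\<^sub>p ?X) ^ p - g \<circ>\<^sub>p monom 1 (p ^ Suc j)"
    by (simp add: pcompose_diff)
  show ?case using dvd_add[OF 1 2] by (simp add: power_mult[symmetric] mult.commute)
qed

text \<open>
  If \<open>ev g (z ^ r) = 0\<close>, then the prime \<open>p\<close> divides \<open>ev g (z ^ (r * p))\<close>, which therefore vanishes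
  for all large \<open>p\<close>; and the residue class of \<open>s\<close> contains a number all of whose prime factors
  are large.
\<close>

theorem ev_root_unity_conjugate:
  assumes z: "z ^ M = 1" "M > 0" and g: "ev g z = 0" and s: "coprime s M"
  shows "ev g (z ^ s) = 0"
proof -
  have "\<exists>c::nat. ev g (z ^ r) \<noteq> 0 \<longrightarrow>
      (\<forall>p. prime p \<longrightarrow> (\<exists>w. ev g (z ^ r) = of_nat p * ev w z) \<longrightarrow> p \<le> c)" for r
    using finitely_many_prime_divisors[OF z, of "g \<circ>\<^sub>p monom 1 r"] by auto
  then obtain c where c: "\<And>r p w. ev g (z ^ r) \<noteq> 0 \<Longrightarrow> prime p \<Longrightarrow>
      ev g (z ^ r) = of_nat p * ev w z \<Longrightarrow> p \<le> c r" by metis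
  \<comment> \<open>The value at \<open>z ^ r\<close> depends only on \<open>r mod M\<close>, so
    finitely many bounds \<open>c r\<close> are enough. The summand 2 excludes \<open>s' = 0\<close>
    in the induction below, since the prime 2 divides 0 but does not exceed
    \<open>b\<close>.\<close>
  define b where "b = (\<Sum>r<M. c r) + 2"
  have big: "ev g (z ^ r) = 0" if "prime p" "p > b" "ev g (z ^ r) = of_nat p * ev w z" for r p w
  proof (rule ccontr)
    assume "ev g (z ^ r) \<noteq> 0"
    then have "p \<le> c (r mod M)"
      using c[of "r mod M" p w] that by (simp add: power_mod_root_unity[OF z(1)])
    also have "\<dots> \<le> (\<Sum>r<M. c r)" using \<open>M > 0\<close> by (intro member_le_sum) auto
    finally show False using that by (simp add: b_def)
  qed
  have prime_step: "ev g (z ^ (r * p)) = 0" if p: "prime p" "p > b" and r: "ev g (z ^ r) = 0" for r p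
  proof -
    obtain w where "g ^ p - g \<circ>\<^sub>p monom 1 p = of_nat p * w" using frobenius_poly[OF p(1)] by blast
    then have "ev (g ^ p - g \<circ>\<^sub>p monom 1 p) (z ^ r) = ev (of_nat p * w) (z ^ r)" by simp
    then have "- ev g (z ^ (r * p)) = of_nat p * ev w (z ^ r)"
      using r prime_gt_0_nat[OF p(1)] by (simp add: power_mult zero_power)
    then have "ev g (z ^ (r * p)) = of_nat p * ev (- (w \<circ>\<^sub>p monom 1 r)) z"
      by (simp add: minus_equation_iff eq_commute)
    then show ?thesis using big p by blast
  qed
  have all: "ev g (z ^ (r * s')) = 0"
    if "ev g (z ^ r) = 0" "\<forall>p. prime p \<longrightarrow> p dvd s' \<longrightarrow> p > b" for r s'
    using that
  proof (induction s' arbitrary: r rule: prime_divisors_induct)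
    case zero
    have "(2::nat) > b" using zero(2) two_is_prime_nat by blast
    then show ?case by (simp add: b_def)
  next
    case (factor p x)
    have "p > b" using factor by simp
    then have "ev g (z ^ (r * p)) = 0" using prime_step factor by blast
    then have "ev g (z ^ (r * p * x)) = 0" using factor by (intro factor.IH) auto
    then show ?case by (simp add: mult.assoc)
  qed simp
  \<comment> \<open>Being 1 modulo \<open>N\<close> keeps \<open>s'\<close> free of the small primes
    not dividing \<open>M\<close>; being \<open>s\<close> modulo \<open>M\<close> keeps it free of
    the primes dividing \<open>M\<close>.\<close>
  define N where "N = \<Prod>{p. prime p \<and> p \<le> b \<and> \<not> p dvd M}"
  have finN: "finite {p. prime p \<and> p \<le> b \<and> \<not> p dvd M}" by simp
  have "coprime M N" unfolding N_def
    by (intro prod_coprime_right) (auto simp: prime_imp_coprime_nat coprime_commute)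
  then obtain s' where s': "[s' = s] (mod M)" "[s' = 1] (mod N)"
    using binary_chinese_remainder_nat by blast
  have "p > b" if p: "prime p" "p dvd s'" for p
  proof (rule ccontr)
    assume "\<not> p > b"
    show False
    proof (cases "p dvd M")
      case True
      then have "[s' = s] (mod p)" using s'(1) cong_dvd_modulus_nat by blast
      then have "p dvd s" using p cong_dvd_iff by blast
      then have "p dvd 1" using True s coprime_common_divisor by blast
      then show False using p by simp
    next
      case False
      then have "p dvd N" unfolding N_def using p \<open>\<not> p > b\<close> by (intro dvd_prodI[OF finN, of p id, simplified]) auto
      then have "[s' = 1] (mod p)" using s'(2) cong_dvd_modulus_nat by blast
      then have "p dvd 1" using p cong_dvd_iff by blast
      then show False using p by simp
    qed
  qed
  then have "ev g (z ^ (1 * s')) = 0" using g by (intro all) auto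
  then show ?thesis using cong_power_root_unity[OF z(1) s'(1)] by simp
qed

section \<open>Divisibility in rings of cyclotomic integers\<close>

definition cyc :: "complex \<Rightarrow> complex set" where
  "cyc z = range (\<lambda>g. ev g z)"

definition zdvd :: "complex \<Rightarrow> complex \<Rightarrow> complex \<Rightarrow> bool" where
  "zdvd z a b \<longleftrightarrow> (\<exists>x\<in>cyc z. b = a * x)"

lemma ev_in_cyc [simp, intro]: "ev g z \<in> cyc z"
  by (simp add: cyc_def)

lemma cyc_add [intro]: "x \<in> cyc z \<Longrightarrow> y \<in> cyc z \<Longrightarrow> x + y \<in> cyc z"
  unfolding cyc_def by (auto simp: image_iff simp flip: ev_add)

lemma cyc_diff [intro]: "x \<in> cyc z \<Longrightarrow> y \<in> cyc z \<Longrightarrow> x - y \<in> cyc z"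
  unfolding cyc_def by (auto simp: image_iff simp flip: ev_diff)

lemma cyc_mult [intro]: "x \<in> cyc z \<Longrightarrow> y \<in> cyc z \<Longrightarrow> x * y \<in> cyc z"
  unfolding cyc_def by (auto simp: image_iff simp flip: ev_mult)

lemma cyc_power [intro]: "x \<in> cyc z \<Longrightarrow> x ^ n \<in> cyc z"
  unfolding cyc_def by (auto simp: image_iff simp flip: ev_power)

lemma cyc_of_int [simp, intro]: "of_int a \<in> cyc z"
  using ev_in_cyc[of "of_int a" z] by simp

lemma cyc_of_nat [simp, intro]: "of_nat a \<in> cyc z"
  using ev_in_cyc[of "of_nat a" z] by simp

lemma cyc_0 [simp, intro]: "0 \<in> cyc z"
  using ev_in_cyc[of 0 z] by simp

lemma cyc_1 [simp, intro]: "1 \<in> cyc z"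
  using ev_in_cyc[of 1 z] by simp

lemma cyc_gen [simp, intro]: "z \<in> cyc z"
  using ev_in_cyc[of "monom 1 1" z] by simp

lemma cyc_sum [intro]: "(\<And>i. i \<in> A \<Longrightarrow> f i \<in> cyc z) \<Longrightarrow> sum f A \<in> cyc z"
  by (induction A rule: infinite_finite_induct) auto

lemma cyc_prod [intro]: "(\<And>i. i \<in> A \<Longrightarrow> f i \<in> cyc z) \<Longrightarrow> prod f A \<in> cyc z"
  by (induction A rule: infinite_finite_induct) auto

lemma cyc_ev [intro]: "w \<in> cyc z \<Longrightarrow> ev g w \<in> cyc z"
  unfolding cyc_def by (auto simp: image_iff simp flip: ev_pcompose)

lemma zdvdI: "b = a * x \<Longrightarrow> x \<in> cyc z \<Longrightarrow> zdvd z a b"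
  by (auto simp: zdvd_def)

lemma zdvd_refl [simp]: "zdvd z a a"
  by (rule zdvdI[of _ _ 1]) auto

lemma zdvd_0 [simp]: "zdvd z a 0"
  by (rule zdvdI[of _ _ 0]) auto

lemma zdvd_one_iff [simp]: "zdvd z 1 x \<longleftrightarrow> x \<in> cyc z"
  by (auto simp: zdvd_def)

lemma zdvd_trans: "zdvd z a b \<Longrightarrow> zdvd z b c \<Longrightarrow> zdvd z a c"
  unfolding zdvd_def by (auto simp: mult.assoc intro!: bexI[of _ "_ * _"])

lemma zdvd_add: "zdvd z a b \<Longrightarrow> zdvd z a c \<Longrightarrow> zdvd z a (b + c)"
  unfolding zdvd_def by (auto simp flip: distrib_left)

lemma zdvd_diff: "zdvd z a b \<Longrightarrow> zdvd z a c \<Longrightarrow> zdvd z a (b - c)"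
  unfolding zdvd_def by (auto simp flip: right_diff_distrib)

lemma zdvd_mult: "zdvd z a b \<Longrightarrow> x \<in> cyc z \<Longrightarrow> zdvd z a (x * b)"
  unfolding zdvd_def by (auto intro!: bexI[of _ "_ * _"])

lemma zdvd_mult2: "zdvd z a b \<Longrightarrow> x \<in> cyc z \<Longrightarrow> zdvd z a (b * x)"
  using zdvd_mult[of z a b x] by (simp add: mult.commute)

lemma zdvd_triv: "x \<in> cyc z \<Longrightarrow> zdvd z a (a * x)"
  by (auto simp: zdvd_def)

lemma zdvd_mult_mono: "zdvd z a b \<Longrightarrow> zdvd z c d \<Longrightarrow> zdvd z (a * c) (b * d)"
  unfolding zdvd_def by (auto intro!: bexI[of _ "_ * _"])

lemma zdvd_power_mono: "zdvd z a b \<Longrightarrow> zdvd z (a ^ n) (b ^ n)"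
  by (induction n) (auto intro: zdvd_mult_mono)

lemma zdvd_cancel: "c \<noteq> 0 \<Longrightarrow> zdvd z (c * a) (c * b) \<Longrightarrow> zdvd z a b"
  by (auto simp: zdvd_def)

lemma zdvd_ev_diff:
  assumes "zdvd z d (u - v)" "u \<in> cyc z" "v \<in> cyc z"
  shows "zdvd z d (ev g u - ev g v)"
proof (induction g)
  case (pCons a g)
  have "ev (pCons a g) u - ev (pCons a g) v = u * (ev g u - ev g v) + (u - v) * ev g v"
    by (simp add: algebra_simps)
  moreover have "zdvd z d (u * (ev g u - ev g v))" using pCons(2) assms(2) by (rule zdvd_mult)
  moreover have "zdvd z d ((u - v) * ev g v)" using assms(1,3) by (auto intro: zdvd_mult2)
  ultimately show ?case by (simp only: zdvd_add)
qed simp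

text \<open>In a^q - b^q = (a - b) (sum of a^k b^(q - 1 - k)), each summand is b^(q - 1) modulo
  \<open>p\<close>, so the second factor is q b^(q - 1) = 0 modulo \<open>p\<close> and supplies the
  additional factor \<open>p\<close>.\<close>

lemma zdvd_power_lift:
  assumes q: "zdvd z p (of_nat q)" and i: "i \<ge> 1" and ab: "zdvd z (p ^ i) (a - b)"
    and "a \<in> cyc z" "b \<in> cyc z" "p \<in> cyc z" "q > 0"
  shows "zdvd z (p ^ Suc i) (a ^ q - b ^ q)"
proof -
  have "zdvd z p (p ^ i)"
    using i \<open>p \<in> cyc z\<close> by (cases i) (auto intro!: zdvd_triv)
  then have p: "zdvd z p (a - b)" using ab zdvd_trans by blast
  have pw: "zdvd z p (a ^ k - b ^ k)" for k
    using zdvd_ev_diff[OF p, of "monom 1 k"] assms by simp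
  have "zdvd z p (\<Sum>k<n. a ^ k * b ^ (q - Suc k) - b ^ k * b ^ (q - Suc k))" for n
    using assms by (induction n) (auto intro!: zdvd_add zdvd_mult2 pw simp flip: left_diff_distrib)
  then have "zdvd z p ((\<Sum>k<q. a ^ k * b ^ (q - Suc k) - b ^ k * b ^ (q - Suc k)) + of_nat q * b ^ (q - 1))"
    using q assms by (auto intro!: zdvd_add zdvd_mult2)
  also have "(\<Sum>k<q. a ^ k * b ^ (q - Suc k) - b ^ k * b ^ (q - Suc k)) + of_nat q * b ^ (q - 1)
      = (\<Sum>k<q. a ^ k * b ^ (q - Suc k))"
    by (simp add: sum_subtractf power_add[symmetric])
  finally have "zdvd z (p ^ i * p) ((a - b) * (\<Sum>k<q. a ^ k * b ^ (q - Suc k)))"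
    using ab by (intro zdvd_mult_mono)
  moreover have "a ^ q - b ^ q = (a - b) * (\<Sum>k<q. a ^ k * b ^ (q - Suc k))"
    using \<open>q > 0\<close> by (simp add: diff_power_eq_sum[of _ "q - 1", simplified] lessThan_Suc_atMost mult.commute power_diff_sumr2)
  ultimately show ?thesis by (simp add: mult.commute)
qed

lemma zdvd_power_lift_iterate:
  assumes q: "zdvd z p (of_nat q)" and ab: "zdvd z p (a - b)"
    and "a \<in> cyc z" "b \<in> cyc z" "p \<in> cyc z" "q > 0"
  shows "zdvd z (p ^ Suc r) (a ^ (q ^ r) - b ^ (q ^ r))"
proof (induction r)
  case (Suc r)
  have "zdvd z (p ^ Suc (Suc r)) ((a ^ (q ^ r)) ^ q - (b ^ (q ^ r)) ^ q)"
    using assms by (intro zdvd_power_lift[OF q _ Suc]) auto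
  then show ?case by (simp add: power_mult[symmetric] mult.commute)
qed (use ab in simp)

text \<open>
  The elementary substitute for: an automorphism that acts as a power of Frobenius modulo a
  uniformiser \<open>p\<close> with reduced residue ring fixes every prime ideal above \<open>p\<close>.
\<close>

lemma frobenius_descent:
  fixes p A :: "int poly" and z w b :: complex and q Q J :: nat
  assumes w: "w \<in> cyc z" and b: "b \<in> cyc z"
    and reduced: "\<And>g. \<exists>h. \<forall>u\<in>{z, w}. ev g u ^ Q - ev g u = ev p u * ev h u"
    and frob: "\<And>g. zdvd z (ev p z) (ev g w - ev g z ^ J)"
    and q: "zdvd z (ev p z) (of_nat q)" and pw: "zdvd z (ev p z) (ev p w)"
    and "ev p z \<noteq> 0" "Q \<ge> 2" "J \<ge> 1" "q \<ge> 1"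
    and Ab: "zdvd z (ev p z ^ r) (ev A z * b)"
  shows "zdvd z (ev p z ^ r) (ev A w * b)"
  using Ab
proof (induction r arbitrary: A)
  case 0
  then show ?case using w b by auto
next
  case (Suc r)
  let ?p = "ev p z" and ?n = "Suc r"
  obtain h where h: "ev A z ^ Q - ev A z = ev p z * ev h z" "ev A w ^ Q - ev A w = ev p w * ev h w"
    using reduced[of A] by auto
  define H where "H = Q - 1"
  have "Q = Suc H" "H \<ge> 1" using \<open>Q \<ge> 2\<close> by (auto simp: H_def)
  then have Qpow: "x ^ Q = x ^ H * x" for x :: complex by simp
  \<comment> \<open>The left side is divisible by the power r + 1 of the uniformiser because
    \<open>ev A z * b\<close> is. Cancelling one factor lets the induction hypothesis apply to
    \<open>h\<close> in place of \<open>A\<close>, and multiplying by \<open>ev p w\<close>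
    afterwards restores the lost factor at \<open>w\<close>.\<close>
  have "ev p z * (ev h z * b) = (ev A z ^ H - 1) * (ev A z * b)"
    using h(1) by (simp add: Qpow algebra_simps)
  also have "zdvd z (?p ^ ?n) \<dots>" using Suc.prems by (rule zdvd_mult) auto
  finally have "zdvd z (?p ^ r) (ev h z * b)"
    using \<open>?p \<noteq> 0\<close> by (auto dest: zdvd_cancel)
  then have "zdvd z (?p ^ r) (ev h w * b)" by (rule Suc.IH)
  then have "zdvd z (?p * ?p ^ r) (ev p w * (ev h w * b))" using pw by (rule zdvd_mult_mono[rotated])
  then have step: "zdvd z (?p ^ ?n) ((ev A w ^ Q - ev A w) * b)" by (simp add: h(2) mult.assoc)
  \<comment> \<open>Modulo the power r + 1, \<open>ev A w * b\<close> may be multiplied by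
    \<open>ev A w ^ H\<close> any number of times, so it is enough that a high power of
    \<open>ev A w\<close> times \<open>b\<close> vanishes.\<close>
  have iter: "zdvd z (?p ^ ?n) ((ev A w ^ (1 + H * n) - ev A w) * b)" for n
  proof (induction n)
    case (Suc n)
    have "(ev A w ^ (1 + H * Suc n) - ev A w) * b =
        ev A w ^ (H * n) * ((ev A w ^ Q - ev A w) * b) + (ev A w ^ (1 + H * n) - ev A w) * b"
      by (simp add: Qpow algebra_simps power_add)
    then show ?case using Suc w step by (auto intro!: zdvd_add zdvd_mult)
  qed simp
  \<comment> \<open>The Frobenius congruence holds only modulo the uniformiser itself; raising to
    the power q^r lifts it to the exponent r + 1, and any positive power of \<open>ev A z\<close>
    times \<open>b\<close> vanishes there.\<close>
  have "zdvd z (?p ^ ?n) (ev A w ^ (q ^ r) - (ev A z ^ J) ^ (q ^ r))"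
    using q frob w \<open>q \<ge> 1\<close> by (intro zdvd_power_lift_iterate) auto
  then have "zdvd z (?p ^ ?n) ((ev A w ^ (q ^ r) - (ev A z ^ J) ^ (q ^ r)) * b)"
    using b by (rule zdvd_mult2)
  moreover have "zdvd z (?p ^ ?n) ((ev A z ^ J) ^ (q ^ r) * b)"
  proof -
    have "(ev A z ^ J) ^ (q ^ r) = ev A z ^ (J * q ^ r - 1) * ev A z"
      using power_minus_mult[of "J * q ^ r" "ev A z"] \<open>J \<ge> 1\<close> \<open>q \<ge> 1\<close>
      by (simp add: power_mult[symmetric])
    then show ?thesis using zdvd_mult[OF Suc.prems, of "ev A z ^ (J * q ^ r - 1)"]
      by (auto simp: mult.assoc)
  qed
  ultimately have "zdvd z (?p ^ ?n) (ev A w ^ (q ^ r) * b)"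
    using zdvd_add by (fastforce simp: algebra_simps)
  then have "zdvd z (?p ^ ?n) (ev A w ^ (1 + H * q ^ r - q ^ r) * (ev A w ^ (q ^ r) * b))"
    using w by (intro zdvd_mult[of _ _ "ev A w ^ (q ^ r) * b"]) auto
  moreover have "q ^ r \<le> 1 + H * q ^ r" using \<open>H \<ge> 1\<close> by (cases H) auto
  then have "ev A w ^ (1 + H * q ^ r - q ^ r) * ev A w ^ (q ^ r) = ev A w ^ (1 + H * q ^ r)"
    by (simp only: power_add[symmetric] le_add_diff_inverse2)
  ultimately have "zdvd z (?p ^ ?n) (ev A w ^ (1 + H * q ^ r) * b)"
    by (simp only: mult.assoc[symmetric])
  from zdvd_diff[OF this iter[of "q ^ r"]] show ?case by (simp add: algebra_simps)
qed

section \<open>Primitive roots of unity\<close>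

definition primitive_root_unity :: "nat \<Rightarrow> complex \<Rightarrow> bool" where
  "primitive_root_unity M z \<longleftrightarrow> M > 0 \<and> (\<forall>k. z ^ k = 1 \<longleftrightarrow> M dvd k)"

lemma primitive_root_unityD:
  assumes "primitive_root_unity M z"
  shows "M > 0" "z ^ M = 1" "z ^ k = 1 \<longleftrightarrow> M dvd k" "z \<noteq> 0"
proof -
  show "M > 0" "z ^ M = 1" "z ^ k = 1 \<longleftrightarrow> M dvd k"
    using assms by (auto simp: primitive_root_unity_def)
  then show "z \<noteq> 0" by (metis power_0_left zero_neq_one less_irrefl)
qed

lemma primitive_root_unity_power_eq_iff:
  assumes z: "primitive_root_unity M z"
  shows "z ^ a = z ^ b \<longleftrightarrow> [a = b] (mod M)"
proof (induction a b rule: linorder_wlog)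
  case (le a b)
  have "z ^ b = z ^ a * z ^ (b - a)" using le by (simp add: power_add[symmetric])
  then have "z ^ a = z ^ b \<longleftrightarrow> M dvd b - a"
    using primitive_root_unityD[OF z] by auto
  then show ?case using mod_eq_dvd_iff_nat[OF le, of M] by (auto simp: cong_def)
qed (auto simp: cong_def)

lemma root_unity_power:
  fixes z :: complex
  assumes "z ^ M = 1"
  shows "(z ^ s) ^ M = 1"
proof -
  have "(z ^ s) ^ M = (z ^ M) ^ s" by (simp only: power_mult[symmetric] mult.commute)
  then show ?thesis using assms by simp
qed

lemma primitive_root_unity_coprime_power:
  assumes z: "primitive_root_unity M z" and "coprime s M"
  shows "primitive_root_unity M (z ^ s)"
  using assms primitive_root_unityD[OF z]
  by (simp add: primitive_root_unity_def power_mult[symmetric] coprime_dvd_mult_right_iff coprime_commute)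

lemma primitive_root_unity_power:
  assumes z: "primitive_root_unity (a * b) z"
  shows "primitive_root_unity b (z ^ a)"
  using z primitive_root_unityD[OF z]
  by (simp add: primitive_root_unity_def power_mult[symmetric])

lemma inj_on_primitive_root_unity:
  assumes z: "primitive_root_unity M z"
  shows "inj_on (\<lambda>i. z ^ i) {..<M}"
  by (rule inj_onI) (simp add: primitive_root_unity_power_eq_iff[OF z] cong_less_modulus_unique_nat)

lemma sum_powers_root_unity:
  fixes w :: complex
  assumes "w ^ n = 1"
  shows "(\<Sum>i<n. w ^ i) = (if w = 1 then of_nat n else 0)"
  using assms by (simp add: geometric_sum)

text \<open>Both sides are the value at 1 of (X^N - 1) / (X - 1), once as a product over its N - 1
  roots and once as a sum of monomials.\<close>

lemma prod_one_minus_root_unity: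
  assumes y: "primitive_root_unity N y"
  shows "(\<Prod>i\<in>{0<..<N}. 1 - y ^ i) = of_nat N"
proof -
  let ?P = "\<Prod>i\<in>{0<..<N}. [:- (y ^ i), 1:]" and ?S = "\<Sum>k<N. monom (1::complex) k"
  let ?A = "(\<lambda>i. y ^ i) ` {0<..<N}"
  have N: "N > 0" using primitive_root_unityD[OF y] by simp
  have deg: "degree ?P = N - 1"
    by (subst degree_prod_eq_sum_degree) auto
  have "?P = ?S"
  proof (rule poly_eqI_degree_lead_coeff[of _ "N - 1" _ ?A])
    have "lead_coeff ?P = 1" by (simp add: lead_coeff_prod)
    moreover have "coeff ?S (N - 1) = 1"
      using N by (simp add: coeff_sum)
    ultimately show "coeff ?P (N - 1) = coeff ?S (N - 1)" using deg by simp
    have "inj_on (\<lambda>i. y ^ i) {0<..<N}"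
      by (rule inj_on_subset[OF inj_on_primitive_root_unity[OF y]]) auto
    then show "N - 1 \<le> card ?A" by (simp add: card_image)
    show "degree ?S \<le> N - 1"
      by (intro degree_sum_le) (auto intro: order_trans[OF degree_monom_le])
    show "degree ?P \<le> N - 1" using deg by simp
    fix x assume "x \<in> ?A"
    then obtain i where i: "0 < i" "i < N" "x = y ^ i" by auto
    then have "x ^ N = 1" using primitive_root_unityD[OF y] by (simp add: root_unity_power)
    moreover have "\<not> N dvd i" using i by (auto dest: dvd_imp_le)
    then have "x \<noteq> 1" using i primitive_root_unityD[OF y] by simp
    ultimately have "poly ?S x = 0" by (simp add: poly_sum poly_monom sum_powers_root_unity)
    moreover have "poly ?P x = 0" using i by (auto simp: poly_prod)
    ultimately show "poly ?P x = poly ?S x" by simp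
  qed
  then have "poly ?P 1 = poly ?S 1" by simp
  then show ?thesis by (simp add: poly_prod poly_sum poly_monom)
qed

text \<open>The value at 1 of the cyclotomic polynomial of order q^(a + 1): the product over all
  nonzero indices is q^(a + 1), and the indices divisible by q form the same product for y^q, of
  value q^a.\<close>

lemma prod_one_minus_primitive_prime_power:
  assumes y: "primitive_root_unity (q ^ Suc a) y" and q: "prime q"
  shows "(\<Prod>i | i < q ^ Suc a \<and> \<not> q dvd i. 1 - y ^ i) = of_nat q"
proof -
  let ?N = "q ^ Suc a" and ?I = "{i. i < q ^ Suc a \<and> \<not> q dvd i}"
  let ?K = "(\<lambda>i. q * i) ` {0<..<q ^ a}"
  have q0: "q > 0" using q by (rule prime_gt_0_nat)
  have "{0<..<?N} = ?I \<union> ?K"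
  proof (intro equalityI subsetI)
    fix i assume i: "i \<in> {0<..<?N}"
    show "i \<in> ?I \<union> ?K"
    proof (cases "q dvd i")
      case True
      then obtain k where "i = q * k" by blast
      then show ?thesis using i by auto
    qed (use i in auto)
  qed (use q0 in \<open>auto intro: Nat.gr0I\<close>)
  then have "(\<Prod>i\<in>{0<..<?N}. 1 - y ^ i) = (\<Prod>i\<in>?I. 1 - y ^ i) * (\<Prod>i\<in>?K. 1 - y ^ i)"
    by (simp only:) (intro prod.union_disjoint, auto)
  also have "(\<Prod>i\<in>?K. 1 - y ^ i) = (\<Prod>i\<in>{0<..<q ^ a}. 1 - (y ^ q) ^ i)"
    using q0 by (subst prod.reindex) (auto simp: inj_on_def power_mult)
  also have "\<dots> = of_nat (q ^ a)"
    using y by (intro prod_one_minus_root_unity primitive_root_unity_power) simp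
  finally show ?thesis
    using prod_one_minus_root_unity[OF y] q0 by simp
qed

section \<open>Descent at a single prime\<close>

lemma dvd_pcompose_diff:
  fixes g X Y :: "'a::comm_ring_1 poly"
  shows "X - Y dvd g \<circ>\<^sub>p X - g \<circ>\<^sub>p Y"
proof (induction g)
  case (pCons a g)
  have "pCons a g \<circ>\<^sub>p X - pCons a g \<circ>\<^sub>p Y = X * (g \<circ>\<^sub>p X - g \<circ>\<^sub>p Y) + (X - Y) * (g \<circ>\<^sub>p Y)"
    by (simp add: pcompose_pCons algebra_simps)
  then show ?case using pCons by simp
qed simp

lemma zdvd_diff_powers:
  assumes "[s = t] (mod M')"
  shows "zdvd z (1 - z ^ M') (z ^ s - z ^ t)"
  using assms
proof (induction s t rule: linorder_wlog)
  case (le s t)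
  then have "M' dvd t - s" by (simp add: cong_def mod_eq_dvd_iff_nat[symmetric])
  then obtain l where "t - s = M' * l" by blast
  then have l: "t = s + M' * l" using le by simp
  have "z ^ s - z ^ t = (1 - (z ^ M') ^ l) * z ^ s" by (simp add: l power_add power_mult algebra_simps)
  also have "\<dots> = (1 - z ^ M') * ((\<Sum>i<l. (z ^ M') ^ i) * z ^ s)"
    by (simp add: one_diff_power_eq mult.assoc)
  finally show ?case by (rule zdvdI) (intro cyc_mult cyc_sum cyc_power cyc_gen)
next
  case (sym s t)
  then have "zdvd z (1 - z ^ M') (z ^ t - z ^ s)" by (simp add: cong_sym_eq)
  from zdvd_diff[OF zdvd_0 this] show ?case by simp
qed

text \<open>
  If \<open>q\<close> does not divide \<open>M\<close>, the uniformiser is \<open>q\<close> itself; otherwise it is \<open>1 - z ^ M'\<close>,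
  where \<open>M'\<close> is the \<open>q\<close>-free part of \<open>M\<close>.
\<close>

lemma prime_descent_unramified:
  assumes z: "primitive_root_unity M z" and q: "prime q" "\<not> q dvd M"
    and s: "[s = q ^ j] (mod M)"
    and b: "b \<in> cyc z" and dvd: "zdvd z (of_nat q ^ e) (ev A z * b)"
  shows "zdvd z (of_nat q ^ e) (ev A (z ^ s) * b)"
proof -
  note z' = primitive_root_unityD[OF z]
  \<comment> \<open>This power of q is 1 modulo \<open>M\<close>, so it fixes all M-th roots of
    unity, and the Frobenius congruence becomes g(u)^Q = g(u) modulo q: the residue ring is
    reduced.\<close>
  let ?Q = "q ^ totient M"
  have "coprime q M" using q by (simp add: prime_imp_coprime_nat)
  then have Q1: "[?Q = 1] (mod M)" by (rule euler_theorem)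
  have "?Q \<ge> 2 ^ 1"
    using prime_ge_2_nat[OF q(1)] z'(1) self_le_power[of q "totient M"] by simp
  have "zdvd z (ev (of_nat q) z ^ e) (ev A (z ^ s) * b)"
  proof (rule frobenius_descent[where Q = ?Q and J = "q ^ j" and q = q])
    fix g :: "int poly"
    obtain h where h: "g ^ ?Q - g \<circ>\<^sub>p monom 1 ?Q = of_nat q * h"
      using frobenius_poly_power[OF q(1)] by blast
    have "ev g u ^ ?Q - ev g u = ev (of_nat q) u * ev h u" if "u \<in> {z, z ^ s}" for u
    proof -
      have "u ^ M = 1" using that z'(2) by (auto simp: root_unity_power)
      from cong_power_root_unity[OF this Q1] have "u ^ ?Q = u" by simp
      moreover have "ev (g ^ ?Q - g \<circ>\<^sub>p monom 1 ?Q) u = ev (of_nat q * h) u" by (simp only: h)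
      ultimately show ?thesis by simp
    qed
    then show "\<exists>h. \<forall>u\<in>{z, z ^ s}. ev g u ^ ?Q - ev g u = ev (of_nat q) u * ev h u" by blast
    obtain h' where h': "g ^ (q ^ j) - g \<circ>\<^sub>p monom 1 (q ^ j) = of_nat q * h'"
      using frobenius_poly_power[OF q(1)] by blast
    have "ev (g ^ (q ^ j) - g \<circ>\<^sub>p monom 1 (q ^ j)) z = ev (of_nat q * h') z" by (simp only: h')
    then have "ev g (z ^ s) - ev g z ^ (q ^ j) = ev (of_nat q) z * (0 - ev h' z)"
      using cong_power_root_unity[OF z'(2) s] by (simp add: algebra_simps)
    then show "zdvd z (ev (of_nat q) z) (ev g (z ^ s) - ev g z ^ (q ^ j))"
      by (rule zdvdI) (intro cyc_diff cyc_0 ev_in_cyc)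
  qed (use b dvd prime_gt_0_nat[OF q(1)] \<open>?Q \<ge> 2 ^ 1\<close> in auto)
  then show ?thesis by simp
qed

lemma prime_descent_ramified:
  assumes z: "primitive_root_unity (M' * q ^ Suc a) z" and q: "prime q" "\<not> q dvd M'"
    and s: "[s = q ^ j] (mod M')" "coprime s (M' * q ^ Suc a)"
    and b: "b \<in> cyc z" and dvd: "zdvd z (of_nat q ^ e) (ev A z * b)"
  shows "zdvd z (of_nat q ^ e) (ev A (z ^ s) * b)"
proof -
  note z' = primitive_root_unityD[OF z]
  let ?M = "M' * q ^ Suc a" and ?N = "q ^ Suc a"
  define Q where "Q = q ^ totient M'"
  define p :: "int poly" where "p = 1 - monom 1 M'"
  define I where "I = {i. i < ?N \<and> \<not> q dvd i}"
  define n where "n = card I"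
  \<comment> \<open>The cofactor in q = p^n S: with y = u^M', q is the product of the 1 - y^i over
    \<open>I\<close>, and each factor is 1 - y times a geometric sum.\<close>
  define S :: "int poly" where "S = (\<Prod>i\<in>I. \<Sum>k<i. monom 1 (M' * k))"
  have "M' > 0" using z'(1) by simp
  have "finite I" by (simp add: I_def)
  have q2: "q \<ge> 2" using q(1) by (rule prime_ge_2_nat)
  have "1 \<in> I" using q2 one_less_power[of q "Suc a"] by (simp add: I_def)
  then have "n > 0" using \<open>finite I\<close> by (auto simp: n_def card_gt_0_iff)
  have pn: "x ^ n = x * x ^ (n - 1)" for x :: complex using \<open>n > 0\<close> by (cases n) auto
  have coI: "coprime i ?N" if "i \<in> I" for i
  proof -
    have "coprime q i" using that q(1) by (simp add: I_def prime_imp_coprime_nat)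
    then show ?thesis by (simp only: coprime_power_right_iff coprime_commute simp_thms)
  qed
  have pu: "ev p u = 1 - u ^ M'" for u by (simp add: p_def)
  have qS: "of_nat q = ev p u ^ n * ev S u" if u: "primitive_root_unity ?M u" for u
  proof -
    have "primitive_root_unity ?N (u ^ M')" using u by (rule primitive_root_unity_power)
    then have "of_nat q = (\<Prod>i\<in>I. 1 - (u ^ M') ^ i)"
      using prod_one_minus_primitive_prime_power[OF _ q(1)] by (simp add: I_def)
    also have "\<dots> = (\<Prod>i\<in>I. ev p u * (\<Sum>k<i. (u ^ M') ^ k))"
      by (simp only: one_diff_power_eq pu)
    also have "\<dots> = ev p u ^ n * ev S u"
      by (simp add: prod.distrib n_def S_def power_mult[symmetric])
    finally show ?thesis .
  qed
  \<comment> \<open>Conversely each 1 - y^i divides 1 - y, because y = (y^i)^t for an inverse t of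
    i. Hence q and p^n divide each other, and divisibility by q^e can be tested by p^(n e).\<close>
  have pq: "zdvd z (of_nat q) (ev p z ^ n)"
  proof -
    let ?y = "z ^ M'"
    have y: "primitive_root_unity ?N ?y" using z by (rule primitive_root_unity_power)
    have "\<exists>t. [i * t = 1] (mod ?N)" if "i \<in> I" for i
      using cong_solve_coprime_nat[OF coI[OF that]] by simp
    then obtain t where t: "\<And>i. i \<in> I \<Longrightarrow> [i * t i = 1] (mod ?N)" by metis
    have "ev p z = (1 - ?y ^ i) * (\<Sum>k<t i. (?y ^ i) ^ k)" if "i \<in> I" for i
    proof -
      have "?y ^ (i * t i) = ?y ^ 1" using primitive_root_unity_power_eq_iff[OF y] t[OF that] by blast
      then have "ev p z = 1 - (?y ^ i) ^ t i" by (simp add: pu power_mult)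
      then show ?thesis by (simp only: one_diff_power_eq)
    qed
    then have "(\<Prod>i\<in>I. ev p z) = (\<Prod>i\<in>I. (1 - ?y ^ i) * (\<Sum>k<t i. (?y ^ i) ^ k))"
      by (intro prod.cong) auto
    then have "ev p z ^ n = of_nat q * (\<Prod>i\<in>I. \<Sum>k<t i. (?y ^ i) ^ k)"
      using prod_one_minus_primitive_prime_power[OF y q(1)] by (simp add: n_def prod.distrib I_def)
    then show ?thesis by (rule zdvdI) (intro cyc_prod cyc_sum cyc_power cyc_gen)
  qed
  have w: "primitive_root_unity ?M (z ^ s)"
    using z s(2) by (rule primitive_root_unity_coprime_power)
  have "coprime q M'" using q by (simp add: prime_imp_coprime_nat)
  then have Q1: "[Q = 1] (mod M')" unfolding Q_def by (rule euler_theorem)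
  have "Q \<ge> 2"
    using q2 \<open>M' > 0\<close> self_le_power[of q "totient M'"] by (simp add: Q_def)
  \<comment> \<open>The divisibility is shown for polynomials because
    \<open>frobenius_descent\<close> asks for a single cofactor valid at both \<open>z\<close> and
    \<open>z ^ s\<close>.\<close>
  have "p dvd monom 1 Q - monom 1 1"
  proof -
    obtain l where l: "Q = 1 + M' * l"
    proof -
      have "M' dvd Q - 1" using Q1 by (rule cong_to_1_nat)
      then obtain l where "Q - 1 = M' * l" by blast
      then have "Q = 1 + M' * l" using \<open>Q \<ge> 2\<close> by simp
      then show ?thesis by (rule that)
    qed
    have "monom 1 Q - monom 1 1 = - (monom 1 1 * (1 - (monom (1::int) M') ^ l))"
      by (simp add: l mult_monom monom_power algebra_simps)
    also have "p dvd \<dots>" unfolding p_def by (simp only: one_diff_power_eq) simp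
    finally show ?thesis .
  qed
  have main: "zdvd z (ev p z ^ r) (ev A (z ^ s) * b)" if "zdvd z (ev p z ^ r) (ev A z * b)" for r
    using that
  proof (rule frobenius_descent[where Q = Q and J = "q ^ j" and q = q, rotated -1])
    show zq: "zdvd z (ev p z) (of_nat q)"
    proof -
      have "of_nat q = ev p z * (ev p z ^ (n - 1) * ev S z)"
        using qS[OF z] by (simp add: pn mult.assoc)
      then show ?thesis by (rule zdvdI) auto
    qed
    fix g :: "int poly"
    obtain h where h: "g ^ Q - g \<circ>\<^sub>p monom 1 Q = of_nat q * h"
      using frobenius_poly_power[OF q(1)] unfolding Q_def by blast
    have "p dvd g \<circ>\<^sub>p monom 1 Q - g \<circ>\<^sub>p monom 1 1"
      using \<open>p dvd monom 1 Q - monom 1 1\<close> dvd_pcompose_diff dvd_trans by blast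
    then obtain h' where h': "g \<circ>\<^sub>p monom 1 Q - g \<circ>\<^sub>p monom 1 1 = p * h'" by blast
    have "ev g u ^ Q - ev g u = ev p u * ev (p ^ (n - 1) * S * h + h') u" if "u \<in> {z, z ^ s}" for u
    proof -
      have "of_nat q = ev p u * (ev p u ^ (n - 1) * ev S u)"
        using that qS[of u] z w by (auto simp: pn mult.assoc)
      moreover have "ev (g ^ Q - g \<circ>\<^sub>p monom 1 Q) u = ev (of_nat q * h) u"
        "ev (g \<circ>\<^sub>p monom 1 Q - g \<circ>\<^sub>p monom 1 1) u = ev (p * h') u" by (simp_all only: h h')
      ultimately show ?thesis by (simp add: algebra_simps)
    qed
    then show "\<exists>h. \<forall>u\<in>{z, z ^ s}. ev g u ^ Q - ev g u = ev p u * ev h u" by blast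
    obtain f where f: "g ^ (q ^ j) - g \<circ>\<^sub>p monom 1 (q ^ j) = of_nat q * f"
      using frobenius_poly_power[OF q(1)] by blast
    have "ev (g ^ (q ^ j) - g \<circ>\<^sub>p monom 1 (q ^ j)) z = ev (of_nat q * f) z" by (simp only: f)
    then have "ev g (z ^ s) - ev g z ^ (q ^ j)
        = (ev g (z ^ s) - ev g (z ^ (q ^ j))) - of_nat q * ev f z"
      by (simp add: algebra_simps)
    moreover have "zdvd z (ev p z) (z ^ s - z ^ (q ^ j))"
      unfolding pu using s(1) by (rule zdvd_diff_powers)
    then have "zdvd z (ev p z) (ev g (z ^ s) - ev g (z ^ (q ^ j)))" by (rule zdvd_ev_diff) auto
    moreover have "zdvd z (ev p z) (of_nat q * ev f z)" using zq by (rule zdvd_mult2) simp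
    ultimately show "zdvd z (ev p z) (ev g (z ^ s) - ev g z ^ (q ^ j))"
      by (simp only: zdvd_diff)
  next
    have "ev p (z ^ s) = ev p z * (\<Sum>k<s. (z ^ M') ^ k)"
      using one_diff_power_eq[of "z ^ M'" s] by (simp add: pu power_mult[symmetric] mult.commute)
    then show "zdvd z (ev p z) (ev p (z ^ s))"
      by (rule zdvdI) (intro cyc_sum cyc_power cyc_gen)
    show "ev p z \<noteq> 0"
      using qS[OF z] \<open>n > 0\<close> prime_gt_0_nat[OF q(1)] by (auto simp: zero_power)
  qed (use b q2 \<open>Q \<ge> 2\<close> in auto)
  have "zdvd z (ev p z ^ (n * e)) (of_nat q ^ e)"
    using zdvd_power_mono[OF zdvdI[OF qS[OF z]], of z e] by (simp add: power_mult)
  then have "zdvd z (ev p z ^ (n * e)) (ev A z * b)" using dvd zdvd_trans by blast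
  then have "zdvd z (ev p z ^ (n * e)) (ev A (z ^ s) * b)" by (rule main)
  moreover have "zdvd z (of_nat q ^ e) (ev p z ^ (n * e))"
    using zdvd_power_mono[OF pq, of e] by (simp add: power_mult)
  ultimately show ?thesis using zdvd_trans by blast
qed

section \<open>Kronecker's theorem and roots of unity in cyclotomic rings\<close>

lemma norm_root_unity:
  fixes z :: complex
  assumes "z ^ M = 1" "M > 0"
  shows "norm z = 1"
  using power_eq_imp_eq_norm[of z M 1] assms by simp

lemma cnj_root_unity:
  assumes "z ^ M = 1" "M > 0"
  shows "cnj z = z ^ (M - 1)"
proof -
  have "z * cnj z = 1" using norm_root_unity[OF assms] by (simp add: complex_norm_square[symmetric])
  moreover have "z * z ^ (M - 1) = 1" using assms by (metis power_eq_if neq0_conv)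
  ultimately show ?thesis by (metis mult_cancel_left mult_zero_left zero_neq_one)
qed

lemma root_unity_eq_power:
  assumes z: "primitive_root_unity M z" and u: "u ^ M = 1"
  shows "\<exists>k. u = z ^ k"
proof -
  note z' = primitive_root_unityD[OF z]
  have "(\<lambda>i. z ^ i) ` {..<M} = {u. u ^ M = 1}"
  proof (rule card_seteq)
    show "finite {u::complex. u ^ M = 1}" using z'(1) by (simp add: finite_roots_unity)
    show "(\<lambda>i. z ^ i) ` {..<M} \<subseteq> {u. u ^ M = 1}" using z'(2) by (auto simp: root_unity_power)
    show "card {u::complex. u ^ M = 1} \<le> card ((\<lambda>i. z ^ i) ` {..<M})"
      using z'(1) inj_on_primitive_root_unity[OF z] by (simp add: card_image card_roots_unity_eq)
  qed
  then show ?thesis using u by blast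
qed

lemma primitive_root_unity_cis:
  assumes "M > 0"
  shows "primitive_root_unity M (cis (2 * pi / of_nat M))"
proof -
  let ?f = "\<lambda>k. cis (2 * pi * real k / real M)"
  have bij: "bij_betw ?f {..<M} {z. z ^ M = 1}"
    using assms by (rule bij_betw_roots_unity)
  have pow: "cis (2 * pi / M) ^ k = ?f k" for k
    by (simp add: Complex.DeMoivre mult_ac)
  have M1: "cis (2 * pi / M) ^ M = 1"
    using assms by (simp add: Complex.DeMoivre cis_2pi)
  have "cis (2 * pi / M) ^ k = 1 \<longleftrightarrow> M dvd k" for k
  proof -
    have "cis (2 * pi / M) ^ k = ?f (k mod M)"
      using power_mod_root_unity[OF M1, of k] by (simp only: pow)
    moreover have "?f (k mod M) = ?f 0 \<longleftrightarrow> k mod M = 0"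
      using bij assms by (intro inj_on_eq_iff[OF bij_betw_imp_inj_on]) auto
    ultimately show ?thesis by (simp add: dvd_eq_mod_eq_0)
  qed
  then show ?thesis using assms by (simp add: primitive_root_unity_def)
qed

text \<open>Orthogonality of the powers of z; the exponent \<open>M - i\<close> stands for
  -i.\<close>

lemma fourier_inversion:
  fixes c :: "nat \<Rightarrow> complex"
  assumes z: "primitive_root_unity M z" and i: "i < M"
  shows "(\<Sum>s<M. (\<Sum>k<M. c k * (z ^ s) ^ k) * (z ^ s) ^ (M - i)) = of_nat M * c i"
proof -
  note z' = primitive_root_unityD[OF z]
  have "(\<Sum>s<M. (\<Sum>k<M. c k * (z ^ s) ^ k) * (z ^ s) ^ (M - i))
      = (\<Sum>s<M. \<Sum>k<M. c k * (z ^ (k + M - i)) ^ s)"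
  proof (intro sum.cong refl, subst sum_distrib_right, intro sum.cong refl)
    fix s k
    have "(z ^ s) ^ k * (z ^ s) ^ (M - i) = (z ^ s) ^ (k + M - i)"
      using i by (simp add: power_add[symmetric])
    also have "\<dots> = (z ^ (k + M - i)) ^ s" by (simp only: power_mult[symmetric] mult.commute)
    finally show "c k * (z ^ s) ^ k * (z ^ s) ^ (M - i) = c k * (z ^ (k + M - i)) ^ s" by (simp add: mult.assoc)
  qed
  also have "\<dots> = (\<Sum>k<M. c k * (\<Sum>s<M. (z ^ (k + M - i)) ^ s))"
    by (subst sum.swap) (simp add: sum_distrib_left)
  also have "\<dots> = (\<Sum>k<M. if k = i then of_nat M * c i else 0)"
  proof (intro sum.cong refl)
    fix k assume k: "k \<in> {..<M}"
    have "z ^ (k + M - i) = 1 \<longleftrightarrow> k = i"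
    proof
      assume "z ^ (k + M - i) = 1"
      then have d: "M dvd k + M - i" using z'(3) by blast
      show "k = i"
      proof (cases "k \<ge> i")
        case True
        then have "k + M - i = (k - i) + M" by simp
        then have "M dvd k - i" using d by simp
        then show ?thesis using True k by (auto dest: dvd_imp_le)
      next
        case False
        then show ?thesis using d i k by (auto dest: dvd_imp_le)
      qed
    qed (use z' in simp)
    then show "c k * (\<Sum>s<M. (z ^ (k + M - i)) ^ s) = (if k = i then of_nat M * c i else 0)"
      using z'(2) by (simp add: sum_powers_root_unity root_unity_power)
  qed
  finally show ?thesis using i by simp
qed

text \<open>For \<open>i < M\<close> these are the coefficients of the remainder of \<open>h\<close>
  modulo X^M - 1.\<close>

definition cyclic_coeff :: "nat \<Rightarrow> int poly \<Rightarrow> nat \<Rightarrow> int" where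
  "cyclic_coeff M h i = (\<Sum>k | k \<le> degree h \<and> k mod M = i. coeff h k)"

lemma ev_cyclic_coeff:
  assumes z: "z ^ M = 1" "M > 0"
  shows "ev h z = (\<Sum>i<M. of_int (cyclic_coeff M h i) * z ^ i)"
proof -
  have "ev h z = (\<Sum>k\<in>{..degree h}. of_int (coeff h k) * z ^ k)" by (simp add: ev_altdef)
  also have "\<dots> = (\<Sum>i<M. \<Sum>k\<in>{k\<in>{..degree h}. k mod M = i}. of_int (coeff h k) * z ^ k)"
    using z(2) by (intro sum.group[symmetric]) auto
  also have "\<dots> = (\<Sum>i<M. \<Sum>k | k \<le> degree h \<and> k mod M = i. of_int (coeff h k) * z ^ i)"
    by (intro sum.cong) (auto simp: power_mod_root_unity[OF z(1)])
  finally show ?thesis by (simp add: cyclic_coeff_def sum_distrib_right)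
qed

text \<open>For a prime p dividing M, the sum of the powers X^(j M / p), j < p, is p at z^s when p
  divides s and 0 otherwise. The product of the factors p minus this sum therefore vanishes exactly
  at the non-primitive roots, where nothing is known about the polynomial in Kronecker's
  theorem.\<close>

lemma primitive_indicator_poly:
  assumes z: "primitive_root_unity M z"
  shows "\<exists>E R. R > (0::nat) \<and>
    (\<forall>s. ev E (z ^ s) = (if coprime s M then of_nat R else 0))"
proof (intro exI conjI allI)
  note z' = primitive_root_unityD[OF z]
  let ?P = "prime_factors M"
  let ?E = "\<Prod>p\<in>?P. of_nat p - (\<Sum>j<p. monom (1::int) (j * (M div p)))"
  show "\<Prod>?P > 0" by (intro prod_pos) (auto simp: in_prime_factors_iff prime_gt_0_nat)
  fix s
  have factor: "ev (of_nat p - (\<Sum>j<p. monom (1::int) (j * (M div p)))) (z ^ s)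
      = (if p dvd s then 0 else of_nat p)" if "p \<in> ?P" for p
  proof -
    have p: "prime p" "p dvd M" using that by auto
    define w where "w = (z ^ s) ^ (M div p)"
    have "w ^ p = (z ^ s) ^ (M div p * p)" by (simp only: w_def power_mult)
    then have "w ^ p = (z ^ s) ^ M" using p by simp
    then have wp: "w ^ p = 1" using z'(2) by (simp add: root_unity_power)
    have "w = z ^ (s * (M div p))" by (simp add: w_def power_mult)
    then have "w = 1 \<longleftrightarrow> M dvd s * (M div p)" using z'(3) by simp
    also have "\<dots> \<longleftrightarrow> p * (M div p) dvd s * (M div p)" using p by simp
    also have "\<dots> \<longleftrightarrow> p dvd s"
    proof -
      have "M div p \<noteq> 0" using p z'(1) by (auto simp: div_eq_0_iff dest: dvd_imp_le)
      then show ?thesis by simp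
    qed
    finally have w1: "w = 1 \<longleftrightarrow> p dvd s" .
    have "(\<Sum>j<p. (z ^ s) ^ (j * (M div p))) = (\<Sum>j<p. w ^ j)"
      by (simp add: w_def power_mult[symmetric] mult_ac)
    then show ?thesis using w1 sum_powers_root_unity[OF wp] by simp
  qed
  have "ev ?E (z ^ s) = (\<Prod>p\<in>?P. if p dvd s then 0 else of_nat p)"
    unfolding ev_prod using factor by (intro prod.cong) auto
  also have "\<dots> = (if coprime s M then of_nat (\<Prod>?P) else 0)"
  proof (cases "coprime s M")
    case True
    then have "\<not> p dvd s" if "p \<in> ?P" for p
      using that coprime_common_divisor[OF True] by (metis in_prime_factors_iff not_prime_unit)
    then have "(\<Prod>p\<in>?P. if p dvd s then 0 else of_nat p) = (\<Prod>p\<in>?P. of_nat p :: complex)"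
      by (intro prod.cong) auto
    then show ?thesis using True by simp
  next
    case False
    then have "gcd s M \<noteq> 1" by (simp only: coprime_iff_gcd_eq_1 not_False_eq_True)
    then obtain p where "prime p" "p dvd gcd s M" using prime_factor_nat by blast
    then have "p \<in> ?P" "p dvd s" using z'(1) by (auto simp: in_prime_factors_iff)
    then show ?thesis using False by (auto intro!: prod_zero)
  qed
  finally show "ev ?E (z ^ s) = (if coprime s M then of_nat (\<Prod>?P) else 0)" .
qed

text \<open>
  Kronecker's theorem. After multiplication by the indicator polynomial, a power of \<open>g\<close> is
  bounded at all \<open>M\<close>-th roots of unity, so only finitely many coefficient vectors occur.
\<close>

lemma kronecker_root_unity:
  assumes z: "primitive_root_unity M z"
    and g: "\<And>s. coprime s M \<Longrightarrow> norm (ev g (z ^ s)) = 1"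
  shows "\<exists>n>0. ev g z ^ n = 1"
proof -
  note z' = primitive_root_unityD[OF z]
  obtain E R where R: "R > (0::nat)" and E: "\<And>s. ev E (z ^ s) = (if coprime s M then of_nat R else 0)"
    using primitive_indicator_poly[OF z] by blast
  define c where "c N = restrict (cyclic_coeff M (g ^ N * E)) {..<M}" for N
  have bound: "\<bar>cyclic_coeff M (g ^ N * E) i\<bar> \<le> int R" if i: "i < M" for N i
  proof -
    let ?h = "g ^ N * E"
    have zs: "(z ^ s) ^ M = 1" for s using z'(2) by (simp add: root_unity_power)
    have "of_nat M * of_int (cyclic_coeff M ?h i) = (\<Sum>s<M. ev ?h (z ^ s) * (z ^ s) ^ (M - i))"
      unfolding ev_cyclic_coeff[OF zs z'(1)] by (rule fourier_inversion[OF z i, symmetric])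
    then have "norm (of_nat M * of_int (cyclic_coeff M ?h i) :: complex)
        \<le> (\<Sum>s<M. norm (ev ?h (z ^ s) * (z ^ s) ^ (M - i)))"
      by (simp only: norm_sum)
    also have "\<dots> \<le> (\<Sum>s<M. real R)"
    proof (rule sum_mono)
      fix s
      show "norm (ev ?h (z ^ s) * (z ^ s) ^ (M - i)) \<le> real R"
        using E[of s] g[of s] norm_root_unity[OF zs z'(1), of s]
        by (auto simp: norm_mult norm_power)
    qed
    finally have "real M * \<bar>of_int (cyclic_coeff M ?h i)\<bar> \<le> real M * real R"
      by (simp add: norm_mult)
    then have "\<bar>real_of_int (cyclic_coeff M ?h i)\<bar> \<le> real R" using z'(1) by simp
    then show ?thesis by linarith
  qed
  have "c N \<in> PiE {..<M} (\<lambda>_. {- int R..int R})" for N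
    unfolding c_def restrict_PiE_iff using bound[of _ N] by (auto simp: abs_le_iff minus_le_iff)
  then have "range c \<subseteq> PiE {..<M} (\<lambda>_. {- int R..int R})" by blast
  then have "finite (range c)" by (rule finite_subset) (intro finite_PiE, auto)
  then have "\<not> inj c" using finite_imageD infinite_UNIV_nat by blast
  then obtain N N' where "N \<noteq> N'" "c N = c N'" by (auto simp: inj_def)
  then obtain N N' where N: "N < N'" "c N = c N'" by (metis nat_neq_iff)
  have "cyclic_coeff M (g ^ N * E) i = cyclic_coeff M (g ^ N' * E) i" if "i < M" for i
    using fun_cong[OF N(2), of i] that by (simp add: c_def)
  then have "ev (g ^ N * E) z = ev (g ^ N' * E) z"
    using ev_cyclic_coeff[OF z'(2,1)] by simp
  moreover have "ev E z = of_nat R" using E[of 1] by simp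
  ultimately have "ev g z ^ N = ev g z ^ N'" using R by simp
  also have "\<dots> = ev g z ^ N * ev g z ^ (N' - N)" using N(1) by (simp add: power_add[symmetric])
  finally have "ev g z ^ N * (ev g z ^ (N' - N) - 1) = 0" by (simp add: algebra_simps)
  moreover have "ev g z \<noteq> 0" using g[of 1] by auto
  ultimately have "ev g z ^ (N' - N) = 1" by simp
  then show ?thesis using N(1) by (intro exI[of _ "N' - N"]) simp
qed

section \<open>Roots of unity contained in Z[z]\<close>

lemma ev_eq_conjugate:
  assumes z: "primitive_root_unity M z" and "coprime s M" and "ev g z = ev h z"
  shows "ev g (z ^ s) = ev h (z ^ s)"
  using ev_root_unity_conjugate[of z M "g - h" s] primitive_root_unityD[OF z] assms by simp

lemma one_add_cong_one:
  fixes a b :: nat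
  assumes "a dvd b"
  shows "[1 + b = 1] (mod a)"
  using assms by (simp only: cong_add_lcancel_0_nat cong_0_iff)

lemma finite_order_primitive_root_unity:
  fixes u :: complex
  assumes "u ^ n = 1" "n > 0"
  shows "\<exists>w. primitive_root_unity w u"
proof -
  define w where "w = (LEAST w. w > 0 \<and> u ^ w = 1)"
  have w: "w > 0" "u ^ w = 1" and least: "\<And>k. k > 0 \<Longrightarrow> u ^ k = 1 \<Longrightarrow> w \<le> k"
    using LeastI[of "\<lambda>w. w > 0 \<and> u ^ w = 1" n] Least_le[of "\<lambda>w. w > 0 \<and> u ^ w = 1"] assms
    unfolding w_def by auto
  have "u ^ k = 1 \<longleftrightarrow> w dvd k" for k
  proof
    assume "u ^ k = 1"
    then have "u ^ (k mod w) = 1" using power_mod_root_unity[OF w(2)] by simp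
    then have "k mod w = 0" using least[of "k mod w"] w(1) by (meson mod_less_divisor not_gr_zero not_less)
    then show "w dvd k" by (simp add: dvd_eq_mod_eq_0)
  next
    assume "w dvd k"
    then show "u ^ k = 1" using w(2) by (auto simp: power_mult)
  qed
  then show ?thesis using w(1) by (auto simp: primitive_root_unity_def)
qed

text \<open>
  An automorphism of the field of \<open>M * w\<close>-th roots of unity that fixes \<open>z\<close> also fixes
  \<open>u\<close>, which restricts the order \<open>w\<close> of \<open>u\<close>.
\<close>

lemma root_unity_in_cyc_fixed:
  assumes z: "primitive_root_unity M z" and u: "primitive_root_unity w u" and "u \<in> cyc z"
    and r: "coprime r (M * w)" "[r = 1] (mod M)"
  shows "[r = 1] (mod w)"
proof -
  note z' = primitive_root_unityD[OF z] and u' = primitive_root_unityD[OF u]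
  define \<eta> where "\<eta> = cis (2 * pi / of_nat (M * w))"
  have \<eta>: "primitive_root_unity (M * w) \<eta>"
    unfolding \<eta>_def using z'(1) u'(1) by (intro primitive_root_unity_cis) simp
  obtain i where i: "z = \<eta> ^ i"
    using root_unity_eq_power[OF \<eta>, of z] z'(2) by (auto simp: power_mult)
  obtain j where j: "u = \<eta> ^ j"
    using root_unity_eq_power[OF \<eta>, of u] u'(2) by (auto simp: power_mult mult.commute[of M])
  obtain g where g: "u = ev g z" using \<open>u \<in> cyc z\<close> by (auto simp: cyc_def)
  have "ev (monom 1 j) \<eta> = ev (g \<circ>\<^sub>p monom 1 i) \<eta>" using g i j by simp
  then have "ev (monom 1 j) (\<eta> ^ r) = ev (g \<circ>\<^sub>p monom 1 i) (\<eta> ^ r)"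
    by (rule ev_eq_conjugate[OF \<eta> r(1)])
  then have "(\<eta> ^ r) ^ j = ev g ((\<eta> ^ r) ^ i)" by simp
  moreover have "(\<eta> ^ r) ^ i = z ^ r" "(\<eta> ^ r) ^ j = u ^ r"
    unfolding i j by (simp_all only: power_mult[symmetric] mult.commute)
  ultimately have "u ^ r = ev g (z ^ r)" by simp
  also have "z ^ r = z ^ 1" using r(2) by (simp only: primitive_root_unity_power_eq_iff[OF z])
  finally have "u ^ r = u ^ 1" using g by simp
  then show ?thesis by (simp only: primitive_root_unity_power_eq_iff[OF u])
qed

text \<open>If the p-part p^e of w were too large, some r prime to p would be 1 modulo M and modulo
  the p-free part of w, but not modulo p^e; \<open>root_unity_in_cyc_fixed\<close> forbids
  this.\<close>

lemma root_unity_in_cyc_order: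
  assumes z: "primitive_root_unity M z" and u: "primitive_root_unity w u" and uz: "u \<in> cyc z"
  shows "w dvd (if even M then M else 2 * M)"
proof (rule multiplicity_le_imp_dvd)
  note z' = primitive_root_unityD[OF z] and u' = primitive_root_unityD[OF u]
  show "w \<noteq> 0" using u'(1) by simp
  fix p :: nat assume p: "prime p"
  let ?M = "if even M then M else 2 * M"
  show "multiplicity p w \<le> multiplicity p ?M"
  proof (rule ccontr)
    assume less: "\<not> multiplicity p w \<le> multiplicity p ?M"
    have mM: "multiplicity p M < multiplicity p w"
      using less dvd_imp_multiplicity_le[of M ?M p] z'(1) by (auto split: if_splits)
    define e where "e = multiplicity p w"
    have "w \<noteq> 0" "\<not> is_unit p" using p u'(1) by auto
    then obtain w' where w': "w = p ^ e * w'" "\<not> p dvd w'"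
      unfolding e_def by (rule multiplicity_decompose')
    have "e > 0" using mM by (simp add: e_def)
    have contra: False
      if "coprime r p" "[r = 1] (mod M * w')" "\<not> [r = 1] (mod p ^ e)" for r
    proof -
      have "coprime r (M * w')" using that(2) cong_imp_coprime coprime_1_left cong_sym by blast
      then have "coprime r (M * w)" using that(1) w' by (simp add: coprime_power_right_iff)
      moreover have "[r = 1] (mod M)" using that(2) by (rule cong_dvd_modulus_nat) simp
      ultimately have "[r = 1] (mod w)" by (rule root_unity_in_cyc_fixed[OF z u uz])
      then have "[r = 1] (mod p ^ e)" by (rule cong_dvd_modulus_nat) (simp add: w')
      then show False using that(3) by simp
    qed
    show False
    proof (cases "p dvd M")
      case True
      define r where "r = 1 + M * w'"
      have "\<not> [r = 1] (mod p ^ e)"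
      proof
        assume "[r = 1] (mod p ^ e)"
        then have "p ^ e dvd M * w'" using cong_to_1_nat[of r "p ^ e"] by (simp add: r_def)
        moreover have "coprime (p ^ e) w'" using w'(2) p by (simp add: prime_imp_coprime_nat)
        ultimately have "p ^ e dvd M" by (simp add: coprime_dvd_mult_left_iff)
        then have "e \<le> multiplicity p M"
          using z'(1) \<open>\<not> is_unit p\<close> by (intro multiplicity_geI) auto
        then show False using mM by (simp add: e_def)
      qed
      moreover have "coprime r p"
      proof -
        have "[r = 1] (mod p)" unfolding r_def using True by (intro one_add_cong_one) simp
        then show ?thesis using cong_imp_coprime coprime_1_left cong_sym by blast
      qed
      moreover have "[r = 1] (mod M * w')" unfolding r_def by (rule one_add_cong_one) simp
      ultimately show False using contra by blast
    next
      case False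
      \<comment> \<open>A residue prime to p and different from 1: 2 for odd p. For p = 2 the
        residue 3 differs from 1 only modulo 4, and e >= 2 holds because the bound 2 M already
        allows one factor 2.\<close>
      define a where "a = (if p = 2 then 3 else 2 :: nat)"
      have e2: "e \<ge> 2" if "p = 2"
      proof -
        have "odd M" using False that by simp
        then have "multiplicity 2 (2 * M) = 1"
          using z'(1) multiplicity_times_same[of M "2 :: nat"] by (simp add: not_dvd_imp_multiplicity_0)
        then show ?thesis using less that \<open>odd M\<close> by (simp add: e_def)
      qed
      have "coprime (p ^ e) (M * w')"
        using False w'(2) p by (simp add: prime_imp_coprime_nat)
      then obtain r where r: "[r = a] (mod p ^ e)" "[r = 1] (mod M * w')"
        using binary_chinese_remainder_nat by blast
      have "coprime a p"
        using p primes_coprime[of 2 p] primes_coprime[of 3 p] by (auto simp: a_def)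
      moreover have "[r = a] (mod p)"
        using r(1) by (rule cong_dvd_modulus_nat) (use \<open>e > 0\<close> in simp)
      ultimately have "coprime r p" using cong_imp_coprime cong_sym by blast
      moreover have "\<not> [r = 1] (mod p ^ e)"
      proof
        assume "[r = 1] (mod p ^ e)"
        then have "[a = 1] (mod p ^ e)" using r(1) cong_sym cong_trans by blast
        then have d: "p ^ e dvd a - 1" by (rule cong_to_1_nat)
        show False
        proof (cases "p = 2")
          case True
          then have "2 ^ 2 dvd p ^ e" using e2 unfolding True by (intro le_imp_power_dvd) simp
          then have "2 ^ 2 dvd a - 1" using d by (rule dvd_trans)
          then show False using True by (simp add: a_def)
        next
          case False
          then show False using d \<open>e > 0\<close> p by (auto simp: a_def prime_power_eq_one_iff)
        qed
      qed
      ultimately show False using contra r(2) by blast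
    qed
  qed
qed

lemma root_unity_in_cyc:
  assumes z: "primitive_root_unity M z" and u: "u \<in> cyc z" "u ^ n = 1" "n > 0"
  shows "\<exists>k. u = z ^ k \<or> odd M \<and> u = - (z ^ k)"
proof -
  obtain w where w: "primitive_root_unity w u"
    using finite_order_primitive_root_unity[OF u(2,3)] by blast
  have "w dvd (if even M then M else 2 * M)" by (rule root_unity_in_cyc_order[OF z w u(1)])
  then have uM: "u ^ (if even M then M else 2 * M) = 1"
    using primitive_root_unityD(3)[OF w] by blast
  show ?thesis
  proof (cases "even M")
    case True
    then show ?thesis using uM root_unity_eq_power[OF z, of u] by auto
  next
    case False
    then have "(u ^ M)\<^sup>2 = 1" using uM by (simp add: power_mult[symmetric] mult.commute)
    then have "u ^ M = 1 \<or> u ^ M = - 1" by (simp add: power2_eq_1_iff)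
    then have "u ^ M = 1 \<or> (- u) ^ M = 1" using False by (auto simp: power_minus_odd)
    then show ?thesis
      using root_unity_eq_power[OF z, of u] root_unity_eq_power[OF z, of "- u"] False
      by (metis minus_minus)
  qed
qed

section \<open>Field descent\<close>

lemma zdvd_coprime_mult:
  assumes "coprime a b" "zdvd z (of_nat a) x" "zdvd z (of_nat b) x"
  shows "zdvd z (of_nat (a * b)) x"
proof -
  obtain s t where st: "s * int a + t * int b = 1"
    using bezout_int[of "int a" "int b"] assms(1) by auto
  obtain y y' where y: "y \<in> cyc z" "x = of_nat a * y" "y' \<in> cyc z" "x = of_nat b * y'"
    using assms(2,3) unfolding zdvd_def by blast
  have "of_int (s * int a + t * int b) * x = x" by (simp only: st of_int_1 mult_1)
  then have "x = of_int s * of_nat a * x + of_int t * of_nat b * x" by (simp add: algebra_simps)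
  also have "\<dots> = of_int s * of_nat a * (of_nat b * y') + of_int t * of_nat b * (of_nat a * y)"
    using y by simp
  also have "\<dots> = of_nat (a * b) * (of_int s * y' + of_int t * y)" by (simp add: algebra_simps)
  finally show ?thesis by (rule zdvdI) (intro cyc_add cyc_mult cyc_of_int y)
qed

lemma zdvd_prime_powers:
  assumes "n > 0" and x: "x \<in> cyc z"
    and q: "\<And>q. prime q \<Longrightarrow> q dvd n \<Longrightarrow> zdvd z (of_nat q ^ multiplicity q n) x"
  shows "zdvd z (of_nat n) x"
proof -
  have "zdvd z (of_nat (\<Prod>q\<in>S. q ^ multiplicity q n)) x"
    if "finite S" "S \<subseteq> prime_factors n" for S
    using that
  proof (induction S rule: finite_induct)
    case (insert q S)
    have "coprime (q ^ multiplicity q n) (\<Prod>q\<in>S. q ^ multiplicity q n)"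
      using insert by (intro prod_coprime_right) (auto intro!: primes_coprime)
    moreover have "zdvd z (of_nat (q ^ multiplicity q n)) x"
      using insert.prems q by auto
    ultimately have "zdvd z (of_nat (q ^ multiplicity q n * (\<Prod>q\<in>S. q ^ multiplicity q n))) x"
      using insert by (intro zdvd_coprime_mult) auto
    then show ?case using insert by simp
  qed (use x in simp)
  from this[of "prime_factors n"] show ?thesis
    using \<open>n > 0\<close> by (simp only: prime_factorization_nat[symmetric] finite_set_mset subset_refl)
qed

lemma prime_descent:
  assumes z: "primitive_root_unity M z" and q: "prime q" "M = M' * q ^ a" "\<not> q dvd M'"
    and s: "[s = q ^ j] (mod M')" "coprime s M"
    and b: "b \<in> cyc z" and dvd: "zdvd z (of_nat q ^ e) (ev A z * b)"
  shows "zdvd z (of_nat q ^ e) (ev A (z ^ s) * b)"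
proof (cases a)
  case 0
  then have M: "M' = M" using q(2) by simp
  show ?thesis
    by (rule prime_descent_unramified[OF z q(1) q(3)[unfolded M] s(1)[unfolded M] b dvd])
next
  case (Suc a')
  then have M: "M = M' * q ^ Suc a'" using q(2) by simp
  show ?thesis
    by (rule prime_descent_ramified[OF z[unfolded M] q(1,3) s(1) s(2)[unfolded M] b dvd])
qed

lemma conjugate_quotient_root_unity:
  assumes z: "primitive_root_unity M z" and "n > 0"
    and X: "\<And>s. coprime s M \<Longrightarrow> ev X (z ^ s) * cnj (ev X (z ^ s)) = of_nat n"
    and s: "coprime s M"
    and frob: "\<And>q. prime q \<Longrightarrow> q dvd n \<Longrightarrow>
      \<exists>j M' a. M = M' * q ^ a \<and> \<not> q dvd M' \<and> [s = q ^ j] (mod M')"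
  shows "\<exists>k. ev X (z ^ s) = z ^ k * ev X z \<or> odd M \<and> ev X (z ^ s) = - (z ^ k) * ev X z"
proof -
  note z' = primitive_root_unityD[OF z]
  define b where "b = cnj (ev X z)"
  \<comment> \<open>Complex conjugation is the automorphism with exponent M - 1. This puts
    \<open>b\<close> into Z[z] and lets identities involving conjugates be transferred to
    \<open>z ^ r\<close> as polynomial identities.\<close>
  have cnj: "cnj (ev X (z ^ r)) = ev X (z ^ (r * (M - 1)))" if "coprime r M" for r
  proof -
    have "(z ^ r) ^ M = 1" using z'(2) by (rule root_unity_power)
    then have "cnj (z ^ r) = (z ^ r) ^ (M - 1)" using z'(1) by (rule cnj_root_unity)
    then show ?thesis by (simp only: ev_cnj power_mult)
  qed
  have b: "b = ev X (z ^ (M - 1))" using cnj[of 1] by (simp add: b_def)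
  then have "b \<in> cyc z" by (auto intro: cyc_ev)
  have "zdvd z (of_nat n) (ev X (z ^ s) * b)"
  proof (rule zdvd_prime_powers[OF \<open>n > 0\<close>])
    show "ev X (z ^ s) * b \<in> cyc z" using \<open>b \<in> cyc z\<close> by (intro cyc_mult cyc_ev) auto
    fix q assume q: "prime q" "q dvd n"
    obtain j M' a where j: "M = M' * q ^ a" "\<not> q dvd M'" "[s = q ^ j] (mod M')"
      using frob[OF q] by blast
    have "n = q ^ multiplicity q n * (n div q ^ multiplicity q n)" by (simp add: multiplicity_dvd)
    then have "ev X z * b = of_nat q ^ multiplicity q n * of_nat (n div q ^ multiplicity q n)"
      using X[of 1] by (simp add: b_def flip: of_nat_power of_nat_mult)
    then have "zdvd z (of_nat q ^ multiplicity q n) (ev X z * b)" by (rule zdvdI) simp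
    then show "zdvd z (of_nat q ^ multiplicity q n) (ev X (z ^ s) * b)"
      by (rule prime_descent[OF z q(1) j s \<open>b \<in> cyc z\<close>])
  qed
  then obtain g where g: "ev X (z ^ s) * b = of_nat n * ev g z"
    by (auto simp: zdvd_def cyc_def)
  have "norm (ev g (z ^ r)) = 1" if r: "coprime r M" for r
  proof -
    have "ev (X \<circ>\<^sub>p monom 1 s * X \<circ>\<^sub>p monom 1 (M - 1)) z = ev (of_nat n * g) z"
      using g b by simp
    then have "ev (X \<circ>\<^sub>p monom 1 s * X \<circ>\<^sub>p monom 1 (M - 1)) (z ^ r) = ev (of_nat n * g) (z ^ r)"
      by (rule ev_eq_conjugate[OF z r])
    then have "ev X (z ^ (r * s)) * ev X (z ^ (r * (M - 1))) = of_nat n * ev g (z ^ r)"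
      by (simp add: power_mult)
    then have "ev X (z ^ (r * s)) * cnj (ev X (z ^ r)) = of_nat n * ev g (z ^ r)"
      using cnj[OF r] by simp
    then have "norm (ev X (z ^ (r * s))) * norm (ev X (z ^ r)) = real n * norm (ev g (z ^ r))"
      by (metis complex_mod_cnj norm_mult norm_of_nat)
    moreover have "norm (ev X (z ^ r')) = sqrt (real n)" if "coprime r' M" for r'
    proof -
      have "complex_of_real ((norm (ev X (z ^ r')))\<^sup>2) = of_nat n"
        using X[OF that] by (simp only: complex_norm_square)
      then have "(norm (ev X (z ^ r')))\<^sup>2 = real n"
        by (metis of_real_eq_iff of_real_of_nat_eq)
      then show ?thesis by (metis norm_ge_zero real_sqrt_unique)
    qed
    ultimately show ?thesis using r s \<open>n > 0\<close> by simp
  qed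
  then obtain N where N: "N > 0" "ev g z ^ N = 1" using kronecker_root_unity[OF z] by blast
  obtain k where k: "ev g z = z ^ k \<or> odd M \<and> ev g z = - (z ^ k)"
    using root_unity_in_cyc[OF z ev_in_cyc N(2,1)] by blast
  have "of_nat n * ev X (z ^ s) = ev X (z ^ s) * b * ev X z"
    using X[of 1] by (simp add: b_def mult_ac)
  also have "\<dots> = of_nat n * (ev g z * ev X z)" using g by simp
  finally have "ev X (z ^ s) = ev g z * ev X z" using \<open>n > 0\<close> by simp
  then show ?thesis using k by auto
qed

text \<open>
  Field descent for the cyclic group generated by the automorphism \<open>1 + F\<close>: the norm of the
  root of unity \<open>X (z ^ (1 + F)) / X z\<close> is 1, which makes it a power of \<open>z ^ F\<close>.
\<close>

lemma field_descent:
  assumes z: "primitive_root_unity M z" and "n > 0"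
    and X: "\<And>s. coprime s M \<Longrightarrow> ev X (z ^ s) * cnj (ev X (z ^ s)) = of_nat n"
    and F: "F dvd M" "\<And>p. prime p \<Longrightarrow> p dvd M \<Longrightarrow> p dvd F" "4 dvd M \<Longrightarrow> 4 dvd F"
    and frob: "\<And>q. prime q \<Longrightarrow> q dvd n \<Longrightarrow>
      \<exists>j M' a. M = M' * q ^ a \<and> \<not> q dvd M' \<and> [1 + F = q ^ j] (mod M')"
  shows "\<exists>j. \<forall>s. [s = 1] (mod F) \<longrightarrow> ev (X * monom 1 j) (z ^ s) = ev (X * monom 1 j) z"
proof -
  note z' = primitive_root_unityD[OF z]
  define \<tau> where "\<tau> = 1 + F"
  define N where "N = M div F"
  define S where "S = (\<Sum>i<N. \<tau> ^ i)"
  have MN: "M = F * N" using F(1) by (simp add: N_def)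
  have "F > 0" "N > 0" using MN z'(1) by (auto intro: Nat.gr0I)
  \<comment> \<open>The exponent \<open>S\<close> of the norm has the same p-part as
    \<open>N = M div F\<close>, so M dividing k S will force F to divide k.\<close>
  have S: "multiplicity p S = multiplicity p N" if p: "prime p" "p dvd M" for p
    unfolding S_def
  proof (rule multiplicity_geometric_sum[OF p(1) \<open>N > 0\<close>])
    show "[\<tau> = 1] (mod p)" unfolding \<tau>_def using F(2)[OF p] by (rule one_add_cong_one)
    show "odd N \<or> [\<tau> = 1] (mod 4)" if "p = 2"
    proof (cases "even N")
      case True
      have "2 dvd F" using F(2)[OF p] that by simp
      then have "2 * 2 dvd M" unfolding MN using True by (intro mult_dvd_mono)
      then show ?thesis using F(3) one_add_cong_one[of 4 F] by (simp add: \<tau>_def)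
    qed simp
  qed (simp add: \<tau>_def)
  have "S > 0" unfolding S_def using \<open>N > 0\<close> by (intro sum_pos) (auto simp: \<tau>_def)
  have "coprime \<tau> M"
  proof (rule ccontr)
    assume "\<not> coprime \<tau> M"
    then have "gcd \<tau> M \<noteq> 1" by (simp only: coprime_iff_gcd_eq_1 not_False_eq_True)
    then obtain p where "prime p" "p dvd gcd \<tau> M" using prime_factor_nat by blast
    then have "prime p" "p dvd 1 + F" "p dvd F" using F(2) by (auto simp: \<tau>_def)
    then show False by (metis dvd_add_left_iff not_prime_unit)
  qed
  have "N dvd S"
  proof (rule multiplicity_le_imp_dvd)
    fix p :: nat assume p: "prime p"
    show "multiplicity p N \<le> multiplicity p S"
    proof (cases "p dvd M")
      case False
      then have "\<not> p dvd N" unfolding MN using dvd_mult by blast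
      then show ?thesis by (simp add: not_dvd_imp_multiplicity_0)
    qed (simp add: S p)
  qed (use \<open>N > 0\<close> in simp)
  have FS: "F * S = \<tau> ^ N - 1"
    using geometric_sum_mult_nat[of \<tau> N] by (simp add: S_def \<tau>_def)
  have "M dvd \<tau> ^ N - 1" unfolding FS[symmetric] MN using \<open>N dvd S\<close> by simp
  then have "[1 + (\<tau> ^ N - 1) = 1] (mod M)" by (rule one_add_cong_one)
  moreover have "1 + (\<tau> ^ N - 1) = \<tau> ^ N" by (simp add: \<tau>_def)
  ultimately have "[\<tau> ^ N = 1] (mod M)" by (simp only:)
  from cong_power_root_unity[OF z'(2) this] have \<tau>N: "z ^ (\<tau> ^ N) = z" by simp
  have Xz: "ev X z \<noteq> 0" using X[of 1] \<open>n > 0\<close> by auto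
  have iter: "ev X (z ^ (\<tau> ^ i)) = \<epsilon> ^ i * z ^ (k * (\<Sum>l<i. \<tau> ^ l)) * ev X z"
    if \<epsilon>: "\<epsilon> = of_int \<epsilon>'" and k: "ev X (z ^ \<tau>) = \<epsilon> * z ^ k * ev X z" for \<epsilon> \<epsilon>' k i
  proof (induction i)
    case (Suc i)
    have "ev (X \<circ>\<^sub>p monom 1 \<tau>) z = ev (of_int \<epsilon>' * monom 1 k * X) z" using k \<epsilon> by simp
    then have "ev (X \<circ>\<^sub>p monom 1 \<tau>) (z ^ (\<tau> ^ i)) = ev (of_int \<epsilon>' * monom 1 k * X) (z ^ (\<tau> ^ i))"
      using \<open>coprime \<tau> M\<close> by (intro ev_eq_conjugate[OF z]) auto
    then have "ev X ((z ^ (\<tau> ^ i)) ^ \<tau>) = \<epsilon> * (z ^ (\<tau> ^ i)) ^ k * ev X (z ^ (\<tau> ^ i))"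
      using \<epsilon> by simp
    moreover have "(z ^ (\<tau> ^ i)) ^ \<tau> = z ^ (\<tau> ^ Suc i)" by (simp add: power_mult[symmetric] mult.commute)
    moreover have "(z ^ (\<tau> ^ i)) ^ k * z ^ (k * (\<Sum>l<i. \<tau> ^ l)) = z ^ (k * (\<Sum>l<Suc i. \<tau> ^ l))"
      by (simp add: power_mult[symmetric] power_add[symmetric] algebra_simps)
    ultimately show ?case using Suc by (simp add: mult_ac)
  qed simp
  \<comment> \<open>After N applications \<tau> returns to the identity, since \<tau>^N = 1 modulo
    M, and the nonzero value \<open>ev X z\<close> cancels.\<close>
  have eps: "\<epsilon> ^ N * z ^ (k * S) = 1"
    if \<epsilon>: "\<epsilon> = of_int \<epsilon>'" and k: "ev X (z ^ \<tau>) = \<epsilon> * z ^ k * ev X z" for \<epsilon> \<epsilon>' k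
    using iter[OF that, of N] \<tau>N Xz by (simp add: S_def)
  obtain k where k: "ev X (z ^ \<tau>) = z ^ k * ev X z"
  proof -
    obtain k where "ev X (z ^ \<tau>) = z ^ k * ev X z \<or> odd M \<and> ev X (z ^ \<tau>) = - (z ^ k) * ev X z"
      using conjugate_quotient_root_unity[OF z \<open>n > 0\<close> X \<open>coprime \<tau> M\<close>] frob unfolding \<tau>_def by blast
    \<comment> \<open>With M odd, N is odd as well, so the sign survives in the norm and -1 would be
      an M-th root of unity.\<close>
    moreover have False if "odd M" "ev X (z ^ \<tau>) = - (z ^ k) * ev X z"
    proof -
      have "(- 1) ^ N * z ^ (k * S) = 1" using eps[of "- 1" "- 1" k] that(2) by simp
      moreover have "odd N" using \<open>odd M\<close> MN by simp
      ultimately have "- (z ^ (k * S)) = 1" by (simp add: minus_one_power_iff)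
      then have "- (- (z ^ (k * S))) = - 1" by (simp only:)
      then have "(z ^ (k * S)) ^ M = - 1" using \<open>odd M\<close> by simp
      then show False using root_unity_power[OF z'(2), of "k * S"] by simp
    qed
    ultimately show ?thesis using that by blast
  qed
  have "F dvd k"
  proof (cases "k = 0")
    case False
    have "z ^ (k * S) = 1" using eps[of 1 1 k] k by simp
    then have kS: "M dvd k * S" using z'(3) by blast
    show ?thesis
    proof (rule multiplicity_le_imp_dvd)
      fix p :: nat assume p: "prime p"
      show "multiplicity p F \<le> multiplicity p k"
      proof (cases "p dvd M")
        case True
        have "multiplicity p F + multiplicity p N = multiplicity p M"
          unfolding MN using p \<open>F > 0\<close> \<open>N > 0\<close>
          by (intro prime_elem_multiplicity_mult_distrib[symmetric]) auto
        also have "\<dots> \<le> multiplicity p (k * S)"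
          using kS False \<open>S > 0\<close> by (intro dvd_imp_multiplicity_le) auto
        also have "\<dots> = multiplicity p k + multiplicity p N"
          using p False \<open>S > 0\<close> S[OF p True] by (subst prime_elem_multiplicity_mult_distrib) auto
        finally show ?thesis by simp
      next
        case pM: False
        then have "\<not> p dvd F" unfolding MN using dvd_mult2 by blast
        then show ?thesis by (simp add: not_dvd_imp_multiplicity_0)
      qed
    qed (use \<open>F > 0\<close> in simp)
  qed simp
  then obtain k' where k': "k = F * k'" by blast
  \<comment> \<open>A natural number congruent to -k' modulo M. Multiplying X by z^j cancels the
    factor z^k under \<tau>, because k + F j = F (k' + j) is 0 modulo M.\<close>
  define j where "j = (M - 1) * k'"
  define Y where "Y = X * monom 1 j"
  have "k + \<tau> * j = j + M * (F * k')"
  proof -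
    have "F * k' + F * j = F * (k' * (1 + (M - 1)))" by (simp add: j_def algebra_simps)
    also have "\<dots> = M * (F * k')" using z'(1) by (simp add: algebra_simps)
    finally show ?thesis by (simp add: k' \<tau>_def)
  qed
  then have "z ^ k * (z ^ \<tau>) ^ j = z ^ j * (z ^ M) ^ (F * k')"
    by (simp add: power_mult[symmetric] power_add[symmetric])
  then have Y1: "ev Y (z ^ \<tau>) = ev Y z" using k z'(2) by (simp add: Y_def mult_ac)
  have Yi: "ev Y (z ^ (\<tau> ^ i)) = ev Y z" for i
  proof (induction i)
    case (Suc i)
    have "ev (Y \<circ>\<^sub>p monom 1 \<tau>) z = ev Y z" using Y1 by simp
    then have "ev (Y \<circ>\<^sub>p monom 1 \<tau>) (z ^ (\<tau> ^ i)) = ev Y (z ^ (\<tau> ^ i))"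
      using \<open>coprime \<tau> M\<close> by (intro ev_eq_conjugate[OF z]) auto
    then show ?case using Suc by (simp add: power_mult[symmetric] mult.commute)
  qed simp
  have "ev Y (z ^ s) = ev Y z" if "[s = 1] (mod F)" for s
  proof -
    \<comment> \<open>Invariance under \<tau> extends to all s congruent to 1 modulo F, as these are
      exactly the powers of 1 + F modulo M.\<close>
    have "\<exists>i. [\<tau> ^ i = s] (mod M)"
    proof (rule power_cong_exists)
      show "[\<tau> = 1] (mod p)" if "prime p" "p dvd M" for p
        unfolding \<tau>_def using F(2)[OF that] by (rule one_add_cong_one)
      show "[\<tau> = 1] (mod 4)" if "4 dvd M"
        unfolding \<tau>_def using F(3)[OF that] by (rule one_add_cong_one)
      show "[s = 1] (mod gcd (\<tau> - 1) M)" using that F(1) by (simp add: \<tau>_def gcd_nat.absorb1)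
    qed (use z'(1) in \<open>auto simp: \<tau>_def\<close>)
    then obtain i where "[\<tau> ^ i = s] (mod M)" by blast
    then have "z ^ s = z ^ (\<tau> ^ i)" using cong_power_root_unity[OF z'(2)] by metis
    then show ?thesis using Yi by simp
  qed
  then show ?thesis unfolding Y_def by blast
qed

section \<open>Schmidt's function and the coefficient bound\<close>

lemma schmidt_F_witness:
  assumes "M > 0" "N \<noteq> 1"
  shows "\<exists>b. schmidt_admissible M N b \<and> schmidt_F M N = (\<Prod>p\<in>prime_factors M. p ^ b p)"
proof -
  let ?Q = "\<lambda>f. \<exists>b. schmidt_admissible M N b \<and> f = (\<Prod>p\<in>prime_factors M. p ^ b p)"
  have "multiplicity p M \<ge> 1" if "p \<in> prime_factors M" for p
    using that by (simp add: prime_factors_multiplicity Suc_le_eq)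
  then have "schmidt_admissible M N (\<lambda>p. multiplicity p M)"
    by (simp add: schmidt_admissible_def)
  then have "?Q (\<Prod>p\<in>prime_factors M. p ^ multiplicity p M)" by blast
  then have "?Q (LEAST f. ?Q f)" by (rule LeastI)
  then show ?thesis using assms(2) by (simp add: schmidt_F_def)
qed

lemma schmidt_power_cong:
  "[q ^ ord (schmidt_m M q) q = 1] (mod schmidt_m M q)"
  by (rule ord)

context
  fixes M N :: nat and b :: "nat \<Rightarrow> nat" and F :: nat
  assumes M: "M > 0" and adm: "schmidt_admissible M N b"
    and F_eq: "F = (\<Prod>p\<in>prime_factors M. p ^ b p)"
begin

lemma multiplicity_F:
  assumes "prime p"
  shows "multiplicity p F = (if p dvd M then b p else 0)"
  unfolding F_eq using assms M by (subst multiplicity_prod_prime_powers) (auto simp: in_prime_factors_iff)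

lemma F_pos: "F > 0"
  unfolding F_eq by (intro prod_pos) (auto simp: in_prime_factors_iff prime_gt_0_nat)

lemma admissible_exponent:
  assumes "prime p" "p dvd M"
  shows "1 \<le> b p" "b p \<le> multiplicity p M"
  using adm assms M by (auto simp: schmidt_admissible_def in_prime_factors_iff)

lemma F_dvd: "F dvd M"
proof (rule multiplicity_le_imp_dvd)
  fix p :: nat assume "prime p"
  then show "multiplicity p F \<le> multiplicity p M"
    using admissible_exponent by (simp add: multiplicity_F)
qed (use F_pos in simp)

lemma prime_dvd_F:
  assumes "prime p" "p dvd M"
  shows "p dvd F"
proof -
  have "multiplicity p F > 0" using multiplicity_F[OF assms(1)] admissible_exponent[OF assms] assms by simp
  then show ?thesis using not_dvd_imp_multiplicity_0[of p F] by auto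
qed

text \<open>Exponent 1 at the prime 2 satisfies no alternative of admissibility when 4 divides M:
  the first excludes (2, 1), the second fails, and the third fails because for odd q and even M the
  number \<open>schmidt_m M q\<close> is divisible by 4. The factor 4 in \<open>schmidt_m\<close>
  supplies exactly this.\<close>

lemma four_dvd_F:
  assumes "4 dvd M" "prime q" "q dvd N"
  shows "4 dvd F"
proof -
  have "2 ^ 2 dvd M" using assms(1) by simp
  then have m2: "2 \<le> multiplicity 2 M" using M by (intro multiplicity_geI) auto
  have "2 dvd M" using assms(1) by (rule dvd_trans[rotated]) simp
  have "b 2 \<noteq> 1"
  proof
    assume "b 2 = 1"
    then have "q \<noteq> 2 \<and> \<not> [q ^ ord (schmidt_m M q) q = 1] (mod 2 ^ 2)"
      using adm M assms m2 \<open>2 dvd M\<close>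
      unfolding schmidt_admissible_def by (auto simp: in_prime_factors_iff dest!: bspec[of _ _ 2])
    moreover have "q \<noteq> 2 \<Longrightarrow> 4 dvd schmidt_m M q"
      using \<open>2 dvd M\<close> by (simp add: schmidt_m_def)
    then have "q \<noteq> 2 \<Longrightarrow> [q ^ ord (schmidt_m M q) q = 1] (mod 4)"
      using schmidt_power_cong cong_dvd_modulus_nat by blast
    ultimately show False by simp
  qed
  then have "multiplicity 2 F \<ge> 2"
    using admissible_exponent[of 2] \<open>2 dvd M\<close> by (simp add: multiplicity_F)
  then have "2 ^ 2 dvd F" by (rule multiplicity_dvd')
  then show ?thesis by simp
qed

text \<open>Let x be q to its order modulo \<open>schmidt_m M q\<close>, and M' the q-free part of
  M. Then x is 1 modulo each prime of M', and modulo 4 if 4 divides M', so its powers are all the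
  residues that are 1 modulo gcd (x - 1) M'. The admissible exponents bound this gcd prime by prime,
  so it divides F and 1 + F is among the powers.\<close>

lemma one_add_F_frobenius_power:
  assumes q: "prime q" "q dvd N"
  shows "\<exists>j M' a. M = M' * q ^ a \<and> \<not> q dvd M' \<and> [1 + F = q ^ j] (mod M')"
proof -
  have "M \<noteq> 0" "\<not> is_unit q" using M q by auto
  then obtain M' where M': "M = q ^ multiplicity q M * M'" "\<not> q dvd M'"
    by (rule multiplicity_decompose')
  define x where "x = q ^ ord (schmidt_m M q) q"
  have x1: "x \<ge> 1" using q(1) prime_gt_0_nat[of q] by (simp add: x_def)
  have "M' > 0" using M M'(1) by (auto intro: Nat.gr0I)
  have x_cong: "[x = 1] (mod c)" if "c dvd schmidt_m M q" for c
    unfolding x_def using schmidt_power_cong that by (rule cong_dvd_modulus_nat)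
  have pM: "p dvd M" if "p dvd M'" for p using that M'(1) by (metis dvd_mult)
  have p_dvd: "p dvd schmidt_m M q" if p: "prime p" "p dvd M'" for p
  proof -
    have pq: "p \<noteq> q" using p M'(2) by auto
    have pf: "p \<in> prime_factors M" using p pM M by (simp add: in_prime_factors_iff)
    show ?thesis
    proof (cases "odd M \<or> q = 2")
      case True
      then show ?thesis using pf pq by (auto simp: schmidt_m_def intro!: dvd_prodI[of _ _ id, simplified])
    next
      case False
      show ?thesis
      proof (cases "p = 2")
        case True
        then show ?thesis using False by (simp add: schmidt_m_def)
      next
        case p2: False
        have "p dvd \<Prod>(prime_factors M - {2, q})"
          using pf pq p2 by (intro dvd_prodI[of _ _ id, simplified]) auto
        then show ?thesis using False by (simp add: schmidt_m_def)
      qed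
    qed
  qed
  have gF: "gcd (x - 1) M' dvd F"
  proof (rule multiplicity_le_imp_dvd)
    show "gcd (x - 1) M' \<noteq> 0" using \<open>M' > 0\<close> by simp
    fix p :: nat assume p: "prime p"
    show "multiplicity p (gcd (x - 1) M') \<le> multiplicity p F"
    proof (cases "p dvd M'")
      case False
      then have "\<not> p dvd gcd (x - 1) M'" by simp
      then show ?thesis by (simp add: not_dvd_imp_multiplicity_0)
    next
      case True
      then have "p \<noteq> q" using M'(2) by blast
      then have "b p = multiplicity p M \<or> \<not> [x = 1] (mod p ^ (b p + 1))"
        using adm p pM[OF True] M q unfolding schmidt_admissible_def x_def
        by (auto simp: in_prime_factors_iff dest!: bspec[of _ _ p])
      then have "multiplicity p (gcd (x - 1) M') \<le> b p"
      proof
        assume "b p = multiplicity p M"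
        moreover have "gcd (x - 1) M' dvd M" by (rule dvd_trans[OF gcd_dvd2]) (use M'(1) in \<open>metis dvd_triv_right\<close>)
        ultimately show ?thesis using M by (simp add: dvd_imp_multiplicity_le)
      next
        assume not: "\<not> [x = 1] (mod p ^ (b p + 1))"
        show ?thesis
        proof (rule ccontr)
          assume "\<not> ?thesis"
          then have "p ^ (b p + 1) dvd gcd (x - 1) M'" by (intro multiplicity_dvd') simp
          then have "p ^ (b p + 1) dvd x - 1" by simp
          then have "[1 + (x - 1) = 1] (mod p ^ (b p + 1))" by (rule one_add_cong_one)
          then show False using not x1 by simp
        qed
      qed
      then show ?thesis using multiplicity_F[OF p] pM[OF True] by simp
    qed
  qed
  have "\<exists>k. [x ^ k = 1 + F] (mod M')"
  proof (rule power_cong_exists[OF \<open>M' > 0\<close> x1])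
    show "[x = 1] (mod p)" if "prime p" "p dvd M'" for p
      using p_dvd[OF that] by (rule x_cong)
    show "[x = 1] (mod 4)" if four: "4 dvd M'"
    proof (rule x_cong)
      have "2 dvd M'" using four by (rule dvd_trans[rotated]) simp
      then have "q \<noteq> 2" "even M" using M'(2) pM by auto
      then show "4 dvd schmidt_m M q" by (simp add: schmidt_m_def)
    qed
    show "[1 + F = 1] (mod gcd (x - 1) M')" using gF by (rule one_add_cong_one)
  qed
  then obtain k where "[x ^ k = 1 + F] (mod M')" by blast
  then have "[1 + F = q ^ (ord (schmidt_m M q) q * k)] (mod M')"
    by (simp only: x_def power_mult cong_sym_eq)
  then show ?thesis using M' by (metis mult.commute)
qed

end

section \<open>Fourier analysis of bounded coefficient vectors\<close>

lemma parseval: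
  fixes e :: "nat \<Rightarrow> real"
  assumes \<omega>: "primitive_root_unity F \<omega>"
  shows "(\<Sum>u<F. (norm (\<Sum>k<F. of_real (e k) * (\<omega> ^ u) ^ k))\<^sup>2) = real F * (\<Sum>k<F. (e k)\<^sup>2)"
proof -
  note w' = primitive_root_unityD[OF \<omega>]
  define S where "S u = (\<Sum>k<F. complex_of_real (e k) * (\<omega> ^ u) ^ k)" for u
  have cnjS: "cnj (S u) = (\<Sum>l<F. of_real (e l) * (\<omega> ^ u) ^ (F - l))" for u
  proof -
    let ?w = "\<omega> ^ u"
    have w1: "?w ^ F = 1" using w'(2) by (rule root_unity_power)
    have "cnj ?w ^ l = ?w ^ (F - l)" if "l < F" for l
    proof -
      have "?w * cnj ?w = 1"
        using norm_root_unity[OF w1 w'(1)] by (simp only: complex_norm_square[symmetric]) simp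
      then have "?w ^ l * cnj ?w ^ l = 1"
        by (simp only: power_mult_distrib[symmetric] power_one)
      moreover have "?w ^ l * ?w ^ (F - l) = 1" using w1 that by (simp add: power_add[symmetric])
      ultimately have "?w ^ l * cnj ?w ^ l = ?w ^ l * ?w ^ (F - l)" by (simp only:)
      moreover have "?w ^ l \<noteq> 0" using w'(4) by simp
      ultimately show ?thesis by (simp only: mult_cancel_left) simp
    qed
    then show ?thesis by (simp add: S_def)
  qed
  have "(\<Sum>u<F. S u * cnj (S u)) = (\<Sum>u<F. \<Sum>l<F. of_real (e l) * (S u * (\<omega> ^ u) ^ (F - l)))"
    unfolding cnjS by (simp add: sum_distrib_left mult_ac)
  also have "\<dots> = (\<Sum>l<F. of_real (e l) * (\<Sum>u<F. S u * (\<omega> ^ u) ^ (F - l)))"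
    by (subst sum.swap) (simp add: sum_distrib_left)
  also have "\<dots> = (\<Sum>l<F. of_real (e l) * (of_nat F * of_real (e l)))"
    unfolding S_def using fourier_inversion[OF \<omega>, of _ "\<lambda>k. of_real (e k)"] by simp
  also have "\<dots> = of_real (real F * (\<Sum>k<F. (e k)\<^sup>2))"
    by (simp add: sum_distrib_left power2_eq_square mult_ac)
  finally have "complex_of_real (\<Sum>u<F. (norm (S u))\<^sup>2) = of_real (real F * (\<Sum>k<F. (e k)\<^sup>2))"
    by (simp only: of_real_sum complex_norm_square)
  then show ?thesis unfolding S_def by (simp only: of_real_eq_iff)
qed

lemma sum_shift_mod:
  fixes f :: "nat \<Rightarrow> 'a::comm_monoid_add"
  assumes "d > 0"
  shows "(\<Sum>i<d. f ((i + t) mod d)) = (\<Sum>i<d. f i)"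
proof -
  have "inj_on (\<lambda>i. (i + t) mod d) {..<d}"
  proof (rule inj_onI)
    fix x y assume "x \<in> {..<d}" "y \<in> {..<d}" "(x + t) mod d = (y + t) mod d"
    then have "[x = y] (mod d)" by (simp add: cong_add_rcancel_nat flip: cong_def)
    then show "x = y" using \<open>x \<in> {..<d}\<close> \<open>y \<in> {..<d}\<close> by (simp add: cong_less_modulus_unique_nat)
  qed
  moreover have "(\<lambda>i. (i + t) mod d) ` {..<d} \<subseteq> {..<d}" using assms by auto
  ultimately have "bij_betw (\<lambda>i. (i + t) mod d) {..<d} {..<d}"
    by (simp add: bij_betw_def endo_inj_surj)
  then show ?thesis by (rule sum.reindex_bij_betw)
qed

text \<open>
  Subtracting \<open>C / 2\<close> from all coefficients does not change the values at nontrivial roots of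
  unity and makes the coefficients at most \<open>C / 2\<close> in absolute value.
\<close>

lemma norm_bound_bounded_coeffs:
  fixes b :: "nat \<Rightarrow> nat"
  assumes \<omega>: "primitive_root_unity F \<omega>" and "F > 1" and b: "\<And>k. k < F \<Longrightarrow> b k \<le> C"
    and n: "\<And>u. u < F \<Longrightarrow> coprime u F \<Longrightarrow> (norm (\<Sum>k<F. of_nat (b k) * (\<omega> ^ u) ^ k))\<^sup>2 = real n"
  shows "4 * real (totient F) * real n \<le> (real F)\<^sup>2 * (real C)\<^sup>2"
proof -
  note w' = primitive_root_unityD[OF \<omega>]
  define e where "e k = real (b k) - real C / 2" for k
  have tot: "totatives F \<subseteq> {..<F}" using \<open>F > 1\<close> by (auto simp: totatives_less)
  have "(norm (\<Sum>k<F. of_real (e k) * (\<omega> ^ u) ^ k))\<^sup>2 = real n" if u: "u \<in> totatives F" for u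
  proof -
    have cop: "coprime u F" using u by (simp add: totatives_def)
    have "\<omega> ^ u \<noteq> 1"
    proof
      assume "\<omega> ^ u = 1"
      then have "F dvd u" using w'(3) by blast
      then have "F dvd 1" by (rule coprime_common_divisor[OF cop _ dvd_refl])
      then show False using \<open>F > 1\<close> by simp
    qed
    then have "(\<Sum>k<F. (\<omega> ^ u) ^ k) = 0"
      using sum_powers_root_unity[OF root_unity_power[OF w'(2)]] by simp
    then have "(\<Sum>k<F. of_real (e k) * (\<omega> ^ u) ^ k) = (\<Sum>k<F. of_nat (b k) * (\<omega> ^ u) ^ k)"
      by (simp add: e_def left_diff_distrib sum_subtractf sum_distrib_left[symmetric]
          del: times_divide_eq_left)
    then show ?thesis using n[of u] tot u cop by auto
  qed
  then have "real (totient F) * real n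
      = (\<Sum>u\<in>totatives F. (norm (\<Sum>k<F. of_real (e k) * (\<omega> ^ u) ^ k))\<^sup>2)"
    by (simp add: totient_def)
  \<comment> \<open>Only the values at primitive roots are known to be \<open>n\<close>; the others
    enter as nonnegative terms.\<close>
  also have "\<dots> \<le> (\<Sum>u<F. (norm (\<Sum>k<F. of_real (e k) * (\<omega> ^ u) ^ k))\<^sup>2)"
    using tot by (intro sum_mono2) auto
  also have "\<dots> = real F * (\<Sum>k<F. (e k)\<^sup>2)" by (rule parseval[OF \<omega>])
  also have "\<dots> \<le> real F * (\<Sum>k<F. (real C / 2)\<^sup>2)"
  proof (intro mult_left_mono sum_mono)
    fix k assume "k \<in> {..<F}"
    then have "\<bar>e k\<bar> \<le> \<bar>real C / 2\<bar>" using b[of k] by (simp add: e_def abs_le_iff field_simps)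
    then show "(e k)\<^sup>2 \<le> (real C / 2)\<^sup>2" by (simp only: abs_le_square_iff)
  qed simp
  finally show ?thesis by (simp add: power2_eq_square field_simps)
qed

text \<open>The invariant multiple Y of X equals its average over the automorphisms z -> z^(1 + F
  r), r < d / F. Averaging deletes every term whose index is not a multiple of d / F and leaves the
  others unchanged, so Y is a combination of F-th roots of unity whose coefficients still lie
  between 0 and \<open>C\<close>.\<close>

theorem schmidt_field_descent_bound:
  fixes c :: "nat \<Rightarrow> nat"
  assumes z: "primitive_root_unity d z" and "d > 1" "n > 0"
    and N: "N > 1" "\<And>q. prime q \<Longrightarrow> q dvd n \<Longrightarrow> q dvd N"
    and c: "\<And>i. i < d \<Longrightarrow> c i \<le> C"
    and n: "\<And>s. coprime s d \<Longrightarrow> (norm (\<Sum>i<d. of_nat (c i) * (z ^ s) ^ i))\<^sup>2 = real n"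
  shows "4 * real (totient (schmidt_F d N)) * real n \<le> (real (schmidt_F d N))\<^sup>2 * (real C)\<^sup>2"
proof -
  note z' = primitive_root_unityD[OF z]
  obtain b where adm: "schmidt_admissible d N b"
    and F_eq: "schmidt_F d N = (\<Prod>p\<in>prime_factors d. p ^ b p)"
    using schmidt_F_witness[of d N] z'(1) N(1) by auto
  define F where "F = schmidt_F d N"
  note F = z'(1) adm F_eq[folded F_def]
  have Fd: "F dvd d" by (rule F_dvd[OF F])
  obtain q where q: "prime q" "q dvd N" using prime_factor_nat[of N] N(1) by auto
  have "F > 1"
  proof -
    obtain p where p: "prime p" "p dvd d" using prime_factor_nat[of d] \<open>d > 1\<close> by auto
    then have "p dvd F" by (rule prime_dvd_F[OF F])
    then have "p \<le> F" using F_pos[OF F] by (rule dvd_imp_le)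
    then show ?thesis using prime_gt_1_nat[OF p(1)] by simp
  qed
  define N' where "N' = d div F"
  have dN: "d = N' * F" using Fd by (simp add: N'_def)
  have "N' > 0" using dN z'(1) by (auto intro: Nat.gr0I)
  define X where "X = (\<Sum>i<d. monom (int (c i)) i)"
  have evX: "ev X w = (\<Sum>i<d. of_nat (c i) * w ^ i)" for w by (simp add: X_def)
  have X: "ev X (z ^ s) * cnj (ev X (z ^ s)) = of_nat n" if "coprime s d" for s
    using n[OF that] by (simp only: evX complex_norm_square[symmetric]) simp
  obtain j where j: "\<And>s. [s = 1] (mod F) \<Longrightarrow> ev (X * monom 1 j) (z ^ s) = ev (X * monom 1 j) z"
    using field_descent[OF z \<open>n > 0\<close> X Fd prime_dvd_F[OF F] four_dvd_F[OF F _ q]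
        one_add_F_frobenius_power[OF F _ N(2)]] by blast
  define Y where "Y = X * monom 1 j"
  \<comment> \<open>The shift by -j modulo d: multiplication by z^j only permutes the coefficients
    cyclically.\<close>
  define t where "t = (d - 1) * j"
  define c' where "c' i = c ((i + t) mod d)" for i
  have evY: "ev Y w = (\<Sum>i<d. of_nat (c' i) * w ^ i)" if w: "w ^ d = 1" for w
  proof -
    have "w ^ ((i + t) mod d + j) = w ^ i" for i
    proof -
      have "w ^ ((i + t) mod d + j) = w ^ (i + t + j)"
        by (simp add: power_add power_mod_root_unity[OF w, of "i + t"])
      also have "i + t + j = i + d * j" using z'(1) by (cases d) (auto simp: t_def)
      also have "w ^ (i + d * j) = w ^ i" using w by (simp add: power_add power_mult)
      finally show ?thesis .
    qed
    moreover have "ev Y w = (\<Sum>i<d. of_nat (c i) * w ^ (i + j))"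
      by (simp add: Y_def evX sum_distrib_right power_add mult.assoc)
    ultimately show ?thesis
      using sum_shift_mod[OF z'(1), of "\<lambda>i. of_nat (c i) * w ^ (i + j)" t] by (simp add: c'_def)
  qed
  have multiples: "{i. i < d \<and> N' dvd i} = (\<lambda>k. N' * k) ` {..<F}"
    using \<open>N' > 0\<close> by (auto simp: dN elim!: dvdE)
  have "of_nat N' * ev Y z = (\<Sum>r<N'. ev Y (z ^ (1 + F * r)))"
  proof -
    have "ev Y (z ^ (1 + F * r)) = ev Y z" for r
      unfolding Y_def by (rule j) (rule one_add_cong_one, simp)
    then show ?thesis by simp
  qed
  also have "\<dots> = (\<Sum>r<N'. \<Sum>i<d. of_nat (c' i) * (z ^ i * (z ^ (F * i)) ^ r))"
  proof (intro sum.cong refl)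
    fix r
    have "(z ^ (1 + F * r)) ^ i = z ^ i * (z ^ (F * i)) ^ r" for i
      by (simp only: power_mult[symmetric] power_add[symmetric]) (simp add: algebra_simps)
    then show "ev Y (z ^ (1 + F * r)) = (\<Sum>i<d. of_nat (c' i) * (z ^ i * (z ^ (F * i)) ^ r))"
      using evY[OF root_unity_power[OF z'(2)], of "1 + F * r"] by (simp only:)
  qed
  also have "\<dots> = (\<Sum>i<d. of_nat (c' i) * (z ^ i * (\<Sum>r<N'. (z ^ (F * i)) ^ r)))"
    by (subst sum.swap) (simp only: sum_distrib_left)
  also have "\<dots> = (\<Sum>i<d. if N' dvd i then of_nat N' * (of_nat (c' i) * z ^ i) else 0)"
  proof (intro sum.cong refl)
    fix i
    have "(z ^ (F * i)) ^ N' = (z ^ d) ^ i"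
      by (simp only: power_mult[symmetric] dN) (simp add: mult_ac)
    then have "(z ^ (F * i)) ^ N' = 1" using z'(2) by simp
    moreover have "z ^ (F * i) = 1 \<longleftrightarrow> N' dvd i"
      using \<open>F > 1\<close> by (simp add: z'(3) dN mult.commute[of F])
    ultimately show "of_nat (c' i) * (z ^ i * (\<Sum>r<N'. (z ^ (F * i)) ^ r))
        = (if N' dvd i then of_nat N' * (of_nat (c' i) * z ^ i) else 0)"
      by (simp add: sum_powers_root_unity)
  qed
  also have "\<dots> = (\<Sum>i | i < d \<and> N' dvd i. of_nat N' * (of_nat (c' i) * z ^ i))"
    by (subst sum.inter_filter[symmetric]) auto
  also have "\<dots> = (\<Sum>k<F. of_nat N' * (of_nat (c' (N' * k)) * z ^ (N' * k)))"
    unfolding multiples using \<open>N' > 0\<close> by (subst sum.reindex) (auto simp: inj_on_def)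
  also have "\<dots> = of_nat N' * (\<Sum>k<F. of_nat (c' (N' * k)) * z ^ (N' * k))"
    by (simp only: sum_distrib_left)
  finally have Yz: "ev Y z = (\<Sum>k<F. of_nat (c' (N' * k)) * z ^ (N' * k))"
    using \<open>N' > 0\<close> by simp
  show ?thesis
    unfolding F_def[symmetric]
  proof (rule norm_bound_bounded_coeffs[of F "z ^ N'" "\<lambda>k. c' (N' * k)"])
    show "primitive_root_unity F (z ^ N')"
      using z unfolding dN by (rule primitive_root_unity_power)
    show "c' (N' * k) \<le> C" for k unfolding c'_def using z'(1) by (intro c) simp
    fix u assume u: "coprime u F"
    have cop: "coprime u d"
    proof (rule ccontr)
      assume "\<not> coprime u d"
      then have "gcd u d \<noteq> 1" by (simp only: coprime_iff_gcd_eq_1 not_False_eq_True)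
      then obtain p where "prime p" "p dvd gcd u d" using prime_factor_nat by blast
      then have "prime p" "p dvd u" "p dvd F" using prime_dvd_F[OF F] by auto
      then show False using u coprime_common_divisor not_prime_unit by blast
    qed
    \<comment> \<open>The reduced expression was obtained at \<open>z\<close> alone. As
      \<open>d\<close> and \<open>F\<close> have the same prime divisors, u is prime to d, and the
      equality of the two polynomials at \<open>z\<close> transfers to \<open>z ^ u\<close>.\<close>
    define Z where "Z = (\<Sum>k<F. monom (int (c' (N' * k))) (N' * k))"
    have "ev Z z = ev Y z" by (simp add: Z_def Yz)
    then have ZY: "ev Z (z ^ u) = ev Y (z ^ u)" by (rule ev_eq_conjugate[OF z cop])
    have "(z ^ u) ^ (N' * k) = ((z ^ N') ^ u) ^ k" for k
      by (simp only: power_mult[symmetric]) (simp add: mult_ac)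
    then have "(\<Sum>k<F. of_nat (c' (N' * k)) * ((z ^ N') ^ u) ^ k) = ev X (z ^ u) * (z ^ u) ^ j"
      using ZY by (simp add: Z_def Y_def)
    moreover have "norm (z ^ u) = 1"
      using root_unity_power[OF z'(2)] z'(1) by (rule norm_root_unity)
    ultimately show "(norm (\<Sum>k<F. of_nat (c' (N' * k)) * ((z ^ N') ^ u) ^ k))\<^sup>2 = real n"
      using n[OF cop] by (simp add: norm_mult norm_power evX)
  qed (use \<open>F > 1\<close> in simp)
qed

section \<open>Characters of finite abelian groups\<close>

lemma (in group) pow_eq_imp_cong_ord:
  assumes "g \<in> carrier G" "g [^] (i::nat) = g [^] (j::nat)"
  shows "[i = j] (mod ord g)"
proof -
  have "g [^] int i = g [^] int j" using assms(2) by (simp add: int_pow_int)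
  then have "int (ord g) dvd int j - int i" using int_pow_eq[OF assms(1)] by blast
  then have "[int j = int i] (mod int (ord g))" by (simp add: cong_iff_dvd_diff)
  then show ?thesis by (simp add: cong_int_iff cong_sym_eq)
qed

lemma (in comm_group) ord_mult_coprime:
  assumes a: "a \<in> carrier G" and b: "b \<in> carrier G" and cop: "coprime (ord a) (ord b)"
  shows "ord (a \<otimes> b) = ord a * ord b"
proof (rule dvd_antisym)
  show "ord (a \<otimes> b) dvd ord a * ord b" using a b by (rule abelian_ord_mul_divides)
  have part: "ord x dvd ord (x \<otimes> y)" if x: "x \<in> carrier G" and y: "y \<in> carrier G" and "coprime (ord x) (ord y)" for x y
  proof -
    let ?n = "ord (x \<otimes> y)"
    have "(x \<otimes> y) [^] (?n * ord y) = \<one>" using x y by (simp add: nat_pow_pow[symmetric])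
    moreover have "(x \<otimes> y) [^] (?n * ord y) = x [^] (?n * ord y) \<otimes> y [^] (?n * ord y)"
      using x y by (rule nat_pow_distrib)
    moreover have "y [^] (?n * ord y) = \<one>" using y by (simp add: pow_eq_id)
    ultimately have "x [^] (?n * ord y) = \<one>" using x by simp
    then have "ord x dvd ?n * ord y" using x by (simp add: pow_eq_id)
    then show ?thesis using that(3) by (simp add: coprime_dvd_mult_left_iff)
  qed
  have "ord a dvd ord (a \<otimes> b)" using part a b cop by blast
  moreover have "ord b dvd ord (a \<otimes> b)" using part[of b a] a b cop by (simp add: m_comm coprime_commute)
  ultimately show "ord a * ord b dvd ord (a \<otimes> b)" using cop by (simp add: divides_mult)
qed

text \<open>Take g of maximal order. If the p-part of some ord x exceeded that of ord g, the product
  of the p-free part of g and the p-part of x would have a larger order.\<close>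

lemma (in comm_group) ord_eq_group_exp_exists:
  assumes fin: "finite (carrier G)"
  shows "\<exists>g\<in>carrier G. ord g = group_exp G"
proof -
  have pos: "ord x > 0" if "x \<in> carrier G" for x using ord_ge_1[OF fin that] by simp
  obtain g where g: "g \<in> carrier G" and max: "\<And>x. x \<in> carrier G \<Longrightarrow> ord x \<le> ord g"
  proof -
    have "Max (ord ` carrier G) \<in> ord ` carrier G" using fin by (intro Max_in) auto
    then obtain g where "g \<in> carrier G" "Max (ord ` carrier G) = ord g" by auto
    then show ?thesis using that Max_ge[OF finite_imageI[OF fin, of ord]] by auto
  qed
  have dvd: "ord x dvd ord g" if x: "x \<in> carrier G" for x
  proof (rule multiplicity_le_imp_dvd)
    show "ord x \<noteq> 0" using pos[OF x] by simp
    fix p :: nat assume p: "prime p"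
    show "multiplicity p (ord x) \<le> multiplicity p (ord g)"
    proof (rule ccontr)
      assume less: "\<not> multiplicity p (ord x) \<le> multiplicity p (ord g)"
      have p': "\<not> is_unit p" and "ord g \<noteq> 0" "ord x \<noteq> 0" using p pos[OF g] pos[OF x] by auto
      obtain u where u: "ord g = p ^ multiplicity p (ord g) * u" "\<not> p dvd u"
        using \<open>ord g \<noteq> 0\<close> p' by (rule multiplicity_decompose')
      obtain y where y: "ord x = p ^ multiplicity p (ord x) * y" "\<not> p dvd y"
        using \<open>ord x \<noteq> 0\<close> p' by (rule multiplicity_decompose')
      define P where "P = p ^ multiplicity p (ord g)"
      define P' where "P' = p ^ multiplicity p (ord x)"
      let ?a = "g [^] P" and ?b = "x [^] y"
      have u': "ord g = P * u" and y': "ord x = P' * y" using u y by (simp_all only: P_def P'_def)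
      then have "y > 0" "u > 0" "P > 0" using \<open>ord g \<noteq> 0\<close> \<open>ord x \<noteq> 0\<close> by auto
      have oa: "ord ?a = u" using ord_pow[OF g, of P] \<open>P > 0\<close> by (simp add: u')
      have ob: "ord ?b = P'" using ord_pow[OF x, of y] \<open>y > 0\<close> by (simp add: y')
      have "coprime p u" using u(2) p by (simp add: prime_imp_coprime_nat)
      then have "coprime u P'" unfolding P'_def by (simp add: coprime_commute)
      then have "ord (?a \<otimes> ?b) = u * P'" using ord_mult_coprime[of ?a ?b] g x oa ob by simp
      moreover have "P < P'"
        unfolding P_def P'_def using less prime_gt_1_nat[OF p] by (intro power_strict_increasing) auto
      then have "ord g < u * P'" using \<open>u > 0\<close> by (simp add: u' mult.commute)
      moreover have "ord (?a \<otimes> ?b) \<le> ord g" using g x by (intro max) auto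
      ultimately show False by simp
    qed
  qed
  have "group_exp G = ord g"
    unfolding group_exp_def using dvd g by (intro dvd_antisym Lcm_least dvd_Lcm) auto
  then show ?thesis using g by auto
qed

definition translation_eigen ::
    "('a, 'b) monoid_scheme \<Rightarrow> ('a \<Rightarrow> complex) \<Rightarrow> 'a \<Rightarrow> complex \<Rightarrow> bool" where
  "translation_eigen G f a w \<longleftrightarrow> (\<forall>x\<in>carrier G. f (x \<otimes>\<^bsub>G\<^esub> a) = w * f x)"

text \<open>
  A character is a simultaneous eigenfunction of all translations. The projection
  \<open>\<lambda>x. \<Sum>i. \<eta> ^ i * f (x * a ^ i)\<close> to an eigenspace of one translation preserves
  the other eigenvalues, and \<open>f\<close> is a combination of these projections.
\<close>

lemma (in comm_group) translation_eigen_refine: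
  assumes fin: "finite (carrier G)" and a: "a \<in> carrier G"
    and f: "y \<in> carrier G" "f y \<noteq> 0"
  shows "\<exists>h. (\<exists>y\<in>carrier G. h y \<noteq> 0) \<and> (\<exists>w. translation_eigen G h a w) \<and>
    (\<forall>b\<in>carrier G. \<forall>w. translation_eigen G f b w \<longrightarrow> translation_eigen G h b w)"
proof -
  define r where "r = ord a"
  have "r > 0" using ord_ge_1[OF fin a] by (simp add: r_def)
  define \<eta> where "\<eta> = cis (2 * pi / of_nat r)"
  have \<eta>: "primitive_root_unity r \<eta>" unfolding \<eta>_def using \<open>r > 0\<close> by (rule primitive_root_unity_cis)
  note \<eta>' = primitive_root_unityD[OF \<eta>]
  define h where "h l x = (\<Sum>i<r. (\<eta> ^ l) ^ i * f (x \<otimes> a [^] i))" for l x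
  \<comment> \<open>The projections add up to \<open>r * f y\<close> at \<open>y\<close>, so at
    least one of them is not the zero function.\<close>
  have "(\<Sum>l<r. h l y) = (\<Sum>i<r. f (y \<otimes> a [^] i) * (\<Sum>l<r. (\<eta> ^ i) ^ l))"
    unfolding h_def by (subst sum.swap)
      (simp add: sum_distrib_left mult.commute flip: power_mult)
  also have "\<dots> = (\<Sum>i<r. if i = 0 then of_nat r * f y else 0)"
  proof (intro sum.cong refl)
    fix i assume "i \<in> {..<r}"
    then have "\<eta> ^ i = 1 \<longleftrightarrow> i = 0" using \<eta>'(3) by (auto dest: dvd_imp_le)
    then show "f (y \<otimes> a [^] i) * (\<Sum>l<r. (\<eta> ^ i) ^ l) = (if i = 0 then of_nat r * f y else 0)"
      using f(1) sum_powers_root_unity[OF root_unity_power[OF \<eta>'(2)]] by simp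
  qed
  also have "\<dots> \<noteq> 0" using f(2) \<open>r > 0\<close> by simp
  finally obtain l where l: "h l y \<noteq> 0" by (metis (no_types, lifting) sum.neutral)
  have "translation_eigen G (h l) a (inverse (\<eta> ^ l))"
    unfolding translation_eigen_def
  proof
    fix x assume x: "x \<in> carrier G"
    define F where "F i = (\<eta> ^ l) ^ i * f (x \<otimes> a [^] i)" for i :: nat
    have "x \<otimes> a \<otimes> a [^] i = x \<otimes> a [^] Suc i" for i
      using x a by (simp only: nat_pow_Suc2 m_assoc nat_pow_closed)
    then have "\<eta> ^ l * h l (x \<otimes> a) = (\<Sum>i<r. F (Suc i))"
      unfolding h_def F_def by (simp add: sum_distrib_left mult.assoc del: nat_pow_Suc)
    also have "\<dots> = (\<Sum>i<r. F i)"
    proof -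
      have "a [^] r = \<one>" using a by (simp add: r_def)
      then have "F r = F 0" using root_unity_power[OF \<eta>'(2), of l] by (simp add: F_def)
      moreover have "F 0 + (\<Sum>i<r. F (Suc i)) = (\<Sum>i<r. F i) + F r"
        by (metis sum.lessThan_Suc sum.lessThan_Suc_shift)
      ultimately show ?thesis by simp
    qed
    also have "\<dots> = h l x" by (simp add: h_def F_def)
    finally show "h l (x \<otimes> a) = inverse (\<eta> ^ l) * h l x" using \<eta>'(4) by (simp add: field_simps)
  qed
  moreover have "translation_eigen G (h l) b w"
    if b: "b \<in> carrier G" and w: "translation_eigen G f b w" for b w
    unfolding translation_eigen_def
  proof
    fix x assume x: "x \<in> carrier G"
    have "f (x \<otimes> b \<otimes> a [^] i) = w * f (x \<otimes> a [^] i)" for i :: nat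
    proof -
      have "x \<otimes> b \<otimes> a [^] i = (x \<otimes> a [^] i) \<otimes> b" using x a b by (simp add: m_ac)
      then show ?thesis using w x a by (simp add: translation_eigen_def)
    qed
    then show "h l (x \<otimes> b) = w * h l x" by (simp add: h_def sum_distrib_left mult_ac)
  qed
  ultimately show ?thesis using f(1) l by blast
qed

text \<open>Start with the function that is z^i at g^i and 0 off the cyclic subgroup of g; it is
  well defined because z has order ord g. Refining it over all elements keeps the eigenvalue z for g
  and yields a simultaneous eigenfunction f, whose eigenvalues f (y a) / f y form the
  character.\<close>

lemma (in comm_group) character_extension:
  assumes fin: "finite (carrier G)" and g: "g \<in> carrier G" and z: "primitive_root_unity (ord g) z"
  shows "\<exists>\<chi>. (\<forall>a\<in>carrier G. \<forall>b\<in>carrier G. \<chi> (a \<otimes> b) = \<chi> a * \<chi> b) \<and> \<chi> \<one> = 1 \<and> \<chi> g = (z :: complex)"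
proof -
  note z' = primitive_root_unityD[OF z]
  have "\<exists>f. (\<exists>y\<in>carrier G. f y \<noteq> 0) \<and> translation_eigen G f g z \<and>
      (\<forall>a\<in>S. \<exists>w. translation_eigen G f a w)" if "finite S" "S \<subseteq> carrier G" for S
    using that
  proof (induction S rule: finite_induct)
    case empty
    define f where "f x = (if \<exists>i::nat. x = g [^] i then z ^ (SOME i. x = g [^] i) else 0)" for x
    have fg: "f (g [^] i) = z ^ i" for i :: nat
    proof -
      define j where "j = (SOME j. g [^] i = g [^] (j::nat))"
      have "g [^] i = g [^] j" unfolding j_def by (rule someI[of _ i]) simp
      then have "[i = j] (mod ord g)" by (rule pow_eq_imp_cong_ord[OF g])
      then have "z ^ i = z ^ j" by (rule cong_power_root_unity[OF z'(2)])
      then show ?thesis unfolding f_def j_def by auto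
    qed
    have "translation_eigen G f g z"
      unfolding translation_eigen_def
    proof
      fix x assume x: "x \<in> carrier G"
      show "f (x \<otimes> g) = z * f x"
      proof (cases "\<exists>i::nat. x = g [^] i")
        case True
        then obtain i :: nat where i: "x = g [^] i" by blast
        then have "x \<otimes> g = g [^] Suc i" by simp
        then show ?thesis using fg[of i] fg[of "Suc i"] by (simp add: i)
      next
        case False
        have "\<nexists>i::nat. x \<otimes> g = g [^] i"
        proof
          assume "\<exists>i::nat. x \<otimes> g = g [^] i"
          then obtain i :: nat where i: "x \<otimes> g = g [^] i" by blast
          have "x = x \<otimes> g \<otimes> g [^] (ord g - 1)"
          proof -
            have "g \<otimes> g [^] (ord g - 1) = g [^] (Suc (ord g - 1))" using g by (rule nat_pow_Suc2[symmetric])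
            also have "\<dots> = \<one>" using g z'(1) by (simp del: nat_pow_Suc)
            finally show ?thesis using x g by (simp add: m_assoc)
          qed
          also have "\<dots> = g [^] (i + (ord g - 1))" using g by (simp add: i nat_pow_mult)
          finally show False using False by blast
        qed
        then show ?thesis using False by (simp add: f_def)
      qed
    qed
    moreover have "f \<one> \<noteq> 0" using fg[of 0] by simp
    ultimately show ?case by auto
  next
    case (insert a S)
    then obtain f y where f: "y \<in> carrier G" "f y \<noteq> 0" "translation_eigen G f g z"
      "\<forall>a\<in>S. \<exists>w. translation_eigen G f a w" by auto
    obtain h where "\<exists>y\<in>carrier G. h y \<noteq> 0" "\<exists>w. translation_eigen G h a w"
      "\<forall>b\<in>carrier G. \<forall>w. translation_eigen G f b w \<longrightarrow> translation_eigen G h b w"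
      using translation_eigen_refine[where a = a and f = f and y = y, OF fin _ f(1,2)] insert.prems by auto
    then show ?case using f g insert.prems by (intro exI[of _ h]) blast
  qed
  from this[OF fin subset_refl] obtain f y where f: "y \<in> carrier G" "f y \<noteq> 0"
    "translation_eigen G f g z" "\<forall>a\<in>carrier G. \<exists>w. translation_eigen G f a w" by auto
  define \<chi> where "\<chi> a = f (y \<otimes> a) / f y" for a
  have \<chi>: "f (x \<otimes> a) = \<chi> a * f x" if a: "a \<in> carrier G" and x: "x \<in> carrier G" for a x
  proof -
    obtain w where w: "translation_eigen G f a w" using f(4) a by blast
    then have "\<chi> a = w" using f(1,2) by (simp add: translation_eigen_def \<chi>_def)
    then show ?thesis using w x by (simp add: translation_eigen_def)
  qed
  have "\<chi> (a \<otimes> b) = \<chi> a * \<chi> b" if "a \<in> carrier G" "b \<in> carrier G" for a b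
  proof -
    have "\<chi> (a \<otimes> b) * f y = f (y \<otimes> (a \<otimes> b))" using that f(1) by (simp only: \<chi> m_closed)
    also have "\<dots> = f ((y \<otimes> a) \<otimes> b)" using that f(1) by (simp only: m_assoc)
    also have "\<dots> = \<chi> a * \<chi> b * f y" using that f(1) by (simp add: \<chi>)
    finally show ?thesis using f(2) by simp
  qed
  moreover have "\<chi> \<one> = 1" using f(1,2) by (simp add: \<chi>_def)
  moreover have "\<chi> g = z" using f(1-3) by (simp add: \<chi>_def translation_eigen_def)
  ultimately show ?thesis by blast
qed

lemma (in comm_group) character_nat_pow:
  fixes \<chi> :: "'a \<Rightarrow> complex"
  assumes "\<And>a b. a \<in> carrier G \<Longrightarrow> b \<in> carrier G \<Longrightarrow> \<chi> (a \<otimes> b) = \<chi> a * \<chi> b" "\<chi> \<one> = 1"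
    and "a \<in> carrier G"
  shows "\<chi> (a [^] (n::nat)) = \<chi> a ^ n"
  using assms by (induction n) auto

text \<open>An element whose order is the exponent e of the group has a character sending it to a
  primitive e-th root of unity; its (e / d)-th power is the required one.\<close>

lemma (in comm_group) character_of_order_exists:
  assumes fin: "finite (carrier G)" and d: "d dvd group_exp G" "d > 0"
  shows "\<exists>\<chi> z g. primitive_root_unity d z \<and> g \<in> carrier G \<and> \<chi> g = z \<and> \<chi> \<one> = 1 \<and>
    (\<forall>a\<in>carrier G. \<forall>b\<in>carrier G. \<chi> (a \<otimes> b) = \<chi> a * \<chi> b) \<and>
    (\<forall>a\<in>carrier G. \<chi> a ^ d = (1 :: complex))"
proof -
  obtain g where g: "g \<in> carrier G" "ord g = group_exp G"
    using ord_eq_group_exp_exists[OF fin] by blast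
  define e where "e = group_exp G"
  have "e > 0" using ord_ge_1[OF fin g(1)] g(2) by (simp add: e_def)
  define \<zeta> where "\<zeta> = cis (2 * pi / of_nat e)"
  have \<zeta>: "primitive_root_unity e \<zeta>" unfolding \<zeta>_def using \<open>e > 0\<close> by (rule primitive_root_unity_cis)
  obtain \<chi> where \<chi>: "\<And>a b. a \<in> carrier G \<Longrightarrow> b \<in> carrier G \<Longrightarrow> \<chi> (a \<otimes> b) = \<chi> a * \<chi> b"
    "\<chi> \<one> = 1" "\<chi> g = \<zeta>"
    using character_extension[OF fin g(1), of \<zeta>] \<zeta> g(2) by (auto simp: e_def)
  obtain k where k: "e = k * d" using d(1) unfolding e_def by (metis dvdE mult.commute)
  define \<psi> where "\<psi> a = \<chi> a ^ k" for a
  have "\<psi> a ^ d = 1" if a: "a \<in> carrier G" for a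
  proof -
    have "ord a dvd e" using a by (simp add: e_def group_exp_def)
    then have "a [^] e = \<one>" using a by (simp add: pow_eq_id)
    then have "\<chi> a ^ e = 1" using character_nat_pow[OF \<chi>(1,2) a, of e] \<chi>(2) by simp
    then show ?thesis by (simp add: \<psi>_def k power_mult)
  qed
  moreover have "primitive_root_unity d (\<zeta> ^ k)"
    using \<zeta> unfolding k by (rule primitive_root_unity_power)
  moreover have "\<psi> (a \<otimes> b) = \<psi> a * \<psi> b" if "a \<in> carrier G" "b \<in> carrier G" for a b
    using that by (simp add: \<psi>_def \<chi>(1) power_mult_distrib)
  ultimately show ?thesis
    using g(1) \<chi>(2,3) by (intro exI[of _ \<psi>] exI[of _ "\<zeta> ^ k"] exI[of _ g]) (auto simp: \<psi>_def)
qed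

text \<open>The fibres over the d powers of z are translates of the kernel by powers of g, hence of
  equal size.\<close>

lemma (in comm_group) card_character_fibre:
  fixes \<chi> :: "'a \<Rightarrow> complex"
  assumes fin: "finite (carrier G)" and z: "primitive_root_unity d z" and g: "g \<in> carrier G" "\<chi> g = z"
    and \<chi>: "\<And>a b. a \<in> carrier G \<Longrightarrow> b \<in> carrier G \<Longrightarrow> \<chi> (a \<otimes> b) = \<chi> a * \<chi> b" "\<chi> \<one> = 1"
    and d: "\<And>a. a \<in> carrier G \<Longrightarrow> \<chi> a ^ d = 1"
  shows "d * card {a \<in> carrier G. \<chi> a = z ^ i} = Coset.order G"
proof -
  note z' = primitive_root_unityD[OF z]
  let ?K = "\<lambda>i. {a \<in> carrier G. \<chi> a = z ^ i}"
  have eq: "card (?K i) = card (?K 0)" for i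
  proof -
    have \<chi>g: "\<chi> (g [^] i) = z ^ i" using character_nat_pow[OF \<chi> g(1)] g(2) by simp
    have "bij_betw (\<lambda>a. a \<otimes> g [^] i) (?K 0) (?K i)"
    proof (rule bij_betwI[where g = "\<lambda>a. a \<otimes> inv (g [^] i)"])
      have inv: "\<chi> (inv (g [^] i)) * z ^ i = 1"
      proof -
        have "\<chi> (inv (g [^] i) \<otimes> g [^] i) = 1" using g \<chi>(2) by (simp only: l_inv nat_pow_closed)
        then show ?thesis using g \<chi>(1)[of "inv (g [^] i)" "g [^] i"] \<chi>g by simp
      qed
      show "(\<lambda>a. a \<otimes> g [^] i) \<in> ?K 0 \<rightarrow> ?K i" using g \<chi>g by (auto simp: \<chi>(1))
      show "(\<lambda>a. a \<otimes> inv (g [^] i)) \<in> ?K i \<rightarrow> ?K 0"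
        using g inv by (auto simp: \<chi>(1) mult.commute)
    qed (use g in \<open>auto simp: m_assoc\<close>)
    then show ?thesis by (simp add: bij_betw_same_card)
  qed
  have un: "carrier G = (\<Union>j\<in>{..<d}. ?K j)"
  proof (intro equalityI subsetI)
    fix a assume a: "a \<in> carrier G"
    obtain j where "\<chi> a = z ^ j" using root_unity_eq_power[OF z d[OF a]] by blast
    then have "\<chi> a = z ^ (j mod d)" by (simp add: power_mod_root_unity[OF z'(2)])
    then show "a \<in> (\<Union>j\<in>{..<d}. ?K j)" using a z'(1) by auto
  qed auto
  have "Coset.order G = (\<Sum>j<d. card (?K j))"
    unfolding Coset.order_def
  proof (subst un, rule card_UN_disjoint)
    show "\<forall>i\<in>{..<d}. \<forall>j\<in>{..<d}. i \<noteq> j \<longrightarrow> ?K i \<inter> ?K j = {}"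
      using inj_on_primitive_root_unity[OF z] by (auto simp: inj_on_def)
  qed (use fin in auto)
  also have "\<dots> = d * card (?K i)" by (simp add: eq[of i] eq)
  finally show ?thesis by simp
qed

section \<open>Character sums of strong external difference families\<close>

lemma SEDF_external_differences:
  fixes G (structure)
  assumes "comm_group G" and D: "SEDF G v m k lam D" and j: "j \<in> {1..m}"
  defines "A \<equiv> SIGMA l:{1..m} - {j}. D l \<times> D j"
  defines "f \<equiv> \<lambda>(l, x, y). x \<otimes> inv y"
  shows "finite A" "f ` A \<subseteq> carrier G - {\<one>}"
    "\<And>g. g \<in> carrier G - {\<one>} \<Longrightarrow> card {a \<in> A. f a = g} = lam"
proof -
  interpret comm_group G by fact
  have Dl: "D l \<subseteq> carrier G" "finite (D l)" if "l \<in> {1..m}" for l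
    using D that by (auto simp: SEDF_def)
  show fin: "finite A"
    unfolding A_def using Dl j by (intro finite_SigmaI finite_cartesian_product) auto
  have cnt: "count (external_differences G m D j) g = card {a \<in> A. f a = g}" for g
    using count_image_mset_eq_card_vimage[OF fin, of f g]
    unfolding external_differences_def A_def f_def .
  show "f ` A \<subseteq> carrier G - {\<one>}"
  proof
    fix g assume "g \<in> f ` A"
    then obtain a where a: "a \<in> A" "g = f a" by blast
    obtain l x y where "a = (l, x, y)" by (cases a)
    then have *: "l \<in> {1..m}" "l \<noteq> j" "x \<in> D l" "y \<in> D j" "g = x \<otimes> inv y"
      using a by (auto simp: A_def f_def)
    have "x \<in> carrier G" "y \<in> carrier G" using * Dl[of l] Dl[OF j] by auto
    then have "g \<in> carrier G" using * by simp
    have "\<one> \<notin># external_differences G m D j" using D j by (simp add: SEDF_def)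
    then have "{a \<in> A. f a = \<one>} = {}" using cnt[of \<one>] fin by (simp add: not_in_iff)
    then have "a \<notin> {a \<in> A. f a = \<one>}" by (simp only: empty_iff not_False_eq_True)
    then have "g \<noteq> \<one>" using a by simp
    then show "g \<in> carrier G - {\<one>}" using \<open>g \<in> carrier G\<close> by simp
  qed
  show "card {a \<in> A. f a = g} = lam" if "g \<in> carrier G - {\<one>}" for g
    using D j that cnt[of g] by (simp add: SEDF_def)
qed

lemma sum_external_differences:
  fixes G (structure) and h :: "'a \<Rightarrow> complex"
  assumes G: "comm_group G" "finite (carrier G)" and D: "SEDF G v m k lam D" and j: "j \<in> {1..m}"
  shows "(\<Sum>(l, x, y)\<in>(SIGMA l:{1..m} - {j}. D l \<times> D j). h (x \<otimes> inv y))
    = of_nat lam * (\<Sum>g\<in>carrier G - {\<one>}. h g)"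
proof -
  define A where "A = (SIGMA l:{1..m} - {j}. D l \<times> D j)"
  define f where "f = (\<lambda>(l :: nat, x, y). x \<otimes> inv y)"
  note A = SEDF_external_differences[OF G(1) D j, folded A_def f_def]
  have "(\<Sum>a\<in>A. h (f a)) = (\<Sum>g\<in>carrier G - {\<one>}. \<Sum>a\<in>{a \<in> A. f a = g}. h (f a))"
    using A(1,2) G(2) by (intro sum.group[symmetric]) auto
  also have "\<dots> = (\<Sum>g\<in>carrier G - {\<one>}. of_nat lam * h g)"
    using A(3) by (intro sum.cong refl) simp
  finally show ?thesis by (simp add: sum_distrib_left case_prod_unfold A_def f_def)
qed

lemma (in comm_group) character_inv:
  fixes \<chi> :: "'a \<Rightarrow> complex"
  assumes \<chi>: "\<And>a b. a \<in> carrier G \<Longrightarrow> b \<in> carrier G \<Longrightarrow> \<chi> (a \<otimes> b) = \<chi> a * \<chi> b" "\<chi> \<one> = 1"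
    and d: "\<And>a. a \<in> carrier G \<Longrightarrow> \<chi> a ^ d = 1" "d > 0" and a: "a \<in> carrier G"
  shows "\<chi> (inv a) = cnj (\<chi> a)"
proof -
  have n: "\<chi> a * cnj (\<chi> a) = 1"
    using norm_root_unity[OF d(1)[OF a] d(2)] by (simp only: complex_norm_square[symmetric]) simp
  have "\<chi> (inv a) * \<chi> a = 1" using a \<chi>(1)[of "inv a" a] \<chi>(2) by simp
  then have "\<chi> (inv a) * \<chi> a * cnj (\<chi> a) = cnj (\<chi> a)" by simp
  then show ?thesis by (simp only: mult.assoc n mult_1_right)
qed

lemma (in comm_group) sum_character_nontrivial:
  fixes \<chi> :: "'a \<Rightarrow> complex"
  assumes \<chi>: "\<And>a b. a \<in> carrier G \<Longrightarrow> b \<in> carrier G \<Longrightarrow> \<chi> (a \<otimes> b) = \<chi> a * \<chi> b"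
    and g: "g \<in> carrier G" "\<chi> g \<noteq> 1"
  shows "(\<Sum>a\<in>carrier G. \<chi> a) = 0"
proof -
  have "bij_betw (\<lambda>a. a \<otimes> g) (carrier G) (carrier G)"
    by (rule bij_betwI[where g = "\<lambda>a. a \<otimes> inv g"]) (use g in \<open>auto simp: m_assoc\<close>)
  then have "(\<Sum>a\<in>carrier G. \<chi> (a \<otimes> g)) = (\<Sum>a\<in>carrier G. \<chi> a)"
    by (rule sum.reindex_bij_betw)
  then have "(\<Sum>a\<in>carrier G. \<chi> a) * \<chi> g = (\<Sum>a\<in>carrier G. \<chi> a)"
    using g by (simp add: \<chi> sum_distrib_right)
  then show ?thesis using g(2) by simp
qed

text \<open>The character is summed over the external differences. Over the non-identity elements it
  sums to -1, because its sum over the whole group is 0, and the double sum factors since inverses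
  become complex conjugates.\<close>

lemma SEDF_character_equation:
  fixes G (structure) and \<chi> :: "'a \<Rightarrow> complex"
  assumes G: "comm_group G" "finite (carrier G)" and D: "SEDF G v m k lam D" and j: "j \<in> {1..m}"
    and \<chi>: "\<And>a b. a \<in> carrier G \<Longrightarrow> b \<in> carrier G \<Longrightarrow> \<chi> (a \<otimes> b) = \<chi> a * \<chi> b" "\<chi> \<one> = 1"
    and d: "\<And>a. a \<in> carrier G \<Longrightarrow> \<chi> a ^ d = 1" "d > 0"
    and g: "g \<in> carrier G" "\<chi> g \<noteq> 1"
  shows "((\<Sum>l=1..m. \<Sum>x\<in>D l. \<chi> x) - (\<Sum>x\<in>D j. \<chi> x)) * cnj (\<Sum>x\<in>D j. \<chi> x) = - of_nat lam"
proof -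
  interpret comm_group G by fact
  have Dl: "D l \<subseteq> carrier G" "finite (D l)" if "l \<in> {1..m}" for l
    using D that by (auto simp: SEDF_def)
  have "of_nat lam * (\<Sum>g\<in>carrier G - {\<one>}. \<chi> g) = - of_nat lam"
    using sum_character_nontrivial[of \<chi>, OF \<chi>(1) g] G(2) by (simp add: sum_diff1 \<chi>(2))
  moreover have "(\<Sum>(l, x, y)\<in>(SIGMA l:{1..m} - {j}. D l \<times> D j). \<chi> (x \<otimes> inv y))
      = (\<Sum>l\<in>{1..m} - {j}. \<Sum>(x, y)\<in>D l \<times> D j. \<chi> (x \<otimes> inv y))"
    using Dl j by (subst sum.Sigma) (auto simp: case_prod_unfold)
  moreover have "(\<Sum>(x, y)\<in>D l \<times> D j. \<chi> (x \<otimes> inv y)) = (\<Sum>x\<in>D l. \<chi> x) * cnj (\<Sum>x\<in>D j. \<chi> x)"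
    if l: "l \<in> {1..m} - {j}" for l
  proof -
    have "(\<Sum>(x, y)\<in>D l \<times> D j. \<chi> (x \<otimes> inv y)) = (\<Sum>x\<in>D l. \<Sum>y\<in>D j. \<chi> x * cnj (\<chi> y))"
      unfolding sum.cartesian_product
    proof (intro sum.cong refl, clarify)
      fix x y assume "x \<in> D l" "y \<in> D j"
      then have xy: "x \<in> carrier G" "y \<in> carrier G" using Dl[of l] Dl[OF j] l by auto
      have "\<chi> (inv y) = cnj (\<chi> y)" by (rule character_inv[OF \<chi> d xy(2)])
      then show "\<chi> (x \<otimes> inv y) = \<chi> x * cnj (\<chi> y)" using xy by (simp add: \<chi>(1))
    qed
    then show ?thesis by (simp add: sum_product)
  qed
  ultimately have "(\<Sum>l\<in>{1..m} - {j}. (\<Sum>x\<in>D l. \<chi> x) * cnj (\<Sum>x\<in>D j. \<chi> x)) = - of_nat lam"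
    using sum_external_differences[OF G D j, of \<chi>] by simp
  then have "(\<Sum>l\<in>{1..m} - {j}. \<Sum>x\<in>D l. \<chi> x) * cnj (\<Sum>x\<in>D j. \<chi> x) = - of_nat lam"
    by (simp only: sum_distrib_right)
  then show ?thesis using j by (simp add: sum_diff1)
qed

text \<open>
  The real numbers \<open>x j = norm (z j) ^ 2 - lam\<close> are roots of one quadratic with roots
  \<open>a > 0 > b\<close> and \<open>a + b = T\<close>; since \<open>T\<close> is also the sum of all the \<open>x j\<close> and \<open>m > 2\<close>,
  the quotient \<open>a / b\<close> is rational.
\<close>

lemma quadratic_values_sum:
  fixes x :: "nat \<Rightarrow> real" and T lam :: real
  assumes "finite J" "card J \<ge> 3" "T > 0" "lam > 0"
    and quad: "\<And>j. j \<in> J \<Longrightarrow> (x j)\<^sup>2 = T * (lam + x j)" and sum: "(\<Sum>j\<in>J. x j) = T"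
  shows "\<exists>i\<in>J. \<exists>j\<in>J. x i > 0 \<and> (lam + x i) * (lam + x j) = lam\<^sup>2 \<and>
    lam + x i \<in> (\<lambda>r. lam * r) ` \<rat> \<and> lam + x j \<in> (\<lambda>r. lam * r) ` \<rat>"
proof -
  \<comment> \<open>From x^2 = T lam + T x > T x. A positive root above T cannot be the sum's only
    kind of term, which produces a negative one.\<close>
  have pos: "x j > T" if "j \<in> J" "x j > 0" for j
  proof (rule ccontr)
    assume "\<not> x j > T"
    then have "x j * x j \<le> T * x j" using that by (intro mult_right_mono) auto
    moreover have "T * lam > 0" using assms by simp
    ultimately show False using quad[OF that(1)] by (simp add: power2_eq_square algebra_simps)
  qed
  have nz: "x j \<noteq> 0" if "j \<in> J" for j using quad[OF that] assms by auto
  have diff: "(x i - x j) * (x i + x j - T) = 0" if "i \<in> J" "j \<in> J" for i j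
  proof -
    have "(x i)\<^sup>2 - (x j)\<^sup>2 = T * (x i - x j)" using quad that by (simp add: algebra_simps)
    then show ?thesis by (simp add: power2_eq_square algebra_simps)
  qed
  obtain i where i: "i \<in> J" "x i > 0"
    using sum_nonpos[of J x] sum assms by (metis not_less)
  have "\<exists>j\<in>J. x j < 0"
  proof (rule ccontr)
    assume no: "\<not> (\<exists>j\<in>J. x j < 0)"
    then have "x l \<ge> 0" if "l \<in> J" for l using that by (auto simp: not_less)
    then have "x i \<le> (\<Sum>j\<in>J. x j)" using i assms by (intro member_le_sum) auto
    then show False using pos[OF i] sum by simp
  qed
  then obtain j where j: "j \<in> J" "x j < 0" by blast
  have ij: "x i + x j = T" using diff[OF i(1) j(1)] i j by auto
  have prod: "x i * x j = - (T * lam)"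
    using quad[OF i(1)] unfolding ij[symmetric] by (simp add: power2_eq_square algebra_simps)
  define P where "P = {l \<in> J. x l > 0}"
  have P: "x l = x i" if "l \<in> P" for l
    using diff[of l i] pos[of l] pos[of i] that i assms by (auto simp: P_def)
  have N: "x l = x j" if "l \<in> J - P" for l
    using diff[of l j] nz[of l] that j assms by (auto simp: P_def)
  define p q where "p = card P" and "q = card (J - P)"
  have fin: "finite P" using assms by (simp add: P_def)
  have pq: "p + q = card J"
    using assms(1) fin by (simp add: p_def q_def P_def card_Diff_subset card_mono)
  have "(\<Sum>l\<in>J. x l) = (\<Sum>l\<in>P. x l) + (\<Sum>l\<in>J - P. x l)"
    using assms(1) by (simp add: P_def sum.subset_diff[of "{l \<in> J. x l > 0}" J] add.commute)
  also have "(\<Sum>l\<in>P. x l) = real p * x i" using P by (simp add: p_def)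
  also have "(\<Sum>l\<in>J - P. x l) = real q * x j" using N by (simp add: q_def)
  \<comment> \<open>With p values equal to a and q equal to b, p a + q b = a + b. Since a > 0 > b, p
    = 1 exactly when q = 1, and p + q >= 3 excludes that case, so both p - 1 and q - 1 are
    nonzero.\<close>
  finally have key: "(real p - 1) * x i = (real q - 1) * (- x j)"
    using sum ij by (simp add: algebra_simps)
  have "i \<in> P" "j \<in> J - P" using i j by (auto simp: P_def)
  then have "p \<ge> 1" "q \<ge> 1" using fin assms(1) unfolding p_def q_def
    by (auto simp: Suc_le_eq card_gt_0_iff)
  have "p \<noteq> 1"
  proof
    assume "p = 1"
    then have "q = 1" using key j by simp
    then show False using pq \<open>p = 1\<close> assms(2) by simp
  qed
  then have p2: "real p - 1 > 0" using \<open>p \<ge> 1\<close> by simp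
  have "q \<noteq> 1"
  proof
    assume "q = 1"
    then have "p = 1" using key i by simp
    then show False using \<open>p \<noteq> 1\<close> by simp
  qed
  then have q2: "real q - 1 > 0" using \<open>q \<ge> 1\<close> by simp
  have "(lam + x i) * (- x j) = lam * x i"
  proof -
    have "(lam + x i) * (- x j) = lam * T - lam * x j" using prod by (simp add: algebra_simps)
    then show ?thesis by (simp add: ij[symmetric] algebra_simps)
  qed
  moreover define r where "r = (real q - 1) / (real p - 1)"
  moreover have "x i = r * (- x j)" using key p2 by (simp add: r_def field_simps)
  ultimately have "(lam + x i) * (- x j) = (lam * r) * (- x j)" by (simp only: mult.assoc)
  moreover have "- x j \<noteq> 0" using j by simp
  ultimately have "lam + x i = lam * r" using mult_right_cancel by blast
  then have 1: "lam + x i = lam * ((real q - 1) / (real p - 1))" by (simp only: r_def)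
  have "T\<^sup>2 * ((lam + x i) * (lam + x j)) = (x i * x j)\<^sup>2"
    using quad[OF i(1)] quad[OF j(1)] by (simp add: power2_eq_square mult_ac)
  also have "\<dots> = T\<^sup>2 * lam\<^sup>2" by (simp add: prod power_mult_distrib)
  finally have 2: "(lam + x i) * (lam + x j) = lam\<^sup>2" using assms by simp
  have 3: "lam + x j = lam * ((real p - 1) / (real q - 1))"
  proof -
    have "lam * (r * (lam + x j)) = lam * lam"
      using 2 \<open>lam + x i = lam * r\<close> by (simp only: power2_eq_square mult.assoc)
    then have "r * (lam + x j) = lam" using assms(4) by simp
    then show ?thesis using p2 q2 by (simp add: r_def field_simps)
  qed
  have "(real q - 1) / (real p - 1) \<in> \<rat>" "(real p - 1) / (real q - 1) \<in> \<rat>" by simp_all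
  then show ?thesis using i j 1 2 3 by blast
qed

text \<open>With T the sum of the y l, the equation reads T cnj (y j) = x j, where x j = norm (y
  j)^2 - lam is real. If T = 0, every norm squared is lam. Otherwise taking absolute values gives
  the quadratic for the x j, and summing gives T cnj T as their total. The norms belonging to the
  two roots are integers with product lam^2, and the one with positive x j is at least lam.\<close>

lemma large_integral_norm:
  fixes y :: "nat \<Rightarrow> complex"
  assumes "m \<ge> 3" "lam > 0"
    and eq: "\<And>j. j \<in> {1..m} \<Longrightarrow> ((\<Sum>l=1..m. y l) - y j) * cnj (y j) = - of_nat lam"
    and int: "\<And>j. j \<in> {1..m} \<Longrightarrow> (norm (y j))\<^sup>2 \<in> \<rat> \<Longrightarrow> (norm (y j))\<^sup>2 \<in> \<int>"
  shows "\<exists>j\<in>{1..m}. \<exists>n. (norm (y j))\<^sup>2 = real n \<and> n \<ge> lam \<and> n dvd lam\<^sup>2"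
proof -
  define T where "T = (\<Sum>l=1..m. y l)"
  define x where "x j = (norm (y j))\<^sup>2 - real lam" for j
  have Tx: "T * cnj (y j) = of_real (x j)" if "j \<in> {1..m}" for j
    using eq[OF that] by (simp add: T_def x_def left_diff_distrib complex_norm_square[symmetric] algebra_simps
        del: of_real_power)
  show ?thesis
  proof (cases "T = 0")
    case True
    have "1 \<in> {1..m}" using assms(1) by simp
    moreover have "complex_of_real (x 1) = 0" using Tx[OF \<open>1 \<in> {1..m}\<close>] True by simp
    then have "x 1 = 0" by (simp only: of_real_eq_0_iff)
    then have "(norm (y 1))\<^sup>2 = real lam" by (simp add: x_def)
    ultimately show ?thesis by (intro bexI[of _ 1] exI[of _ lam]) auto
  next
    case False
    define t where "t = (norm T)\<^sup>2"
    have "t > 0" using False by (simp add: t_def)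
    have quad: "(x j)\<^sup>2 = t * (real lam + x j)" if "j \<in> {1..m}" for j
    proof -
      have "\<bar>x j\<bar> = norm T * norm (y j)"
        using arg_cong[OF Tx[OF that], of norm] by (simp add: norm_mult)
      then have "(x j)\<^sup>2 = t * (norm (y j))\<^sup>2" by (metis power2_abs power_mult_distrib t_def)
      then show ?thesis by (simp add: x_def)
    qed
    have "T * cnj T = T * (\<Sum>j=1..m. cnj (y j))" by (simp add: T_def)
    also have "\<dots> = (\<Sum>j=1..m. T * cnj (y j))" by (rule sum_distrib_left)
    also have "\<dots> = (\<Sum>j=1..m. of_real (x j))" by (intro sum.cong refl Tx)
    finally have "complex_of_real (\<Sum>j=1..m. x j) = T * cnj T" by (simp only: of_real_sum)
    then have "complex_of_real (\<Sum>j=1..m. x j) = of_real t"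
      by (simp only: t_def complex_norm_square)
    then have sum: "(\<Sum>j=1..m. x j) = t" by (simp only: of_real_eq_iff)
    obtain i j where ij: "i \<in> {1..m}" "j \<in> {1..m}" "x i > 0"
      "(real lam + x i) * (real lam + x j) = (real lam)\<^sup>2"
      "real lam + x i \<in> (\<lambda>r. real lam * r) ` \<rat>" "real lam + x j \<in> (\<lambda>r. real lam * r) ` \<rat>"
      using quadratic_values_sum[of "{1..m}" t "real lam" x] quad sum \<open>t > 0\<close> assms(1,2) by auto
    have nat: "\<exists>n. (norm (y l))\<^sup>2 = real n" if l: "l \<in> {1..m}" "real lam + x l \<in> (\<lambda>r. real lam * r) ` \<rat>" for l
    proof -
      have "(norm (y l))\<^sup>2 \<in> \<rat>" using l(2) by (auto simp: x_def)
      then have "(norm (y l))\<^sup>2 \<in> \<int>" using int l(1) by blast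
      then obtain c where c: "(norm (y l))\<^sup>2 = of_int c" by (auto elim: Ints_cases)
      then have "c \<ge> 0" by (metis of_int_0_le_iff zero_le_power2)
      then show ?thesis using c by (metis of_nat_nat zero_le_imp_eq_int of_int_of_nat_eq)
    qed
    obtain n n' where n: "(norm (y i))\<^sup>2 = real n" "(norm (y j))\<^sup>2 = real n'"
      using nat ij by blast
    have "real (n * n') = real (lam\<^sup>2)" using ij(4) n by (simp add: x_def)
    then have "n * n' = lam\<^sup>2" by (simp only: of_nat_eq_iff)
    then have "n dvd lam\<^sup>2" by (metis dvd_triv_left)
    moreover have "n \<ge> lam" using ij(3) n(1) by (simp add: x_def)
    ultimately show ?thesis using ij(1) n(1) by blast
  qed
qed

text \<open>
  For \<open>x \<noteq> x'\<close> in \<open>D 1\<close>, the quotient \<open>x / x'\<close> would be a difference \<open>a / b\<close> with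
  \<open>b\<close> in \<open>D 2\<close> and a difference \<open>a' / c\<close> with \<open>c\<close> in \<open>D 3\<close>; uniqueness of differences
  forces \<open>a\<close> and \<open>a'\<close> into \<open>D 1\<close>, and then \<open>b / a = c / a'\<close> contradicts it.
\<close>

lemma SEDF_lambda_one:
  fixes G (structure)
  assumes G: "comm_group G" and D: "SEDF G v m k 1 D" and "m \<ge> 3"
  shows "k \<le> 1"
proof (rule ccontr)
  assume "\<not> k \<le> 1"
  interpret comm_group G by fact
  have J: "1 \<in> {1..m}" "2 \<in> {1..m}" "3 \<in> {1..m}" using \<open>m \<ge> 3\<close> by auto
  have Dl: "D l \<subseteq> carrier G" "finite (D l)" "card (D l) = k" if "l \<in> {1..m}" for l
    using D that by (auto simp: SEDF_def)
  have disj: "D i \<inter> D j = {}" if "i \<in> {1..m}" "j \<in> {1..m}" "i \<noteq> j" for i j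
    using D that unfolding SEDF_def by blast
  have ex: "\<exists>l a b. l \<in> {1..m} \<and> l \<noteq> j \<and> a \<in> D l \<and> b \<in> D j \<and> a \<otimes> inv b = g"
    if j: "j \<in> {1..m}" and g: "g \<in> carrier G" "g \<noteq> \<one>" for j g
  proof -
    have "card {a \<in> (SIGMA l:{1..m} - {j}. D l \<times> D j). (\<lambda>(l, x, y). x \<otimes> inv y) a = g} = 1"
      using SEDF_external_differences(3)[OF G D j] g by simp
    then obtain a where "{a \<in> (SIGMA l:{1..m} - {j}. D l \<times> D j). (\<lambda>(l, x, y). x \<otimes> inv y) a = g} = {a}"
      by (auto simp: card_1_singleton_iff)
    then have "a \<in> (SIGMA l:{1..m} - {j}. D l \<times> D j)" "(\<lambda>(l, x, y). x \<otimes> inv y) a = g" by blast+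
    then show ?thesis by (cases a) auto
  qed
  have uniq: "l = l'"
    if j: "j \<in> {1..m}" and l: "l \<in> {1..m}" "l \<noteq> j" "a \<in> D l" "b \<in> D j"
      and l': "l' \<in> {1..m}" "l' \<noteq> j" "a' \<in> D l'" "b' \<in> D j"
      and eq: "a \<otimes> inv b = a' \<otimes> inv b'" for j l l' a a' b b'
  proof -
    let ?A = "SIGMA l:{1..m} - {j}. D l \<times> D j" and ?f = "\<lambda>(l :: nat, x, y). x \<otimes> inv y"
    have mem: "(l, a, b) \<in> ?A" "(l', a', b') \<in> ?A" using l l' by auto
    have "?f (l, a, b) \<in> carrier G - {\<one>}"
      using SEDF_external_differences(2)[OF G D j] mem(1) by blast
    then have "card {x \<in> ?A. ?f x = ?f (l, a, b)} = 1"
      by (rule SEDF_external_differences(3)[OF G D j])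
    then obtain c where c: "{x \<in> ?A. ?f x = ?f (l, a, b)} = {c}"
      by (auto simp: card_1_singleton_iff)
    have "(l, a, b) \<in> {c}" unfolding c[symmetric] using mem by simp
    moreover have "(l', a', b') \<in> {c}" unfolding c[symmetric] using mem eq by simp
    ultimately show ?thesis by auto
  qed
  obtain x x' where x: "x \<in> D 1" "x' \<in> D 1" "x \<noteq> x'"
  proof -
    have "\<not> card (D 1) \<le> Suc 0" using Dl(3)[OF J(1)] \<open>\<not> k \<le> 1\<close> by simp
    then show ?thesis using that Dl(2)[OF J(1)] by (auto simp: card_le_Suc0_iff_eq)
  qed
  have xG: "x \<in> carrier G" "x' \<in> carrier G" using x Dl(1)[OF J(1)] by auto
  let ?g = "x \<otimes> inv x'"
  have g: "?g \<in> carrier G" "?g \<noteq> \<one>"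
  proof -
    show "?g \<in> carrier G" using xG by simp
    show "?g \<noteq> \<one>"
    proof
      assume "?g = \<one>"
      then have "x = x'" using xG inv_equality inv_inv by (metis inv_closed)
      then show False using x by simp
    qed
  qed
  have through_1: "\<exists>a\<in>D 1. \<exists>b\<in>D j. a \<otimes> inv b = ?g" if j: "j \<in> {1..m}" "j \<noteq> 1" for j
  proof -
    obtain l a b where l: "l \<in> {1..m}" "l \<noteq> j" "a \<in> D l" "b \<in> D j" "a \<otimes> inv b = ?g"
      using ex[OF j(1) g] by blast
    have ab: "a \<in> carrier G" "b \<in> carrier G" using l Dl(1)[of l] Dl(1)[OF j(1)] by auto
    have "l = 1"
    proof (rule ccontr)
      assume "l \<noteq> 1"
      \<comment> \<open>Rearranging a / b = x / x' to a / x = b / x' gives two differences against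
        \<open>D 1\<close>, one from \<open>D l\<close> and one from \<open>D j\<close>; uniqueness
        would force l = j.\<close>
      have "a \<otimes> inv x = (a \<otimes> inv b) \<otimes> (b \<otimes> inv x)"
        using ab xG by (simp add: m_assoc inv_solve_left)
      also have "\<dots> = (x \<otimes> inv x') \<otimes> (b \<otimes> inv x)" by (simp only: l(5))
      also have "\<dots> = (b \<otimes> inv x') \<otimes> (x \<otimes> inv x)" using ab xG by (simp only: m_ac m_closed inv_closed)
      also have "\<dots> = b \<otimes> inv x'" using ab xG by simp
      finally have "l = j" using uniq[OF J(1) l(1) \<open>l \<noteq> 1\<close> l(3) x(1) j l(4) x(2)] by blast
      then show False using l(2) by simp
    qed
    then show ?thesis using l by blast
  qed
  obtain a b where ab: "a \<in> D 1" "b \<in> D 2" "a \<otimes> inv b = ?g" using through_1[OF J(2)] by auto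
  obtain a' c where ac: "a' \<in> D 1" "c \<in> D 3" "a' \<otimes> inv c = ?g" using through_1[OF J(3)] by auto
  have G: "a \<in> carrier G" "b \<in> carrier G" "a' \<in> carrier G" "c \<in> carrier G"
    using ab ac Dl(1)[OF J(1)] Dl(1)[OF J(2)] Dl(1)[OF J(3)] by auto
  have "b \<otimes> inv a = inv ?g" unfolding ab(3)[symmetric] using G by (simp add: inv_mult m_comm)
  moreover have "c \<otimes> inv a' = inv ?g" unfolding ac(3)[symmetric] using G by (simp add: inv_mult m_comm)
  ultimately have "(2::nat) = 3" using uniq[OF J(1) J(2) _ ab(2,1) J(3) _ ac(2,1)] by simp
  then show False by simp
qed

text \<open>The squared norm is the value of the integer polynomial X(t) X(t^(d - 1)) at d-th roots
  of unity t, so its being the integer n at \<open>z\<close> passes to every conjugate.\<close>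

lemma norm_character_sum_conjugates:
  fixes c :: "nat \<Rightarrow> nat"
  assumes z: "primitive_root_unity d z" and "coprime s d"
    and n: "(norm (\<Sum>i<d. of_nat (c i) * z ^ i))\<^sup>2 = real n"
  shows "(norm (\<Sum>i<d. of_nat (c i) * (z ^ s) ^ i))\<^sup>2 = real n"
proof -
  note z' = primitive_root_unityD[OF z]
  define X where "X = (\<Sum>i<d. monom (int (c i)) i)"
  have evX: "ev X w = (\<Sum>i<d. of_nat (c i) * w ^ i)" for w by (simp add: X_def)
  have norm: "ev (X * X \<circ>\<^sub>p monom 1 (d - 1)) w = of_real ((norm (ev X w))\<^sup>2)" if "w ^ d = 1" for w
    using cnj_root_unity[OF that z'(1)] by (simp add: complex_norm_square ev_cnj del: of_real_power)
  have "ev (X * X \<circ>\<^sub>p monom 1 (d - 1)) z = ev (of_nat n) z"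
    unfolding norm[OF z'(2)] using n by (simp add: evX del: of_real_power)
  then have "ev (X * X \<circ>\<^sub>p monom 1 (d - 1)) (z ^ s) = ev (of_nat n) (z ^ s)"
    by (rule ev_eq_conjugate[OF z \<open>coprime s d\<close>])
  then have "complex_of_real ((norm (ev X (z ^ s)))\<^sup>2) = of_real (real n)"
    unfolding norm[OF root_unity_power[OF z'(2)]] by simp
  then show ?thesis by (simp only: of_real_eq_iff evX)
qed

theorem theorem5p4:
  fixes G :: "('a, 'b) monoid_scheme"
    and D :: "nat \<Rightarrow> 'a set"
    and v m k lam d t :: nat
  assumes "comm_group G" and "finite (carrier G)"
    and "SEDF G v m k lam D"
    and "m \<ge> 3"
    and "k \<noteq> 1"
    and "d > 2" and "d dvd group_exp G"
    and "t = card (prime_factors d)"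
  shows "real lam \<le> (2 ^ (t - 1) * real v)\<^sup>2 * (real (schmidt_F d lam))\<^sup>2
                   / (4 * (real d)\<^sup>2 * real (totient (schmidt_F d lam)))"
proof (cases "lam = 0")
  case False
  interpret comm_group G by fact
  note G = assms(1,2) and D = assms(3)
  have Dl: "D l \<subseteq> carrier G" "finite (D l)" "card (D l) = k" if "l \<in> {1..m}" for l
    using D that by (auto simp: SEDF_def)
  obtain \<chi> z g where z: "primitive_root_unity d z" and g: "g \<in> carrier G" "\<chi> g = z"
    and \<chi>1: "\<chi> \<one>\<^bsub>G\<^esub> = 1"
    and \<chi>: "\<And>a b. a \<in> carrier G \<Longrightarrow> b \<in> carrier G \<Longrightarrow> \<chi> (a \<otimes>\<^bsub>G\<^esub> b) = \<chi> a * \<chi> b"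
    and \<chi>d: "\<And>a. a \<in> carrier G \<Longrightarrow> \<chi> a ^ d = (1 :: complex)"
    using character_of_order_exists[OF G(2) assms(7)] assms(6) by auto
  note z' = primitive_root_unityD[OF z]
  have "z \<noteq> 1" using z'(3)[of 1] assms(6) by auto
  have "g \<noteq> \<one>\<^bsub>G\<^esub>" using g(2) \<chi>1 \<open>z \<noteq> 1\<close> by auto
  \<comment> \<open>For \<open>lam = 1\<close> the family has k <= 1, hence k = 0 by assumption; but
    empty sets have no differences, while \<open>g\<close> is not the identity and would have to
    occur once.\<close>
  have "lam \<noteq> 1"
  proof
    assume "lam = 1"
    then have "k = 0" using SEDF_lambda_one[OF G(1) _ assms(4), of v k D] D assms(5) by simp
    then have "D l = {}" if "l \<in> {1..m}" for l using Dl[OF that] by simp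
    then have "(SIGMA l:{1..m} - {1}. D l \<times> D 1) = {}" using assms(4) by auto
    moreover have "1 \<in> {1..m}" using assms(4) by simp
    ultimately show False
      using SEDF_external_differences(3)[OF G(1) D, of 1 g] g(1) \<open>g \<noteq> \<one>\<^bsub>G\<^esub>\<close> \<open>lam = 1\<close> by simp
  qed
  then have "lam > 1" using False by simp
  define y where "y j = (\<Sum>x\<in>D j. \<chi> x)" for j
  define c where "c j i = card {x \<in> D j. \<chi> x = z ^ i}" for j i
  have y: "y j = (\<Sum>i<d. of_nat (c j i) * z ^ i)" if j: "j \<in> {1..m}" for j
  proof -
    have "\<chi> ` D j \<subseteq> (\<lambda>i. z ^ i) ` {..<d}"
    proof
      fix w assume "w \<in> \<chi> ` D j"
      then have "w ^ d = 1" using \<chi>d Dl(1)[OF j] by auto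
      then obtain i where "w = z ^ i" using root_unity_eq_power[OF z] by blast
      then have "w = z ^ (i mod d)" by (simp add: power_mod_root_unity[OF z'(2)])
      then show "w \<in> (\<lambda>i. z ^ i) ` {..<d}" using z'(1) by auto
    qed
    then have "y j = (\<Sum>w\<in>(\<lambda>i. z ^ i) ` {..<d}. \<Sum>x\<in>{x \<in> D j. \<chi> x = w}. \<chi> x)"
      unfolding y_def using Dl(2)[OF j] by (intro sum.group[symmetric]) auto
    also have "\<dots> = (\<Sum>i<d. \<Sum>x\<in>{x \<in> D j. \<chi> x = z ^ i}. \<chi> x)"
      using inj_on_primitive_root_unity[OF z] by (subst sum.reindex) auto
    also have "\<dots> = (\<Sum>i<d. of_nat (c j i) * z ^ i)" by (simp add: c_def)
    finally show ?thesis .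
  qed
  have eq: "((\<Sum>l=1..m. y l) - y j) * cnj (y j) = - of_nat lam" if j: "j \<in> {1..m}" for j
    unfolding y_def
    by (rule SEDF_character_equation[OF G D j \<chi> \<chi>1 \<chi>d z'(1) g(1)]) (use g(2) \<open>z \<noteq> 1\<close> in auto)
  \<comment> \<open>The squared norm lies in Z[z], hence is an algebraic integer.\<close>
  have int: "(norm (y j))\<^sup>2 \<in> \<int>" if j: "j \<in> {1..m}" and rat: "(norm (y j))\<^sup>2 \<in> \<rat>" for j
  proof -
    define X where "X = (\<Sum>i<d. monom (int (c j i)) i)"
    have X: "ev X z = y j" by (simp add: X_def y[OF j])
    have "ev (X * X \<circ>\<^sub>p monom 1 (d - 1)) z = y j * cnj (y j)"
      using X ev_cnj[of X z] cnj_root_unity[OF z'(2,1)] by simp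
    then have e: "ev (X * X \<circ>\<^sub>p monom 1 (d - 1)) z = of_real ((norm (y j))\<^sup>2)"
      by (simp only: complex_norm_square)
    obtain a b :: int where "(norm (y j))\<^sup>2 = of_int a / of_int b"
      using rat by (rule Rats_cases')
    then have "ev (X * X \<circ>\<^sub>p monom 1 (d - 1)) z = of_int a / of_int b" unfolding e by simp
    then have "ev (X * X \<circ>\<^sub>p monom 1 (d - 1)) z \<in> \<rat>" by simp
    then have "ev (X * X \<circ>\<^sub>p monom 1 (d - 1)) z \<in> \<int>" by (rule rational_ev_imp_int[OF z'(2,1)])
    then obtain a where "complex_of_real ((norm (y j))\<^sup>2) = of_real (of_int a)"
      unfolding e by (auto elim: Ints_cases)
    then have "(norm (y j))\<^sup>2 = of_int a" by (simp only: of_real_eq_iff)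
    then show ?thesis by simp
  qed
  obtain j n where j: "j \<in> {1..m}" and n: "(norm (y j))\<^sup>2 = real n" "lam \<le> n" "n dvd lam\<^sup>2"
    using large_integral_norm[OF assms(4) _ eq int] \<open>lam > 1\<close> by auto
  \<comment> \<open>The division is exact: every fibre of the character has this size, which bounds
    the number of elements of \<open>D j\<close> in it.\<close>
  define C where "C = v div d"
  have v: "d * card {a \<in> carrier G. \<chi> a = z ^ i} = v" for i
    using card_character_fibre[OF G(2) z g \<chi> \<chi>1 \<chi>d] D by (simp add: SEDF_def)
  then have vC: "v = d * C" unfolding C_def by (metis dvd_triv_left dvd_mult_div_cancel)
  have cC: "c j i \<le> C" for i
  proof -
    have "c j i \<le> card {a \<in> carrier G. \<chi> a = z ^ i}"
      unfolding c_def using Dl(1)[OF j] G(2) by (intro card_mono) auto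
    also have "\<dots> = C" using v[of i] vC z'(1) by simp
    finally show ?thesis .
  qed
  let ?F = "schmidt_F d lam"
  have "4 * real (totient ?F) * real n \<le> (real ?F)\<^sup>2 * (real C)\<^sup>2"
  proof (rule schmidt_field_descent_bound[OF z])
    show "d > 1" "n > 0" "lam > 1" using assms(6) n(2) \<open>lam > 1\<close> by auto
    show "q dvd lam" if "prime q" "q dvd n" for q
      using that n(3) by (meson dvd_trans prime_dvd_power)
    show "(norm (\<Sum>i<d. of_nat (c j i) * (z ^ s) ^ i))\<^sup>2 = real n" if "coprime s d" for s
      using n(1) by (intro norm_character_sum_conjugates[OF z that]) (simp add: y[OF j])
  qed (rule cC)
  moreover have "4 * real (totient ?F) * real lam \<le> 4 * real (totient ?F) * real n"
    using n(2) by (intro mult_left_mono) auto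
  ultimately have "4 * real (totient ?F) * real lam \<le> (real ?F)\<^sup>2 * (real C)\<^sup>2" by linarith
  \<comment> \<open>The factor \<open>2 ^ (t - 1)\<close> is inserted here, being at least
    1.\<close>
  also have "\<dots> \<le> (2 ^ (t - 1))\<^sup>2 * ((real ?F)\<^sup>2 * (real C)\<^sup>2)"
  proof -
    have "(1 :: real) \<le> (2 ^ (t - 1))\<^sup>2" by (simp add: one_le_power)
    then show ?thesis
      using mult_right_mono[of 1 "(2 ^ (t - 1))\<^sup>2" "(real ?F)\<^sup>2 * (real C)\<^sup>2"] by simp
  qed
  finally have bound: "4 * real (totient ?F) * real lam \<le> (2 ^ (t - 1))\<^sup>2 * (real C)\<^sup>2 * (real ?F)\<^sup>2"
    by (simp add: mult_ac)
  obtain b where adm: "schmidt_admissible d lam b"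
    and F_eq: "?F = (\<Prod>p\<in>prime_factors d. p ^ b p)"
    using schmidt_F_witness[of d lam] z'(1) \<open>lam > 1\<close> by auto
  have "totient ?F > 0" using F_pos[OF z'(1) adm F_eq] by simp
  then have "real lam \<le> (2 ^ (t - 1))\<^sup>2 * (real C)\<^sup>2 * (real ?F)\<^sup>2 / (4 * real (totient ?F))"
    using bound by (simp add: field_simps)
  also have "\<dots> = (2 ^ (t - 1) * real v)\<^sup>2 * (real ?F)\<^sup>2 / (4 * (real d)\<^sup>2 * real (totient ?F))"
    using z'(1) by (simp add: vC power_mult_distrib field_simps)
  finally show ?thesis .
qed simp

end
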